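(* Let $T>0$ and let $W_i^{b}(t)$, $i=1,2,\dots$, be i.i.d. copies of the stationary packet-emission process $W^{b}(t)$ described in the context. Let $$T_{n}^{b}(t)=\int_{0}^{t}\frac{1}{\sqrt{n}}\sum_{i=1}^{n}W_{i}^{b}(s)\,ds .$$ Then $$Z_{n}^{b}(t)=T_{n}^{b}(t)-\mathbf{E}\,T_{n}^{b}(t)\ \overset{W}{\longrightarrow}\ G^{b}(t),\qquad t\in[0,T],$$ as $n\to\infty$, where $G^{b}(t)$ is a centered Gaussian process with covariance structure $$\mathbf{Cov}(G^{b}(s),G^{b}(t))=\mathbf{E}\left(\int_{0}^{s}W_{1}^{b}(x)dx\int_{0}^{t}W_{1}^{b}(x)dx\right)-\mathbf{E}\left(\int_{0}^{s}W_{1}^{b}(x)dx\right)\mathbf{E}\left(\int_{0}^{t}W_{1}^{b}(x)dx\right).$$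
   Context: Packet-emission process. Consider the following mutually independent families (in $O_n^b$ below the subscript $n$ stands for "on" and is not an index). - $\{O_{f}^{b}(i)\}_{i\ge1}$: i.i.d. positive random variables (OFF-durations) with $\mathbf{E}\,O_f^b(1)^2<\infty$. - $\{L^{b}(i)\}_{i\ge1}$: i.i.d. positive integer-valued random variables (session loads) with $t^{p}\,\mathbf{P}(L^{b}(1)>t)\to C$ as $t\to\infty$, for some $p\in(1,2)$ and $0<C<\infty$. - $\{R^{b}_{i,j}\}_{i,j\ge1}$: i.i.d. random variables with $R^b_{i,j}\ge0$ a.s., $\mathbf{E}(R^b_{i,j})^2<\infty$ and $\lim_{\delta\to0}\delta^{-1}\mathbf{P}(R^b_{i,j}<\delta)\le M<\infty$ for some constant $M$; by convention $R^b_{i,0}=0$ a.s. Put $O_{n}^{b}(i)=\sum_{j=1}^{L^b(i)}R^{b}_{i,j}$. Let $\widehat\delta_x$ denote the unit Dirac delta at $x$ ($\widehat\delta_x(s)=0$ for $s\ne x$ and $\int_{x-h}^{x+h}\widehat\delta_x(s)ds=1$ for all $h>0$). Define $\widetilde{W}^{b}$ formally as $\widetilde W^b(t)=\widehat\delta_t(t)$, i.e. a unit delta at $t$, if $$t=\sum_{i=1}^{k-1}\left(O_{f}^{b}(i)+O_{n}^{b}(i)\right)+O_{f}^{b}(k)+\sum_{i=1}^{l}R^{b}_{k,i}$$ for some $k\ge1$ and some integer $0\le l\le L^{b}(k)$, and $\widetilde W^b(t)=0$ otherwise; thus $\int_s^t \widetilde W^b(x)dx$ counts the emission times in the interval. $W^{b}$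 is a stationary version of $\widetilde{W}^{b}$: let $u$ be uniformly distributed on $[0,O_f^b(1)+O_n^b(1)]$ and put $W^b(t)=\widetilde W^b(u+t)$. The $W_i^b$ are i.i.d. versions of $W^b$. $\overset{W}{\longrightarrow}$ denotes weak convergence in the sense of the finite dimensional distributions. *)

theory Defs
  imports "HOL-Probability.Probability"
begin

section \<open>Trains of unit deltas\<close>

text \<open>
  A formal sum of unit deltas at pairwise distinct times is represented by the set of these times.
  Its integral from \<open>a\<close> to \<open>b\<close> is the number of deltas in \<open>(a, b]\<close>; whether the end points
  are included is immaterial for the process below, since almost surely no delta sits at a
  prescribed time. (\<^const>\<open>card\<close> of an infinite set is 0, but the trains below are almost surely
  locally finite.)
\<close>

definition delta_integral :: "real \<Rightarrow> real \<Rightarrow> real set \<Rightarrow> real" where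
  "delta_integral a b S = real (card (S \<inter> {a<..b}))"

text \<open>The sigma-algebra generated by all integrals over windows in the half-line \<open>t \<ge> 0\<close>.\<close>

definition delta_trains :: "real set measure" where
  "delta_trains = sigma UNIV {delta_integral a b -` B | a b B. 0 \<le> a \<and> a \<le> b \<and> B \<in> sets borel}"

definition shift_train :: "real \<Rightarrow> real set \<Rightarrow> real set" where
  "shift_train u S = {t. u + t \<in> S}"


section \<open>The packet-emission process\<close>

text \<open>
  All sequences are indexed from 1. In the first two definitions \<open>f\<close>, \<open>l\<close>, \<open>r\<close> are realisations
  of the OFF-durations, the session loads and the gaps between packets.
\<close>

definition on_time :: "(nat \<Rightarrow> nat) \<Rightarrow> (nat \<Rightarrow> nat \<Rightarrow> real) \<Rightarrow> nat \<Rightarrow> real" where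
  "on_time l r i = (\<Sum>j=1..l i. r i j)"

definition emission_times :: "(nat \<Rightarrow> real) \<Rightarrow> (nat \<Rightarrow> nat) \<Rightarrow> (nat \<Rightarrow> nat \<Rightarrow> real) \<Rightarrow> real set" where
  "emission_times f l r =
     {(\<Sum>i\<in>{1..<k}. f i + on_time l r i) + f k + (\<Sum>j=1..m. r k j) | k m. 1 \<le> k \<and> m \<le> l k}"

datatype source_index = Off nat | Load nat | Gap nat nat

definition source_indices :: "source_index set" where
  "source_indices = Off ` {1..} \<union> Load ` {1..} \<union> {Gap i j | i j. 1 \<le> i \<and> 1 \<le> j}"

primrec source_var ::
  "(nat \<Rightarrow> 'a \<Rightarrow> real) \<Rightarrow> (nat \<Rightarrow> 'a \<Rightarrow> nat) \<Rightarrow> (nat \<Rightarrow> nat \<Rightarrow> 'a \<Rightarrow> real) \<Rightarrow> source_index \<Rightarrow> 'a \<Rightarrow> real"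
where
  "source_var Of L R (Off i) = Of i"
| "source_var Of L R (Load i) = (\<lambda>\<omega>. real (L i \<omega>))"
| "source_var Of L R (Gap i j) = R i j"

definition first_cycle ::
  "(nat \<Rightarrow> 'a \<Rightarrow> real) \<Rightarrow> (nat \<Rightarrow> 'a \<Rightarrow> nat) \<Rightarrow> (nat \<Rightarrow> nat \<Rightarrow> 'a \<Rightarrow> real) \<Rightarrow> 'a \<Rightarrow> real" where
  "first_cycle Of L R \<omega> = Of 1 \<omega> + on_time (\<lambda>i. L i \<omega>) (\<lambda>i j. R i j \<omega>) 1"

text \<open>
  Joint laws of the sample point \<open>\<omega>\<close> and a starting time \<open>u\<close> in \<open>[0, Y \<omega>]\<close>. Under the first,
  \<open>\<omega>\<close> has law \<open>M\<close> and, given \<open>\<omega>\<close>, \<open>u\<close> is uniform on \<open>[0, Y \<omega>]\<close>. Under the second, the pair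
  is uniform on the region \<open>0 \<le> u \<le> Y \<omega>\<close>, i.e. given \<open>\<omega>\<close>, \<open>u\<close> is again uniform on
  \<open>[0, Y \<omega>]\<close>, but the law of \<open>\<omega>\<close> is weighted by \<open>Y\<close>. For a renewal sequence of cycles with first
  cycle length \<open>Y\<close> it is this length-biased version that makes the process seen from \<open>u\<close> stationary.
\<close>

definition uniform_start :: "'a measure \<Rightarrow> ('a \<Rightarrow> real) \<Rightarrow> ('a \<times> real) measure" where
  "uniform_start M Y =
     density (M \<Otimes>\<^sub>M lborel) (\<lambda>(\<omega>, u). indicator {0..Y \<omega>} u / ennreal (Y \<omega>))"

definition length_biased_start :: "'a measure \<Rightarrow> ('a \<Rightarrow> real) \<Rightarrow> ('a \<times> real) measure" where
  "length_biased_start M Y =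
     density (M \<Otimes>\<^sub>M lborel) (\<lambda>(\<omega>, u). indicator {0..Y \<omega>} u / ennreal (integral\<^sup>L M Y))"

definition packet_law ::
  "('a \<times> real) measure \<Rightarrow> (nat \<Rightarrow> 'a \<Rightarrow> real) \<Rightarrow> (nat \<Rightarrow> 'a \<Rightarrow> nat) \<Rightarrow> (nat \<Rightarrow> nat \<Rightarrow> 'a \<Rightarrow> real)
     \<Rightarrow> real set measure" where
  "packet_law Q Of L R = distr Q delta_trains
     (\<lambda>(\<omega>, u). shift_train u (emission_times (\<lambda>i. Of i \<omega>) (\<lambda>i. L i \<omega>) (\<lambda>i j. R i j \<omega>)))"


section \<open>Aggregated traffic\<close>

definition aggregate :: "(nat \<Rightarrow> 'b \<Rightarrow> real set) \<Rightarrow> nat \<Rightarrow> real \<Rightarrow> 'b \<Rightarrow> real" where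
  "aggregate W n t \<omega> = (1 / sqrt (real n)) * (\<Sum>i=1..n. delta_integral 0 t (W i \<omega>))"

definition centered_aggregate ::
  "'b measure \<Rightarrow> (nat \<Rightarrow> 'b \<Rightarrow> real set) \<Rightarrow> nat \<Rightarrow> real \<Rightarrow> 'b \<Rightarrow> real" where
  "centered_aggregate P W n t \<omega> = aggregate W n t \<omega> - integral\<^sup>L P (aggregate W n t)"


section \<open>Gaussian processes and convergence of finite dimensional distributions\<close>

definition normal_rv :: "'c measure \<Rightarrow> ('c \<Rightarrow> real) \<Rightarrow> bool" where
  "normal_rv N X \<longleftrightarrow> X \<in> borel_measurable N \<and>
     (\<exists>m. distr N borel X = return borel m \<or>
          (\<exists>\<sigma>>0. distributed N lborel X (\<lambda>x. ennreal (normal_density m \<sigma> x))))"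

definition covariance :: "'c measure \<Rightarrow> ('c \<Rightarrow> real) \<Rightarrow> ('c \<Rightarrow> real) \<Rightarrow> real" where
  "covariance N X Y =
     integral\<^sup>L N (\<lambda>\<omega>. (X \<omega> - integral\<^sup>L N X) * (Y \<omega> - integral\<^sup>L N Y))"

definition centered_gaussian_process ::
  "'c measure \<Rightarrow> real set \<Rightarrow> (real \<Rightarrow> 'c \<Rightarrow> real) \<Rightarrow> (real \<Rightarrow> real \<Rightarrow> real) \<Rightarrow> bool" where
  "centered_gaussian_process N I G \<Gamma> \<longleftrightarrow>
     prob_space N \<and>
     (\<forall>J c. finite J \<and> J \<subseteq> I \<longrightarrow> normal_rv N (\<lambda>\<omega>. \<Sum>t\<in>J. c t * G t \<omega>)) \<and>
     (\<forall>t\<in>I. integral\<^sup>L N (G t) = 0) \<and>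
     (\<forall>s\<in>I. \<forall>t\<in>I. covariance N (G s) (G t) = \<Gamma> s t)"

text \<open>
  Weak convergence of all vectors indexed by a finite \<open>J \<subseteq> I\<close>, tested against bounded continuous
  functions on the space of real functions on \<open>J\<close>.
\<close>

definition fdd_converges ::
  "'b measure \<Rightarrow> (nat \<Rightarrow> real \<Rightarrow> 'b \<Rightarrow> real) \<Rightarrow> real set \<Rightarrow> 'c measure \<Rightarrow> (real \<Rightarrow> 'c \<Rightarrow> real) \<Rightarrow> bool"
where
  "fdd_converges P Z I N G \<longleftrightarrow>
     (\<forall>J f. finite J \<and> J \<subseteq> I \<and>
        continuous_map (product_topology (\<lambda>_. euclideanreal) J) euclideanreal f \<and> bounded (f ` (J \<rightarrow>\<^sub>E UNIV)) \<longrightarrow>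
        (\<lambda>n. integral\<^sup>L P (\<lambda>\<omega>. f (\<lambda>t\<in>J. Z n t \<omega>)))
          \<longlonglongrightarrow> integral\<^sup>L N (\<lambda>\<omega>. f (\<lambda>t\<in>J. G t \<omega>)))"

end

theory Submission
  imports Defs
begin

text \<open>
  Once the number of packets in \<open>(0, t]\<close> has a finite second moment, the theorem is the
  multivariate central limit theorem for the independent copies. Linear combinations are treated by
  the one-dimensional theorem, which gives the limit of all characteristic functions; the step from
  there to bounded continuous functions is Stone--Weierstrass on a box, applied to trigonometric
  polynomials that are invariant under folding the space onto the box, with the mass outside the box
  controlled by the variances. The same statement shows that a law is determined by
  its characteristic function, which makes the Gaussian laws consistent, and the Gaussian process
  then comes from Kolmogorov's extension theorem.

  For the second moment, the packets in \<open>(u, u + t]\<close> are split into those of the first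
  cycle and those of later cycles. Events such as \<open>S \<le> t\<close>, for a sum \<open>S\<close>
  of \<open>n\<close> independent OFF-durations and gaps, have indicators at most \<open>exp (t - S)\<close>, so their
  probabilities decay geometrically. For the first cycle this is
  combined with the integration over the starting time \<open>u\<close>: two packets are in a common window for a
  set of times of measure at most \<open>t\<close>, and only if the time between them is at most \<open>t\<close>. What remains is
  a multiple of \<open>\<Sum>i. P (i \<le> L 1)\<close>, which is finite because \<open>1 < p\<close>.
\<close>

section \<open>Trigonometric polynomials\<close>

text \<open>Two obstacles shape the argument. A trigonometric polynomial that is close to a function
  on a box may be huge outside it. Invariance under folding makes all its values occur on the box,
  so outside the error grows by at most twice the bound of the function. For the moments,
  \<open>p < 2\<close> gives the load infinite variance, so the packets of the first cycle cannot
  simply be counted and squared. Integrating over \<open>u\<close> first makes the cost linear in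
  the load: each packet has only boundedly many close neighbours on average. The uniform start
  brings a second difficulty, a weight equal to the reciprocal of the cycle length. Cycles shorter
  than 1 are therefore compared with the number of gap sums that are at most 1, a quantity
  independent of the load. The geometric ratios are Laplace transforms at 1. They are below 1 for
  variables that are nonnegative and not almost surely 0, which for the gaps is what the small-ball
  hypothesis supplies.\<close>

inductive_set trig_poly :: "'i set \<Rightarrow> (('i \<Rightarrow> real) \<Rightarrow> real) set" for J where
  cos: "(\<lambda>x. a * cos ((\<Sum>j\<in>J. c j * x j) + b)) \<in> trig_poly J"
| add: "\<phi> \<in> trig_poly J \<Longrightarrow> \<psi> \<in> trig_poly J \<Longrightarrow> (\<lambda>x. \<phi> x + \<psi> x) \<in> trig_poly J"

lemma trig_poly_const: "(\<lambda>_. a) \<in> trig_poly J"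
  using trig_poly.cos[of a "\<lambda>_. 0" J 0] by simp

lemma trig_poly_sin:
  assumes "finite J" "i \<in> J"
  shows "(\<lambda>x. sin (k * x i)) \<in> trig_poly J"
proof -
  have "(\<Sum>j\<in>J. (if j = i then k else 0) * x j) = k * x i" for x :: "'a \<Rightarrow> real"
    using assms by (simp add: if_distrib[of "\<lambda>y. y * _"] cong: if_cong)
  then show ?thesis
    \<comment> \<open>A sine is a cosine with phase \<open>- (pi/2)\<close>; the free phase in the
      generators lets one family cover sines and constants too.\<close>
    using trig_poly.cos[of 1 "\<lambda>j. if j = i then k else 0" J "- (pi/2)"]
    by (simp add: cos_diff)
qed

text \<open>The product-to-sum formula turns two generators into a sum of two, with frequencies and
  phases subtracted and added. The span is thus an algebra, as Stone-Weierstrass requires.\<close>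

lemma trig_poly_mult:
  assumes "\<phi> \<in> trig_poly J" "\<psi> \<in> trig_poly J"
  shows "(\<lambda>x. \<phi> x * \<psi> x) \<in> trig_poly J"
  using assms
proof (induction \<phi>)
  case (cos a c b)
  from cos show ?case
  proof (induction \<psi>)
    case (cos a' c' b')
    have "a * cos ((\<Sum>j\<in>J. c j * x j) + b) * (a' * cos ((\<Sum>j\<in>J. c' j * x j) + b')) =
      (a * a' / 2) * cos ((\<Sum>j\<in>J. (c j - c' j) * x j) + (b - b')) +
      (a * a' / 2) * cos ((\<Sum>j\<in>J. (c j + c' j) * x j) + (b + b'))" for x
    proof -
      have e: "(\<Sum>j\<in>J. (c j - c' j) * x j) + (b - b') = ((\<Sum>j\<in>J. c j * x j) + b) - ((\<Sum>j\<in>J. c' j * x j) + b')"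
        "(\<Sum>j\<in>J. (c j + c' j) * x j) + (b + b') = ((\<Sum>j\<in>J. c j * x j) + b) + ((\<Sum>j\<in>J. c' j * x j) + b')"
        by (simp_all add: algebra_simps sum_subtractf sum.distrib)
      show ?thesis
        unfolding e cos_diff cos_add by (simp add: algebra_simps)
    qed
    then show ?case
      by (simp only: trig_poly.add[OF trig_poly.cos trig_poly.cos])
  next
    case (add \<phi> \<psi>)
    show ?case
      unfolding distrib_left by (intro trig_poly.add add)
  qed
next
  case (add \<phi>1 \<phi>2)
  show ?case
    unfolding distrib_right by (intro trig_poly.add add)
qed

lemma trig_poly_continuous:
  fixes J :: "'i::countable set"
  shows "\<phi> \<in> trig_poly J \<Longrightarrow> continuous_on S \<phi>"
proof (induction rule: trig_poly.induct)
  case (cos a c b)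
  have "continuous_on S (\<lambda>x :: 'i \<Rightarrow> real. x j)" for j
    by (rule continuous_on_subset[OF continuous_on_product_coordinates subset_UNIV])
  then show ?case
    by (intro continuous_intros)
qed (intro continuous_intros)

lemma trig_poly_cong:
  assumes "\<phi> \<in> trig_poly J" "\<And>j. j \<in> J \<Longrightarrow> x j = y j"
  shows "\<phi> x = \<phi> y"
  using assms(1)
proof (induction rule: trig_poly.induct)
  case (cos a c b)
  have "(\<Sum>j\<in>J. c j * x j) = (\<Sum>j\<in>J. c j * y j)"
    using assms(2) by (intro sum.cong) auto
  then show ?case by simp
qed simp

lemma trig_poly_bounded:
  assumes "\<phi> \<in> trig_poly J"
  obtains K where "\<And>x. \<bar>\<phi> x\<bar> \<le> K"
proof -
  from assms have "\<exists>K. \<forall>x. \<bar>\<phi> x\<bar> \<le> K"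
  proof induction
    case (cos a c b)
    show ?case by (rule exI[of _ "\<bar>a\<bar>"]) (auto simp: abs_mult intro!: mult_left_le)
  next
    case (add \<phi> \<psi>)
    then obtain K K' where *: "\<And>x. \<bar>\<phi> x\<bar> \<le> K" "\<And>x. \<bar>\<psi> x\<bar> \<le> K'" by blast
    have "\<bar>\<phi> x + \<psi> x\<bar> \<le> K + K'" for x
      using *[of x] by linarith
    then show ?case by blast
  qed
  then show ?thesis using that by blast
qed

text \<open>
  The piecewise linear map of period \<open>4 * A\<close> folding the line onto \<open>{-A..A}\<close>.
\<close>

definition fold_coord :: "real \<Rightarrow> real \<Rightarrow> real" where
  "fold_coord A y = (2 * A / pi) * arcsin (sin (pi / (2 * A) * y))"

lemma fold_coord_bound: "0 < A \<Longrightarrow> \<bar>fold_coord A y\<bar> \<le> A"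
  using arcsin_bounded[of "sin (pi / (2 * A) * y)"]
  by (auto simp: fold_coord_def abs_mult field_simps abs_le_iff)

lemma fold_coord_id: "0 < A \<Longrightarrow> \<bar>y\<bar> \<le> A \<Longrightarrow> fold_coord A y = y"
proof -
  assume A: "0 < A" and y: "\<bar>y\<bar> \<le> A"
  have "\<bar>y / A\<bar> \<le> 1" using A y by (simp add: abs_divide)
  then have "\<bar>y / A\<bar> * (pi / 2) \<le> 1 * (pi / 2)"
    by (intro mult_right_mono) auto
  then have "\<bar>pi / (2 * A) * y\<bar> \<le> pi / 2"
    by (simp add: abs_mult abs_divide mult.commute)
  then have "arcsin (sin (pi / (2 * A) * y)) = pi / (2 * A) * y"
    by (intro arcsin_sin) (simp_all only: abs_le_iff, linarith)
  then show ?thesis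
    unfolding fold_coord_def using A by simp
qed

text \<open>This sine is unchanged by folding, and on \<open>{-A..A}\<close> it is injective because
  \<open>arcsin\<close> recovers the point: the two properties wanted of generators for the algebra
  on the box.\<close>

lemma sin_fold_coord: "0 < A \<Longrightarrow> sin (pi / (2 * A) * fold_coord A y) = sin (pi / (2 * A) * y)"
  by (simp add: fold_coord_def)

text \<open>Inside the box folding fixes the coordinates in \<open>J\<close>. Outside,
  \<open>F x\<close> and \<open>F (fd x)\<close> differ by at most \<open>2 * B\<close>, and the sum
  of squares is at least 1: a Chebyshev majorant, to be integrated against second moments.\<close>

lemma trig_poly_approximation:
  fixes F :: "('i::countable \<Rightarrow> real) \<Rightarrow> real"
  assumes J: "finite J" and F: "continuous_on UNIV F"
    and F_cong: "\<And>x y. (\<And>j. j \<in> J \<Longrightarrow> x j = y j) \<Longrightarrow> F x = F y"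
    and F_le: "\<And>x. \<bar>F x\<bar> \<le> B"
    and A: "0 < A" and e: "0 < e"
  obtains \<phi> where "\<phi> \<in> trig_poly J" "\<And>x. \<bar>F x - \<phi> x\<bar> \<le> e + 2 * B * (\<Sum>j\<in>J. (x j / A)\<^sup>2)"
proof -
  define fd where "fd x = (\<lambda>j. if j \<in> J then fold_coord A (x j) else 0)" for x :: "'i \<Rightarrow> real"
  \<comment> \<open>Coordinates outside \<open>J\<close> are pinned to 0, so the product over the
    whole index type is compact and two points of \<open>S\<close> can differ only inside
    \<open>J\<close>.\<close>
  define S where "S = PiE UNIV (\<lambda>j. if j \<in> J then {-A..A} else {0})"
  \<comment> \<open>The subalgebra of polynomials invariant under folding: an estimate for them on
    \<open>S\<close> extends to every \<open>x\<close> through \<open>fd x\<close>.\<close>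
  define Q where "Q \<phi> \<longleftrightarrow> \<phi> \<in> trig_poly J \<and> (\<forall>x. \<phi> (fd x) = \<phi> x)" for \<phi>
  have "compactin (product_topology (\<lambda>_. euclidean) UNIV) S"
    unfolding S_def compactin_PiE by auto
  then have "compact S"
    by (simp add: euclidean_product_topology)
  have sep: "\<exists>\<phi>. Q \<phi> \<and> \<phi> x \<noteq> \<phi> y" if "x \<in> S \<and> y \<in> S \<and> x \<noteq> y" for x y
  proof -
    from that obtain j where j: "x j \<noteq> y j" by blast
    have "j \<in> J"
      using that j by (force simp: S_def PiE_iff split: if_splits)
    then have b: "\<bar>x j\<bar> \<le> A" "\<bar>y j\<bar> \<le> A"
      using that by (force simp: S_def PiE_iff abs_le_iff split: if_splits)+
    let ?\<phi> = "\<lambda>x. sin (pi / (2 * A) * x j)"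
    have "Q ?\<phi>"
      unfolding Q_def using trig_poly_sin[OF J \<open>j \<in> J\<close>, of "pi / (2 * A)"] sin_fold_coord[OF A] \<open>j \<in> J\<close>
      by (simp add: fd_def)
    moreover have "?\<phi> x \<noteq> ?\<phi> y"
      using j fold_coord_id[OF A b(1)] fold_coord_id[OF A b(2)] by (metis fold_coord_def)
    ultimately show ?thesis by blast
  qed
  have "\<exists>\<phi>. Q \<phi> \<and> (\<forall>x\<in>S. \<bar>F x - \<phi> x\<bar> < e)"
  proof (rule Stone_Weierstrass_HOL[OF \<open>compact S\<close>])
    show "Q (\<lambda>x. c)" for c by (simp add: Q_def trig_poly_const)
    show "continuous_on S f" if "Q f" for f using that by (auto simp: Q_def intro: trig_poly_continuous)
    show "Q (\<lambda>x. f x + g x)" if "Q f \<and> Q g" for f g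
      using that by (auto simp: Q_def intro: trig_poly.add)
    show "Q (\<lambda>x. f x * g x)" if "Q f \<and> Q g" for f g
      using that by (auto simp: Q_def intro: trig_poly_mult)
  qed (use sep F e in \<open>auto intro: continuous_on_subset\<close>)
  then obtain \<phi> where \<phi>: "\<phi> \<in> trig_poly J" "\<And>x. \<phi> (fd x) = \<phi> x" "\<And>x. x \<in> S \<Longrightarrow> \<bar>F x - \<phi> x\<bar> < e"
    unfolding Q_def by blast
  have B: "0 \<le> B" using F_le[of undefined] by linarith
  have "\<bar>F x - \<phi> x\<bar> \<le> e + 2 * B * (\<Sum>j\<in>J. (x j / A)\<^sup>2)" for x
  proof -
    have "fd x \<in> S"
      using fold_coord_bound[OF A] by (auto simp: fd_def S_def abs_le_iff minus_le_iff)
    then have 1: "\<bar>F (fd x) - \<phi> x\<bar> < e"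
      using \<phi>(2,3) by metis
    show ?thesis
    proof (cases "\<forall>j\<in>J. \<bar>x j\<bar> \<le> A")
      case True
      then have "F (fd x) = F x"
        by (intro F_cong) (auto simp: fd_def fold_coord_id[OF A])
      moreover have "0 \<le> 2 * B * (\<Sum>j\<in>J. (x j / A)\<^sup>2)"
        using B by (auto intro!: mult_nonneg_nonneg sum_nonneg)
      ultimately show ?thesis using 1 by simp
    next
      case False
      then obtain i where i: "i \<in> J" "A < \<bar>x i\<bar>" by auto
      have "1 < \<bar>x i / A\<bar>" using i A by (simp add: abs_divide)
      then have "1 \<le> (x i / A)\<^sup>2"
        by (metis abs_1 abs_le_square_iff less_imp_le one_power2)
      also have "\<dots> \<le> (\<Sum>j\<in>J. (x j / A)\<^sup>2)"
        using J i by (intro member_le_sum) auto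
      finally have "2 * B * 1 \<le> 2 * B * (\<Sum>j\<in>J. (x j / A)\<^sup>2)"
        using B by (intro mult_left_mono) auto
      then show ?thesis
        using 1 F_le[of x] F_le[of "fd x"] by linarith
    qed
  qed
  with \<phi>(1) show thesis by (rule that)
qed

section \<open>Weak convergence from characteristic functions\<close>

lemma trig_poly_measurable:
  assumes \<phi>: "\<phi> \<in> trig_poly J" and X: "\<And>t. t \<in> J \<Longrightarrow> X t \<in> borel_measurable M"
  shows "(\<lambda>\<omega>. \<phi> (\<lambda>t. X t \<omega>)) \<in> borel_measurable M"
  using \<phi>
proof induction
  case (cos a c b)
  have "(\<lambda>\<omega>. \<Sum>j\<in>J. c j * X j \<omega>) \<in> borel_measurable M"
    using X by (intro borel_measurable_sum borel_measurable_times) auto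
  then show ?case by measurable
qed measurable

lemma trig_poly_integrable:
  assumes D: "prob_space D" and \<phi>: "\<phi> \<in> trig_poly J"
    and Y: "\<And>t. t \<in> J \<Longrightarrow> Y t \<in> borel_measurable D"
  shows "integrable D (\<lambda>\<omega>. \<phi> (\<lambda>t. Y t \<omega>))"
proof -
  interpret prob_space D by fact
  obtain K where "\<And>x. \<bar>\<phi> x\<bar> \<le> K" using trig_poly_bounded[OF \<phi>] by blast
  then show ?thesis
    using trig_poly_measurable[OF \<phi> Y] by (intro integrable_const_bound[where B=K]) auto
qed

text \<open>The phase factors out of the exponential, so convergence of characteristic functions
  passes to each generator of the trigonometric polynomials.\<close>

lemma integral_cos_eq_Re:
  assumes D: "prob_space D" and Y: "Y \<in> borel_measurable D"
  shows "(LINT \<omega>|D. a * cos (Y \<omega> + b)) = a * Re (iexp b * (CLINT \<omega>|D. iexp (Y \<omega>)))"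
proof -
  interpret prob_space D by fact
  have int: "complex_integrable D (\<lambda>\<omega>. iexp (Y \<omega>))"
    using Y by (intro integrable_const_bound[where B=1]) auto
  have "a * cos (S + b) = a * Re (iexp b * iexp S)" for S
    by (simp add: cos_add Re_exp Im_exp mult.commute)
  moreover have "(LINT \<omega>|D. Re (iexp b * iexp (Y \<omega>))) = Re (CLINT \<omega>|D. iexp b * iexp (Y \<omega>))"
    using int by (intro integral_Re integrable_mult_right)
  ultimately show ?thesis
    by (simp only: integral_mult_right_zero)
qed

lemma trig_poly_expectation_tendsto:
  fixes P :: "nat \<Rightarrow> 'b measure" and Z :: "nat \<Rightarrow> 'i \<Rightarrow> 'b \<Rightarrow> real"
  assumes \<phi>: "\<phi> \<in> trig_poly J"
    and P: "\<And>n. prob_space (P n)" and N: "prob_space N"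
    and Z: "\<And>n t. t \<in> J \<Longrightarrow> Z n t \<in> borel_measurable (P n)"
    and G: "\<And>t. t \<in> J \<Longrightarrow> G t \<in> borel_measurable N"
    and char: "\<And>c. (\<lambda>n. CLINT \<omega>|P n. iexp (\<Sum>t\<in>J. c t * Z n t \<omega>)) \<longlonglongrightarrow>
                    (CLINT \<omega>|N. iexp (\<Sum>t\<in>J. c t * G t \<omega>))"
  shows "(\<lambda>n. LINT \<omega>|P n. \<phi> (\<lambda>t. Z n t \<omega>)) \<longlonglongrightarrow> (LINT \<omega>|N. \<phi> (\<lambda>t. G t \<omega>))"
  using \<phi>
proof induction
  case (cos a c b)
  have *: "(LINT \<omega>|P n. a * cos ((\<Sum>t\<in>J. c t * Z n t \<omega>) + b)) =
      a * Re (iexp b * (CLINT \<omega>|P n. iexp (\<Sum>t\<in>J. c t * Z n t \<omega>)))" for n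
    using Z by (intro integral_cos_eq_Re P borel_measurable_sum borel_measurable_times) auto
  have **: "(LINT \<omega>|N. a * cos ((\<Sum>t\<in>J. c t * G t \<omega>) + b)) =
      a * Re (iexp b * (CLINT \<omega>|N. iexp (\<Sum>t\<in>J. c t * G t \<omega>)))"
    using G by (intro integral_cos_eq_Re N borel_measurable_sum borel_measurable_times) auto
  show ?case
    unfolding * ** by (intro tendsto_intros char)
next
  case (add \<phi> \<psi>)
  have "(LINT \<omega>|P n. \<phi> (\<lambda>t. Z n t \<omega>) + \<psi> (\<lambda>t. Z n t \<omega>)) =
      (LINT \<omega>|P n. \<phi> (\<lambda>t. Z n t \<omega>)) + (LINT \<omega>|P n. \<psi> (\<lambda>t. Z n t \<omega>))" for n
    by (rule Bochner_Integration.integral_add; rule trig_poly_integrable[where Y="Z n"]) (use P Z add in auto)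
  moreover have "(LINT \<omega>|N. \<phi> (\<lambda>t. G t \<omega>) + \<psi> (\<lambda>t. G t \<omega>)) =
      (LINT \<omega>|N. \<phi> (\<lambda>t. G t \<omega>)) + (LINT \<omega>|N. \<psi> (\<lambda>t. G t \<omega>))"
    by (rule Bochner_Integration.integral_add; rule trig_poly_integrable[where Y=G]) (use N G add in auto)
  ultimately show ?case
    using add.IH by (simp only: tendsto_add)
qed

lemma integral_diff_trig_poly_le:
  fixes F :: "('i::countable \<Rightarrow> real) \<Rightarrow> real"
  assumes J: "finite J" and F: "continuous_on UNIV F"
    and F_cong: "\<And>x y. (\<And>j. j \<in> J \<Longrightarrow> x j = y j) \<Longrightarrow> F x = F y"
    and F_le: "\<And>x. \<bar>F x\<bar> \<le> B"
    and \<phi>: "\<phi> \<in> trig_poly J" "\<And>x. \<bar>F x - \<phi> x\<bar> \<le> e + 2 * B * (\<Sum>j\<in>J. (x j / A)\<^sup>2)"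
    and D: "prob_space D" and Y: "\<And>t. t \<in> J \<Longrightarrow> Y t \<in> borel_measurable D"
    and Y2: "\<And>t. t \<in> J \<Longrightarrow> integrable D (\<lambda>\<omega>. (Y t \<omega>)\<^sup>2)"
      "\<And>t. t \<in> J \<Longrightarrow> (LINT \<omega>|D. (Y t \<omega>)\<^sup>2) \<le> V"
  shows "\<bar>(LINT \<omega>|D. F (\<lambda>t. Y t \<omega>)) - (LINT \<omega>|D. \<phi> (\<lambda>t. Y t \<omega>))\<bar> \<le>
    e + 2 * B * (real (card J) * V / A\<^sup>2)"
proof -
  interpret prob_space D by fact
  have B: "0 \<le> B" using F_le[of undefined] by linarith
  \<comment> \<open>Coordinates outside \<open>J\<close> carry no measurability. Setting them to 0
    makes the whole random function measurable, and neither \<open>F\<close> nor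
    \<open>\<phi>\<close> sees the change.\<close>
  define Y' where "Y' t = (if t \<in> J then Y t else (\<lambda>_. 0))" for t
  have eq: "F (\<lambda>t. Y t \<omega>) = F (\<lambda>t. Y' t \<omega>)" "\<phi> (\<lambda>t. Y t \<omega>) = \<phi> (\<lambda>t. Y' t \<omega>)" for \<omega>
    by (auto simp: Y'_def intro: F_cong trig_poly_cong[OF \<phi>(1)])
  have Y': "Y' t \<in> borel_measurable D" for t
    using Y by (simp add: Y'_def)
  then have "(\<lambda>\<omega>. (\<lambda>t. Y' t \<omega>)) \<in> borel_measurable D"
    by (rule measurable_coordinatewise_then_product)
  then have "(\<lambda>\<omega>. F (\<lambda>t. Y' t \<omega>)) \<in> borel_measurable D"
    by (rule measurable_compose[OF _ borel_measurable_continuous_onI[OF F]])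
  then have int: "integrable D (\<lambda>\<omega>. F (\<lambda>t. Y' t \<omega>))"
    using F_le by (intro integrable_const_bound[where B=B]) auto
  have int': "integrable D (\<lambda>\<omega>. \<phi> (\<lambda>t. Y' t \<omega>))"
    by (rule trig_poly_integrable[OF D \<phi>(1) Y'])
  have int2: "integrable D (\<lambda>\<omega>. (Y t \<omega> / A)\<^sup>2)" if "t \<in> J" for t
    using Y2(1)[OF that] by (simp add: power_divide)
  have le: "(LINT \<omega>|D. (Y t \<omega> / A)\<^sup>2) \<le> V / A\<^sup>2" if "t \<in> J" for t
    using Y2(2)[OF that] by (simp add: power_divide divide_right_mono)
  have "\<bar>(LINT \<omega>|D. F (\<lambda>t. Y t \<omega>)) - (LINT \<omega>|D. \<phi> (\<lambda>t. Y t \<omega>))\<bar> =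
      \<bar>LINT \<omega>|D. F (\<lambda>t. Y' t \<omega>) - \<phi> (\<lambda>t. Y' t \<omega>)\<bar>"
    unfolding eq using int int' by simp
  also have "\<dots> \<le> (LINT \<omega>|D. \<bar>F (\<lambda>t. Y' t \<omega>) - \<phi> (\<lambda>t. Y' t \<omega>)\<bar>)"
    by (rule integral_abs_bound)
  also have "\<dots> \<le> (LINT \<omega>|D. e + 2 * B * (\<Sum>t\<in>J. (Y t \<omega> / A)\<^sup>2))"
  proof (rule integral_mono)
    show "integrable D (\<lambda>\<omega>. e + 2 * B * (\<Sum>t\<in>J. (Y t \<omega> / A)\<^sup>2))"
      using int2 by (intro Bochner_Integration.integrable_add integrable_mult_right
        Bochner_Integration.integrable_sum) auto
    show "integrable D (\<lambda>\<omega>. \<bar>F (\<lambda>t. Y' t \<omega>) - \<phi> (\<lambda>t. Y' t \<omega>)\<bar>)"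
      using int int' by (intro integrable_abs Bochner_Integration.integrable_diff)
  qed (simp only: eq[symmetric] \<phi>(2))
  also have "\<dots> = e + 2 * B * (\<Sum>t\<in>J. LINT \<omega>|D. (Y t \<omega> / A)\<^sup>2)"
    using int2 by (subst Bochner_Integration.integral_add)
      (auto intro!: integrable_mult_right simp: prob_space Bochner_Integration.integral_sum)
  also have "\<dots> \<le> e + 2 * B * (\<Sum>t\<in>J. V / A\<^sup>2)"
    using le B by (intro add_left_mono mult_left_mono sum_mono) auto
  finally show ?thesis by simp
qed

text \<open>Second moments bounded uniformly in \<open>n\<close> play the part of tightness: one
  box, and hence one polynomial, serves all the laws and the limit.\<close>

lemma bounded_continuous_expectation_tendsto:
  fixes P :: "nat \<Rightarrow> 'b measure" and Z :: "nat \<Rightarrow> 'i::countable \<Rightarrow> 'b \<Rightarrow> real"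
    and F :: "('i \<Rightarrow> real) \<Rightarrow> real"
  assumes J: "finite J" and F: "continuous_on UNIV F"
    and F_cong: "\<And>x y. (\<And>j. j \<in> J \<Longrightarrow> x j = y j) \<Longrightarrow> F x = F y"
    and F_le: "\<And>x. \<bar>F x\<bar> \<le> B"
    and P: "\<And>n. prob_space (P n)" and N: "prob_space N"
    and Z: "\<And>n t. t \<in> J \<Longrightarrow> Z n t \<in> borel_measurable (P n)"
    and G: "\<And>t. t \<in> J \<Longrightarrow> G t \<in> borel_measurable N"
    and Z2: "\<And>n t. t \<in> J \<Longrightarrow> integrable (P n) (\<lambda>\<omega>. (Z n t \<omega>)\<^sup>2)"
      "\<And>n t. t \<in> J \<Longrightarrow> (LINT \<omega>|P n. (Z n t \<omega>)\<^sup>2) \<le> V"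
    and G2: "\<And>t. t \<in> J \<Longrightarrow> integrable N (\<lambda>\<omega>. (G t \<omega>)\<^sup>2)"
      "\<And>t. t \<in> J \<Longrightarrow> (LINT \<omega>|N. (G t \<omega>)\<^sup>2) \<le> V"
    and char: "\<And>c. (\<lambda>n. CLINT \<omega>|P n. iexp (\<Sum>t\<in>J. c t * Z n t \<omega>)) \<longlonglongrightarrow>
                    (CLINT \<omega>|N. iexp (\<Sum>t\<in>J. c t * G t \<omega>))"
  shows "(\<lambda>n. LINT \<omega>|P n. F (\<lambda>t. Z n t \<omega>)) \<longlonglongrightarrow> (LINT \<omega>|N. F (\<lambda>t. G t \<omega>))"
proof (rule tendstoI)
  fix e :: real assume e: "0 < e"
  have B: "0 \<le> B" using F_le[of undefined] by linarith
  \<comment> \<open>\<open>V\<close> may be negative when \<open>J\<close> is empty, hence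
    \<open>V'\<close>. The factor 12 in \<open>A\<close> brings the mass term down to
    \<open>e / 6\<close>; with the approximation error \<open>e / 6\<close>, each of the two laws
    costs \<open>e / 3\<close>, and \<open>e / 3\<close> is left for the polynomial. The summand 1
    keeps \<open>A\<close> positive when the other term vanishes.\<close>
  define V' where "V' = max V 0"
  define A where "A = sqrt (1 + 12 * B * real (card J) * V' / e)"
  have A: "0 < A" "A\<^sup>2 = 1 + 12 * B * real (card J) * V' / e"
    using B e unfolding A_def V'_def by (auto simp: add_pos_nonneg)
  have A_le: "2 * B * (real (card J) * V' / A\<^sup>2) \<le> e / 6"
  proof -
    have "12 * B * real (card J) * V' \<le> e * A\<^sup>2"
      unfolding A(2) using e by (simp add: field_simps)
    then show ?thesis
      using A(1) by (simp add: field_simps)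
  qed
  obtain \<phi> where \<phi>: "\<phi> \<in> trig_poly J" 
      "\<And>x. \<bar>F x - \<phi> x\<bar> \<le> e / 6 + 2 * B * (\<Sum>j\<in>J. (x j / A)\<^sup>2)"
    using trig_poly_approximation[OF J F F_cong F_le A(1), of "e/6"] e by auto
  have A_le': "e / 6 + 2 * B * (real (card J) * V / A\<^sup>2) \<le> e / 3"
  proof -
    have "2 * B * (real (card J) * V / A\<^sup>2) \<le> 2 * B * (real (card J) * V' / A\<^sup>2)"
      using B unfolding V'_def by (intro mult_left_mono divide_right_mono) auto
    then show ?thesis using A_le by linarith
  qed
  have "(\<lambda>n. LINT \<omega>|P n. \<phi> (\<lambda>t. Z n t \<omega>)) \<longlonglongrightarrow> (LINT \<omega>|N. \<phi> (\<lambda>t. G t \<omega>))"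
    by (rule trig_poly_expectation_tendsto[OF \<phi>(1) P N Z G char])
  then have "\<forall>\<^sub>F n in sequentially.
      dist (LINT \<omega>|P n. \<phi> (\<lambda>t. Z n t \<omega>)) (LINT \<omega>|N. \<phi> (\<lambda>t. G t \<omega>)) < e / 3"
    using e by (intro tendstoD) auto
  then show "\<forall>\<^sub>F n in sequentially.
      dist (LINT \<omega>|P n. F (\<lambda>t. Z n t \<omega>)) (LINT \<omega>|N. F (\<lambda>t. G t \<omega>)) < e"
  proof eventually_elim
    case (elim n)
    have "\<bar>(LINT \<omega>|P n. F (\<lambda>t. Z n t \<omega>)) - (LINT \<omega>|P n. \<phi> (\<lambda>t. Z n t \<omega>))\<bar> \<le>
        e / 6 + 2 * B * (real (card J) * V / A\<^sup>2)"
      by (rule integral_diff_trig_poly_le[where Y="Z n", OF J F F_cong F_le \<phi> P Z Z2])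
    moreover have "\<bar>(LINT \<omega>|N. F (\<lambda>t. G t \<omega>)) - (LINT \<omega>|N. \<phi> (\<lambda>t. G t \<omega>))\<bar> \<le>
        e / 6 + 2 * B * (real (card J) * V / A\<^sup>2)"
      by (rule integral_diff_trig_poly_le[where Y=G, OF J F F_cong F_le \<phi> N G G2])
    ultimately show ?case
      using elim A_le' unfolding dist_real_def by linarith
  qed
qed

text \<open>The index set of a process may lie in an uncountable type. Renumbering \<open>J\<close>
  by natural numbers moves the question to functions on a countable type, where coordinatewise
  measurability gives Borel measurability.\<close>

lemma fdd_expectation_tendsto:
  fixes P :: "nat \<Rightarrow> 'b measure" and Z :: "nat \<Rightarrow> 'i \<Rightarrow> 'b \<Rightarrow> real"
  assumes J: "finite J"
    and f: "continuous_map (product_topology (\<lambda>_. euclideanreal) J) euclideanreal f"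
      "bounded (f ` (J \<rightarrow>\<^sub>E UNIV))"
    and P: "\<And>n. prob_space (P n)" and N: "prob_space N"
    and Z: "\<And>n t. t \<in> J \<Longrightarrow> Z n t \<in> borel_measurable (P n)"
    and G: "\<And>t. t \<in> J \<Longrightarrow> G t \<in> borel_measurable N"
    and Z2: "\<And>n t. t \<in> J \<Longrightarrow> integrable (P n) (\<lambda>\<omega>. (Z n t \<omega>)\<^sup>2)"
      "\<And>n t. t \<in> J \<Longrightarrow> (LINT \<omega>|P n. (Z n t \<omega>)\<^sup>2) \<le> V"
    and G2: "\<And>t. t \<in> J \<Longrightarrow> integrable N (\<lambda>\<omega>. (G t \<omega>)\<^sup>2)"
      "\<And>t. t \<in> J \<Longrightarrow> (LINT \<omega>|N. (G t \<omega>)\<^sup>2) \<le> V"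
    and char: "\<And>c. (\<lambda>n. CLINT \<omega>|P n. iexp (\<Sum>t\<in>J. c t * Z n t \<omega>)) \<longlonglongrightarrow>
                    (CLINT \<omega>|N. iexp (\<Sum>t\<in>J. c t * G t \<omega>))"
  shows "(\<lambda>n. LINT \<omega>|P n. f (\<lambda>t\<in>J. Z n t \<omega>)) \<longlonglongrightarrow> (LINT \<omega>|N. f (\<lambda>t\<in>J. G t \<omega>))"
proof -
  define m where "m = card J"
  obtain h where h: "bij_betw h {..<m} J"
    using ex_bij_betw_nat_finite[OF J] unfolding m_def lessThan_atLeast0 by blast
  define g where "g = inv_into {..<m} h"
  have g: "\<And>t. t \<in> J \<Longrightarrow> g t < m" "\<And>t. t \<in> J \<Longrightarrow> h (g t) = t"
    using bij_betw_apply[OF bij_betw_inv_into[OF h]] bij_betw_inv_into_right[OF h] by (auto simp: g_def)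
  have hJ: "\<And>k. k < m \<Longrightarrow> h k \<in> J" "\<And>k. k < m \<Longrightarrow> g (h k) = k"
    using bij_betw_apply[OF h] bij_betw_inv_into_left[OF h] by (auto simp: g_def)
  define F where "F y = f (\<lambda>t\<in>J. y (g t))" for y :: "nat \<Rightarrow> real"
  have eq: "f (\<lambda>t\<in>J. Y t) = F (\<lambda>k. Y (h k))" for Y
    unfolding F_def using g by (intro arg_cong[of _ _ f]) auto
  obtain B where B: "\<And>x. x \<in> J \<rightarrow>\<^sub>E UNIV \<Longrightarrow> \<bar>f x\<bar> \<le> B"
    using f(2) unfolding bounded_iff by auto
  have "continuous_map euclidean (product_topology (\<lambda>_. euclideanreal) J) (\<lambda>y :: nat \<Rightarrow> real. \<lambda>t\<in>J. y (g t))"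
    unfolding continuous_map_componentwise by (auto simp: continuous_on_product_coordinates)
  then have "continuous_map euclidean euclideanreal F"
    unfolding F_def using f(1) by (rule continuous_map_compose[unfolded comp_def])
  then have F: "continuous_on UNIV F" by simp
  have sum: "(\<Sum>t\<in>J. d t) = (\<Sum>k<m. d (h k))" for d :: "'i \<Rightarrow> real"
    by (rule sum.reindex_bij_betw[OF h, symmetric])
  have "(\<lambda>n. LINT \<omega>|P n. F (\<lambda>k. Z n (h k) \<omega>)) \<longlonglongrightarrow> (LINT \<omega>|N. F (\<lambda>k. G (h k) \<omega>))"
  proof (rule bounded_continuous_expectation_tendsto[where J="{..<m}" and B=B and V=V and F=F
      and Z="\<lambda>n k. Z n (h k)" and G="\<lambda>k. G (h k)"])
    show "F x = F y" if "\<And>j. j \<in> {..<m} \<Longrightarrow> x j = y j" for x y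
      unfolding F_def using that g by (intro arg_cong[of _ _ f]) auto
    show "\<bar>F x\<bar> \<le> B" for x
      unfolding F_def by (rule B) auto
    show "(\<lambda>n. CLINT \<omega>|P n. iexp (\<Sum>k<m. c k * Z n (h k) \<omega>)) \<longlonglongrightarrow>
        (CLINT \<omega>|N. iexp (\<Sum>k<m. c k * G (h k) \<omega>))" for c
    proof -
      have *: "(\<Sum>k<m. c k * Y (h k)) = (\<Sum>t\<in>J. c (g t) * Y t)" for Y
        unfolding sum using hJ by (intro sum.cong) auto
      show ?thesis
        unfolding *[of "\<lambda>t. Z n t \<omega>" for n \<omega>] *[of "\<lambda>t. G t \<omega>" for \<omega>] by (rule char)
    qed
  qed (use F P N Z G Z2 G2 hJ in auto)
  then show ?thesis
    unfolding eq .
qed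

section \<open>Gaussian measures and processes\<close>

text \<open>One elimination step: removing the pivot \<open>r\<close> leaves the Schur complement
  \<open>\<Gamma>'\<close>, again positive semidefinite. A zero pivot is harmless because its row
  then vanishes, and since division by 0 gives 0, \<open>\<Gamma>'\<close> is
  \<open>\<Gamma>\<close> in that case.\<close>

lemma cholesky_decomposition:
  fixes \<Gamma> :: "'i \<Rightarrow> 'i \<Rightarrow> real"
  assumes "finite J" and sym: "\<And>s t. s \<in> J \<Longrightarrow> t \<in> J \<Longrightarrow> \<Gamma> s t = \<Gamma> t s"
    and psd: "\<And>c. 0 \<le> (\<Sum>s\<in>J. \<Sum>t\<in>J. c s * c t * \<Gamma> s t)"
  shows "\<exists>a. \<forall>s\<in>J. \<forall>t\<in>J. \<Gamma> s t = (\<Sum>i\<in>J. a s i * a t i)"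
  using assms
proof (induction J arbitrary: \<Gamma>)
  case empty
  then show ?case by simp
next
  case (insert r J)
  note sym = insert.prems(1) and psd = insert.prems(2)
  define \<Gamma>' where "\<Gamma>' s t = \<Gamma> s t - \<Gamma> r s * \<Gamma> r t / \<Gamma> r r" for s t
  have expand: "(\<Sum>s\<in>insert r J. \<Sum>t\<in>insert r J. c s * c t * \<Gamma> s t) =
      (\<Sum>s\<in>J. \<Sum>t\<in>J. c s * c t * \<Gamma> s t) + 2 * c r * (\<Sum>t\<in>J. c t * \<Gamma> r t) + (c r)\<^sup>2 * \<Gamma> r r" for c
  proof -
    have "(\<Sum>s\<in>J. c s * c r * \<Gamma> s r) = c r * (\<Sum>t\<in>J. c t * \<Gamma> r t)"
      unfolding sum_distrib_left using sym by (intro sum.cong) (auto simp: mult_ac)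
    moreover have "(\<Sum>t\<in>J. c r * c t * \<Gamma> r t) = c r * (\<Sum>t\<in>J. c t * \<Gamma> r t)"
      unfolding sum_distrib_left by (intro sum.cong) (auto simp: mult_ac)
    ultimately show ?thesis
      using insert.hyps by (simp add: sum.distrib power2_eq_square)
  qed
  have diag: "0 \<le> \<Gamma> r r"
    using psd[of "\<lambda>s. if s = r then 1 else 0"] insert.hyps unfolding expand
    by (auto simp: if_distrib[of "\<lambda>y. y * _"] cong: if_cong sum.cong)
      (smt (verit, best) sum.neutral)
  have zero: "\<Gamma> r u = 0" if "\<Gamma> r r = 0" "u \<in> J" for u
  proof (rule ccontr)
    assume u: "\<Gamma> r u \<noteq> 0"
    \<comment> \<open>With entry \<open>k\<close> at \<open>r\<close> and 1 at \<open>u\<close>, the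
      quadratic form takes the value -1.\<close>
    define k where "k = - (\<Gamma> u u + 1) / (2 * \<Gamma> r u)"
    define c where "c s = (if s = r then k else if s = u then 1 else 0)" for s
    have ne: "s \<noteq> r" if "s \<in> J" for s using insert.hyps that by auto
    have "(\<Sum>t\<in>J. c t * \<Gamma> r t) = (\<Sum>t\<in>J. if t = u then \<Gamma> r u else 0)"
      using ne by (intro sum.cong) (auto simp: c_def)
    then have 1: "(\<Sum>t\<in>J. c t * \<Gamma> r t) = \<Gamma> r u"
      using that insert.hyps by simp
    have "(\<Sum>s\<in>J. \<Sum>t\<in>J. c s * c t * \<Gamma> s t) = (\<Sum>s\<in>J. if s = u then (\<Sum>t\<in>J. if t = u then \<Gamma> u u else 0) else 0)"
      using ne by (intro sum.cong) (auto simp: c_def intro!: sum.neutral sum.cong)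
    then have 2: "(\<Sum>s\<in>J. \<Sum>t\<in>J. c s * c t * \<Gamma> s t) = \<Gamma> u u"
      using that insert.hyps by simp
    have "0 \<le> \<Gamma> u u + 2 * k * \<Gamma> r u"
      using psd[of c] unfolding expand 1 2 using that by (simp add: c_def)
    moreover have "2 * k * \<Gamma> r u = - (\<Gamma> u u + 1)"
      using u by (simp add: k_def)
    ultimately show False by linarith
  qed
  have "\<exists>a. \<forall>s\<in>J. \<forall>t\<in>J. \<Gamma>' s t = (\<Sum>i\<in>J. a s i * a t i)"
  proof (rule insert.IH)
    show "\<Gamma>' s t = \<Gamma>' t s" if "s \<in> J" "t \<in> J" for s t
      using sym that by (simp add: \<Gamma>'_def mult.commute)
    show "0 \<le> (\<Sum>s\<in>J. \<Sum>t\<in>J. c s * c t * \<Gamma>' s t)" for c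
    proof -
      define S where "S = (\<Sum>t\<in>J. c t * \<Gamma> r t)"
      \<comment> \<open>For a positive pivot this entry minimises the form in the coordinate
        \<open>r\<close>, and the minimum is the form of \<open>\<Gamma>'\<close>. For a zero pivot
        the entry is 0 and the identity below still holds.\<close>
      define d where "d = c(r := - S / \<Gamma> r r)"
      have d: "d s = c s" if "s \<in> J" for s using that insert.hyps by (auto simp: d_def)
      have "(\<Sum>s\<in>J. \<Sum>t\<in>J. c s * c t * \<Gamma>' s t) =
          (\<Sum>s\<in>J. \<Sum>t\<in>J. c s * c t * \<Gamma> s t) - S * S / \<Gamma> r r"
        unfolding \<Gamma>'_def S_def sum_product
        by (simp add: right_diff_distrib sum_subtractf sum_divide_distrib mult_ac)
      also have "\<dots> = (\<Sum>s\<in>J. \<Sum>t\<in>J. d s * d t * \<Gamma> s t) + 2 * d r * (\<Sum>t\<in>J. d t * \<Gamma> r t) + (d r)\<^sup>2 * \<Gamma> r r"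
        using d unfolding S_def[symmetric] 
        by (cases "\<Gamma> r r = 0") (auto simp: S_def[symmetric] d_def[of] power2_eq_square field_simps cong: sum.cong)
      also have "\<dots> \<ge> 0"
        unfolding expand[symmetric] by (rule psd)
      finally show ?thesis .
    qed
  qed
  then obtain a where a: "\<And>s t. s \<in> J \<Longrightarrow> t \<in> J \<Longrightarrow> \<Gamma>' s t = (\<Sum>i\<in>J. a s i * a t i)" by blast
  \<comment> \<open>Column \<open>r\<close> carries the part subtracted in \<open>\<Gamma>'\<close>;
    the other columns factor \<open>\<Gamma>'\<close> on \<open>J\<close> and are 0 in row
    \<open>r\<close>, where \<open>\<Gamma>'\<close> vanishes.\<close>
  define b where "b s i = (if i = r then (if \<Gamma> r r = 0 then 0 else \<Gamma> r s / sqrt (\<Gamma> r r))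
      else if s = r then 0 else a s i)" for s i
  have "\<Gamma> s t = (\<Sum>i\<in>insert r J. b s i * b t i)" if "s \<in> insert r J" "t \<in> insert r J" for s t
  proof -
    have ne: "i \<noteq> r" if "i \<in> J" for i using insert.hyps that by auto
    have "(\<Sum>i\<in>J. b s i * b t i) = (if s = r \<or> t = r then 0 else (\<Sum>i\<in>J. a s i * a t i))"
      using ne by (auto simp: b_def intro!: sum.cong sum.neutral)
    then have "(\<Sum>i\<in>insert r J. b s i * b t i) =
        (if \<Gamma> r r = 0 then 0 else \<Gamma> r s * \<Gamma> r t / \<Gamma> r r) + (if s = r \<or> t = r then 0 else \<Gamma>' s t)"
      using insert.hyps that diag a by (auto simp: b_def)
    also have "\<dots> = \<Gamma> s t"
      using that zero sym[of r s] sym[of r t] by (auto simp: \<Gamma>'_def)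
    finally show ?thesis ..
  qed
  then show ?case by blast
qed

section \<open>Measures on finite products are determined by orthants\<close>

lemma measure_eqI_PiM_atMost:
  fixes \<mu> \<nu> :: "('i \<Rightarrow> real) measure"
  assumes J: "finite J" and \<mu>: "prob_space \<mu>" "sets \<mu> = sets (PiM J (\<lambda>_. borel))"
    and \<nu>: "prob_space \<nu>" "sets \<nu> = sets (PiM J (\<lambda>_. borel))"
    and eq: "\<And>a. emeasure \<mu> (PiE J (\<lambda>j. {..a j})) = emeasure \<nu> (PiE J (\<lambda>j. {..a j}))"
  shows "\<mu> = \<nu>"
proof -
  let ?E = "{PiE J F | F. \<forall>i\<in>J. F i \<in> range (\<lambda>a::real. {..a})}"
  have E: "\<exists>a. X = PiE J (\<lambda>j. {..a j})" if X: "X \<in> ?E" for X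
  proof -
    from X obtain F where F: "X = PiE J F" "\<forall>i\<in>J. F i \<in> range (\<lambda>a. {..a})" by blast
    then have "\<forall>i\<in>J. \<exists>a. F i = {..a}" by auto
    then obtain a where "\<forall>i\<in>J. F i = {..a i}" by metis
    with F(1) show ?thesis by (auto intro!: exI[of _ a] PiE_cong)
  qed
  have gen: "sets (PiM J (\<lambda>_. borel :: real measure)) = sigma_sets (PiE J (\<lambda>_. UNIV)) ?E"
  proof -
    let ?H = "range (\<lambda>a::real. {..a})"
    have "sets (PiM J (\<lambda>_. borel :: real measure)) = sets (PiM J (\<lambda>_. sigma UNIV ?H))"
      by (intro sets_PiM_cong) (auto simp: borel_eq_atMost)
    also have "\<dots> = sets (sigma (PiE J (\<lambda>_. UNIV))
        {{f \<in> PiE J (\<lambda>_. UNIV). \<forall>i\<in>j. f i \<in> A i} | A j. j \<in> {J} \<and> A \<in> Pi j (\<lambda>_. ?H)})"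
    proof (rule sets_PiM_sigma)
      fix i
      have "UNIV = \<Union>(range (\<lambda>n. {..real n}))"
        using real_arch_simple by auto
      then show "\<exists>S\<subseteq>?H. countable S \<and> UNIV = \<Union>S"
        by (intro exI[of _ "range (\<lambda>n. {..real n})"]) auto
    qed (use J in auto)
    also have "{{f \<in> PiE J (\<lambda>_. UNIV). \<forall>i\<in>j. f i \<in> A i} | A j. j \<in> {J} \<and> A \<in> Pi j (\<lambda>_. ?H)} = ?E"
    proof -
      have "{f \<in> PiE J (\<lambda>_. UNIV). \<forall>i\<in>J. f i \<in> A i} = PiE J A" for A :: "'i \<Rightarrow> real set"
        by (auto simp: PiE_iff extensional_def)
      then show ?thesis by (auto simp: Pi_iff)
    qed
    moreover have "?E \<subseteq> Pow (PiE J (\<lambda>_. UNIV))"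
      by (auto simp: PiE_iff)
    ultimately show ?thesis
      by (simp only: sets_measure_of)
  qed
  show ?thesis
  proof (rule measure_eqI_generator_eq[where E="?E" and \<Omega>="PiE J (\<lambda>_. UNIV)" and A="\<lambda>n. PiE J (\<lambda>_. {..real n})"])
    show "Int_stable ?E"
    proof (rule Int_stableI)
      fix X Y assume "X \<in> ?E" "Y \<in> ?E"
      then obtain a b where "X = PiE J (\<lambda>j. {..a j})" "Y = PiE J (\<lambda>j. {..b j})"
        using E by meson
      then have "X \<inter> Y = PiE J (\<lambda>j. {..min (a j) (b j)})"
        by (simp add: PiE_Int Int_atMost inf_min)
      then show "X \<inter> Y \<in> ?E" by blast
    qed
    show "emeasure \<mu> X = emeasure \<nu> X" if "X \<in> ?E" for X
      using E[OF that] eq by auto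
    show "sets \<mu> = sigma_sets (PiE J (\<lambda>_. UNIV)) ?E" "sets \<nu> = sigma_sets (PiE J (\<lambda>_. UNIV)) ?E"
      unfolding \<mu>(2) \<nu>(2) gen by simp_all
    show "(\<Union>n. PiE J (\<lambda>_. {..real n})) = PiE J (\<lambda>_. UNIV)"
    proof safe
      fix x :: "'i \<Rightarrow> real" assume x: "x \<in> PiE J (\<lambda>_. UNIV)"
      obtain n where n: "Max (insert 0 (x ` J)) \<le> real n" using real_arch_simple by blast
      have "x j \<le> real n" if "j \<in> J" for j
        using Max_ge[of "insert 0 (x ` J)" "x j"] that J n by auto
      with x have "x \<in> PiE J (\<lambda>_. {..real n})" by auto
      then show "x \<in> (\<Union>n. PiE J (\<lambda>_. {..real n}))" by blast
    qed auto
    show "emeasure \<mu> (PiE J (\<lambda>_. {..real n})) \<noteq> \<infinity>" for n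
      using prob_space.finite_measure[OF \<mu>(1)] finite_measure.emeasure_finite by auto
  qed auto
qed

section \<open>Centred normal laws on the line\<close>

lemma real_distribution_normal:
  "0 < \<sigma> \<Longrightarrow> real_distribution (density lborel (normal_density \<mu> \<sigma>))"
  using prob_space_normal_density by (auto simp: real_distribution_def real_distribution_axioms_def)

lemma char_normal:
  assumes \<sigma>: "0 < \<sigma>"
  shows "char (density lborel (normal_density 0 \<sigma>)) \<theta> = exp (- (\<theta>\<^sup>2 * \<sigma>\<^sup>2) / 2)"
proof -
  interpret S: prob_space std_normal_distribution
    by (rule prob_space_normal_density) simp
  have "distributed std_normal_distribution lborel (\<lambda>x. x) std_normal_density"
    by (auto simp: distributed_def distr_id2 intro!: measurable_ident_sets)
  then have "distributed std_normal_distribution lborel (\<lambda>x. 0 + \<sigma> * x) (normal_density (0 + \<sigma> * 0) (\<bar>\<sigma>\<bar> * 1))"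
    using \<sigma> by (intro S.normal_density_affine) auto
  then have "distr std_normal_distribution lborel (\<lambda>x. \<sigma> * x) = density lborel (normal_density 0 \<sigma>)"
    using \<sigma> by (simp add: distributed_def)
  then have "density lborel (normal_density 0 \<sigma>) = distr std_normal_distribution borel (\<lambda>x. \<sigma> * x)"
    by (metis distr_cong sets_lborel)
  then have "char (density lborel (normal_density 0 \<sigma>)) \<theta> = char std_normal_distribution (\<theta> * \<sigma>)"
    by (simp add: char_def integral_distr mult.assoc)
  then show ?thesis
    by (simp add: char_std_normal_distribution power_mult_distrib)
qed

text \<open>The case \<open>v = 0\<close> stands apart because a normal density needs a positive
  deviation; the law is then the point mass at 0, which \<open>normal_rv\<close> admits. In both
  cases Levy's uniqueness theorem identifies the law.\<close>

lemma gaussian_rv_of_char: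
  assumes N: "prob_space N" and X: "X \<in> borel_measurable N" and v: "0 \<le> v"
    and char: "\<And>\<theta>. char (distr N borel X) \<theta> = exp (- (\<theta>\<^sup>2 * v) / 2)"
  shows "normal_rv N X" "integrable N (\<lambda>\<omega>. (X \<omega>)\<^sup>2)" "(LINT \<omega>|N. X \<omega>) = 0" "(LINT \<omega>|N. (X \<omega>)\<^sup>2) = v"
proof -
  interpret prob_space N by fact
  have D: "real_distribution (distr N borel X)"
    using X by (rule real_distribution_distr)
  have "normal_rv N X \<and> integrable N (\<lambda>\<omega>. (X \<omega>)\<^sup>2) \<and> (LINT \<omega>|N. X \<omega>) = 0 \<and> (LINT \<omega>|N. (X \<omega>)\<^sup>2) = v"
  proof (cases "v = 0")
    case True
    have "distr N borel X = return borel 0"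
    proof (rule Levy_uniqueness[OF D])
      show "real_distribution (return borel 0)"
        by (auto simp: real_distribution_def real_distribution_axioms_def prob_space_return)
      show "char (distr N borel X) = char (return borel 0)"
        unfolding fun_eq_iff char by (auto simp: char_def True integral_return)
    qed
    moreover from this have "AE x in distr N borel X. x = 0"
      by (simp only:) (subst AE_return; simp)
    then have "AE \<omega> in N. X \<omega> = 0"
      using X by (simp add: AE_distr_iff)
    then have "integrable N (\<lambda>\<omega>. (X \<omega>)\<^sup>2)" "(LINT \<omega>|N. X \<omega>) = 0" "(LINT \<omega>|N. (X \<omega>)\<^sup>2) = 0"
      using X by (auto intro!: integral_eq_zero_AE integrable_cong_AE_imp[where g="\<lambda>_. 0"] elim: eventually_mono)
    ultimately show ?thesis
      using X True by (auto simp: normal_rv_def)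
  next
    case False
    define \<sigma> where "\<sigma> = sqrt v"
    have \<sigma>: "0 < \<sigma>" "\<sigma>\<^sup>2 = v" using v False by (auto simp: \<sigma>_def)
    have "distr N borel X = density lborel (normal_density 0 \<sigma>)"
      by (rule Levy_uniqueness[OF D real_distribution_normal[OF \<sigma>(1)]])
         (simp add: fun_eq_iff char char_normal[OF \<sigma>(1)] \<sigma>(2))
    moreover have "distr N lborel X = distr N borel X"
      by (rule distr_cong) auto
    ultimately have dist: "distributed N lborel X (normal_density 0 \<sigma>)"
      using X by (auto simp: distributed_def)
    have "(LINT \<omega>|N. X \<omega>) = 0"
      by (rule normal_distributed_expectation[OF \<sigma>(1) dist])
    moreover have "variance X = \<sigma>\<^sup>2"
      by (rule normal_distributed_variance[OF \<sigma>(1) dist])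
    moreover have "integrable N (\<lambda>\<omega>. (X \<omega>)\<^sup>2)"
    proof -
      have "integrable lborel (\<lambda>x. normal_density 0 \<sigma> x * (x - 0)\<^sup>2)"
        by (rule integrable_normal_moment[OF \<sigma>(1)])
      then show ?thesis
        by (subst distributed_integrable[OF dist, symmetric]) auto
    qed
    ultimately show ?thesis
      using X \<sigma> dist by (auto simp: normal_rv_def)
  qed
  then show "normal_rv N X" "integrable N (\<lambda>\<omega>. (X \<omega>)\<^sup>2)" "(LINT \<omega>|N. X \<omega>) = 0" "(LINT \<omega>|N. (X \<omega>)\<^sup>2) = v"
    by auto
qed

text \<open>For \<open>n \<ge> 1\<close>, a continuous function that is 1 up to \<open>a\<close>, 0
  from \<open>a + 1 / n\<close> on and linear between. Products of such functions reach orthants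
  from continuous test functions.\<close>

definition ramp :: "nat \<Rightarrow> real \<Rightarrow> real \<Rightarrow> real" where
  "ramp n a x = max 0 (min 1 (1 - real n * (x - a)))"

lemma ramp_tendsto: "(\<lambda>n. ramp n a x) \<longlonglongrightarrow> indicator {..a} x"
proof (cases "x \<le> a")
  case True
  then have "ramp n a x = 1" for n
    by (auto simp: ramp_def mult_nonneg_nonpos)
  then show ?thesis using True by simp
next
  case False
  obtain m where m: "1 / (x - a) \<le> real m" using real_arch_simple by blast
  have "ramp n a x = 0" if "m \<le> n" for n
  proof -
    have "1 / (x - a) \<le> real n" using m that by linarith
    then have "1 \<le> real n * (x - a)" using False by (simp add: field_simps)
    then show ?thesis by (simp add: ramp_def)
  qed
  then have "\<forall>\<^sub>F n in sequentially. ramp n a x = 0"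
    by (auto simp: eventually_sequentially)
  then show ?thesis using False by (simp add: tendsto_eventually)
qed

text \<open>The convergence theorem is applied to the constant sequence \<open>\<mu>\<close> with
  limit \<open>\<nu>\<close>: equal characteristic functions converge trivially, so the integrals of
  bounded continuous functions agree. Ramps and dominated convergence then give orthants. The second
  moments enter through that theorem.\<close>

lemma measure_eqI_char_PiM:
  fixes \<mu> \<nu> :: "('i \<Rightarrow> real) measure"
  assumes J: "finite J" and \<mu>: "prob_space \<mu>" "sets \<mu> = sets (PiM J (\<lambda>_. borel))"
    and \<nu>: "prob_space \<nu>" "sets \<nu> = sets (PiM J (\<lambda>_. borel))"
    and \<mu>2: "\<And>t. t \<in> J \<Longrightarrow> integrable \<mu> (\<lambda>\<omega>. (\<omega> t)\<^sup>2)"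
    and \<nu>2: "\<And>t. t \<in> J \<Longrightarrow> integrable \<nu> (\<lambda>\<omega>. (\<omega> t)\<^sup>2)"
    and char: "\<And>c. (CLINT \<omega>|\<mu>. iexp (\<Sum>t\<in>J. c t * \<omega> t)) = (CLINT \<omega>|\<nu>. iexp (\<Sum>t\<in>J. c t * \<omega> t))"
  shows "\<mu> = \<nu>"
proof (rule measure_eqI_PiM_atMost[OF J \<mu> \<nu>])
  fix a :: "'i \<Rightarrow> real"
  interpret \<mu>: prob_space \<mu> by fact
  interpret \<nu>: prob_space \<nu> by fact
  have coord: "(\<lambda>\<omega>. \<omega> t) \<in> borel_measurable \<mu>" "(\<lambda>\<omega>. \<omega> t) \<in> borel_measurable \<nu>" if "t \<in> J" for t
    using measurable_component_singleton[OF that, of "\<lambda>_. borel :: real measure"]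
    by (auto simp: measurable_cong_sets[OF \<mu>(2) refl] measurable_cong_sets[OF \<nu>(2) refl])
  have sp: "space \<mu> = PiE J (\<lambda>_. UNIV)" "space \<nu> = PiE J (\<lambda>_. UNIV)"
    using sets_eq_imp_space_eq[OF \<mu>(2)] sets_eq_imp_space_eq[OF \<nu>(2)] by (auto simp: space_PiM)
  define f where "f n x = (\<Prod>j\<in>J. ramp n (a j) (x j))" for n and x :: "'i \<Rightarrow> real"
  have f_le: "\<bar>f n x\<bar> \<le> 1" for n x
    unfolding f_def abs_prod by (rule prod_le_1) (auto simp: ramp_def)
  have f_cont: "continuous_map (product_topology (\<lambda>_. euclideanreal) J) euclideanreal (f n)" for n
    unfolding f_def ramp_def
    by (intro continuous_intros continuous_map_real_max continuous_map_real_min J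
        continuous_map_product_projection) auto
  define V where "V = (\<Sum>t\<in>J. (LINT \<omega>|\<mu>. (\<omega> t)\<^sup>2) + (LINT \<omega>|\<nu>. (\<omega> t)\<^sup>2))"
  have V: "(LINT \<omega>|\<mu>. (\<omega> t)\<^sup>2) \<le> V" "(LINT \<omega>|\<nu>. (\<omega> t)\<^sup>2) \<le> V" if "t \<in> J" for t
  proof -
    have "(LINT \<omega>|\<mu>. (\<omega> t)\<^sup>2) + (LINT \<omega>|\<nu>. (\<omega> t)\<^sup>2) \<le> V"
      unfolding V_def using that J by (intro member_le_sum) auto
    moreover have "0 \<le> (LINT \<omega>|\<mu>. (\<omega> t)\<^sup>2)" "0 \<le> (LINT \<omega>|\<nu>. (\<omega> t)\<^sup>2)" by simp_all
    ultimately show "(LINT \<omega>|\<mu>. (\<omega> t)\<^sup>2) \<le> V" "(LINT \<omega>|\<nu>. (\<omega> t)\<^sup>2) \<le> V" by linarith+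
  qed
  have "(\<lambda>_. LINT \<omega>|\<mu>. f n (\<lambda>t\<in>J. \<omega> t)) \<longlonglongrightarrow> (LINT \<omega>|\<nu>. f n (\<lambda>t\<in>J. \<omega> t))" for n
  proof (rule fdd_expectation_tendsto[where P="\<lambda>_. \<mu>" and Z="\<lambda>_ t \<omega>. \<omega> t" and G="\<lambda>t \<omega>. \<omega> t" and V=V])
    show "bounded (f n ` (J \<rightarrow>\<^sub>E UNIV))"
      using f_le by (auto intro!: boundedI)
  qed (use J f_cont \<mu> \<nu> coord \<mu>2 \<nu>2 V char in auto)
  then have "(LINT \<omega>|\<mu>. f n (\<lambda>t\<in>J. \<omega> t)) = (LINT \<omega>|\<nu>. f n (\<lambda>t\<in>J. \<omega> t))" for n
    using LIMSEQ_unique tendsto_const by blast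
  moreover have "f n (\<lambda>t\<in>J. x t) = f n x" for n x
    unfolding f_def by (intro prod.cong) auto
  ultimately have eq: "(LINT \<omega>|\<mu>. f n \<omega>) = (LINT \<omega>|\<nu>. f n \<omega>)" for n
    by simp
  have lim: "(\<lambda>n. f n x) \<longlonglongrightarrow> indicator (PiE J (\<lambda>j. {..a j})) x" if "x \<in> PiE J (\<lambda>_. UNIV)" for x
  proof -
    have "(\<lambda>n. f n x) \<longlonglongrightarrow> (\<Prod>j\<in>J. indicator {..a j} (x j))"
      unfolding f_def by (intro tendsto_prod ramp_tendsto)
    also have "(\<Prod>j\<in>J. indicator {..a j} (x j)) = (indicator (PiE J (\<lambda>j. {..a j})) x :: real)"
      using that J by (auto simp: indicator_def PiE_iff prod_zero_iff)
    finally show ?thesis .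
  qed
  have set: "PiE J (\<lambda>j. {..a j}) \<in> sets (PiM J (\<lambda>_. borel))"
    using J by (intro sets_PiM_I_finite) auto
  have f_meas: "f n \<in> borel_measurable \<mu>" "f n \<in> borel_measurable \<nu>" for n
    unfolding f_def ramp_def using coord by (auto intro!: borel_measurable_prod borel_measurable_max borel_measurable_min borel_measurable_diff borel_measurable_times)
  have "(\<lambda>n. LINT \<omega>|\<mu>. f n \<omega>) \<longlonglongrightarrow> (LINT \<omega>|\<mu>. indicator (PiE J (\<lambda>j. {..a j})) \<omega>)"
    using f_meas f_le lim set \<mu>(2) sp
    by (intro integral_dominated_convergence[where w="\<lambda>_. 1"]) auto
  moreover have "(\<lambda>n. LINT \<omega>|\<nu>. f n \<omega>) \<longlonglongrightarrow> (LINT \<omega>|\<nu>. indicator (PiE J (\<lambda>j. {..a j})) \<omega>)"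
    using f_meas f_le lim set \<nu>(2) sp
    by (intro integral_dominated_convergence[where w="\<lambda>_. 1"]) auto
  ultimately have "(LINT \<omega>|\<mu>. indicator (PiE J (\<lambda>j. {..a j})) \<omega>) = (LINT \<omega>|\<nu>. indicator (PiE J (\<lambda>j. {..a j})) \<omega> :: real)"
    unfolding eq by (rule LIMSEQ_unique)
  then have "measure \<mu> (PiE J (\<lambda>j. {..a j})) = measure \<nu> (PiE J (\<lambda>j. {..a j}))"
    using set \<mu>(2) \<nu>(2) by simp
  then show "emeasure \<mu> (PiE J (\<lambda>j. {..a j})) = emeasure \<nu> (PiE J (\<lambda>j. {..a j}))"
    by (simp add: \<mu>.emeasure_eq_measure \<nu>.emeasure_eq_measure)
qed

section \<open>Existence of Gaussian laws and processes\<close>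

lemma coordinate_measurable:
  assumes "sets \<mu> = sets (PiM J (\<lambda>_. borel))" "t \<in> J"
  shows "(\<lambda>\<omega>. \<omega> t) \<in> borel_measurable \<mu>"
  using measurable_component_singleton[OF assms(2), of "\<lambda>_. borel"]
  by (simp add: measurable_cong_sets[OF assms(1) refl])

text \<open>The law is the image of independent standard normal variables under the factor
  \<open>a\<close> of \<open>\<Gamma>\<close>. Carrying the coefficients \<open>c\<close> back
  through \<open>a\<close> gives \<open>b\<close>, whose squared length is the quadratic form in the
  exponent.\<close>

lemma gaussian_measure_exists:
  fixes \<Gamma> :: "'i \<Rightarrow> 'i \<Rightarrow> real"
  assumes J: "finite J" and sym: "\<And>s t. s \<in> J \<Longrightarrow> t \<in> J \<Longrightarrow> \<Gamma> s t = \<Gamma> t s"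
    and psd: "\<And>c. 0 \<le> (\<Sum>s\<in>J. \<Sum>t\<in>J. c s * c t * \<Gamma> s t)"
  shows "\<exists>\<mu>. prob_space \<mu> \<and> sets \<mu> = sets (PiM J (\<lambda>_. borel)) \<and>
    (\<forall>c. (CLINT \<omega>|\<mu>. iexp (\<Sum>t\<in>J. c t * \<omega> t)) = exp (- (\<Sum>s\<in>J. \<Sum>t\<in>J. c s * c t * \<Gamma> s t) / 2))"
proof -
  obtain a where a: "\<And>s t. s \<in> J \<Longrightarrow> t \<in> J \<Longrightarrow> \<Gamma> s t = (\<Sum>i\<in>J. a s i * a t i)"
    using cholesky_decomposition[OF J sym psd] by blast
  let ?N = "PiM J (\<lambda>_. std_normal_distribution)"
  have sn: "prob_space std_normal_distribution"
    by (rule prob_space_normal_density) simp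
  interpret N: product_prob_space "\<lambda>_. std_normal_distribution" J
    by (rule product_prob_spaceI) (rule sn)
  define h where "h \<xi> = (\<lambda>t\<in>J. \<Sum>i\<in>J. a t i * \<xi> i)" for \<xi> :: "'i \<Rightarrow> real"
  have sets_N: "sets ?N = sets (PiM J (\<lambda>_. borel))"
    by (intro sets_PiM_cong) auto
  have h: "h \<in> measurable ?N (PiM J (\<lambda>_. borel))"
    unfolding h_def
    by (intro measurable_restrict borel_measurable_sum borel_measurable_times borel_measurable_const
        coordinate_measurable[OF sets_N])
  have pN: "prob_space ?N" using sn by (rule prob_space_PiM)
  define \<mu> where "\<mu> = distr ?N (PiM J (\<lambda>_. borel)) h"
  have "(CLINT \<omega>|\<mu>. iexp (\<Sum>t\<in>J. c t * \<omega> t)) = exp (- (\<Sum>s\<in>J. \<Sum>t\<in>J. c s * c t * \<Gamma> s t) / 2)" for c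
  proof -
    define b where "b i = (\<Sum>t\<in>J. c t * a t i)" for i
    have hb: "(\<Sum>t\<in>J. c t * h \<xi> t) = (\<Sum>i\<in>J. b i * \<xi> i)" for \<xi>
    proof -
      have "(\<Sum>t\<in>J. c t * h \<xi> t) = (\<Sum>t\<in>J. \<Sum>i\<in>J. c t * a t i * \<xi> i)"
        by (auto simp: h_def sum_distrib_left mult.assoc intro!: sum.cong)
      also have "\<dots> = (\<Sum>i\<in>J. b i * \<xi> i)"
        unfolding b_def sum_distrib_right by (rule sum.swap)
      finally show ?thesis .
    qed
    have b2: "(\<Sum>i\<in>J. (b i)\<^sup>2) = (\<Sum>s\<in>J. \<Sum>t\<in>J. c s * c t * \<Gamma> s t)"
    proof -
      have "(\<Sum>i\<in>J. (b i)\<^sup>2) = (\<Sum>i\<in>J. \<Sum>s\<in>J. \<Sum>t\<in>J. c s * c t * (a s i * a t i))"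
        unfolding b_def power2_eq_square sum_product by (simp add: mult_ac)
      also have "\<dots> = (\<Sum>s\<in>J. \<Sum>i\<in>J. \<Sum>t\<in>J. c s * c t * (a s i * a t i))"
        by (rule sum.swap)
      also have "\<dots> = (\<Sum>s\<in>J. \<Sum>t\<in>J. \<Sum>i\<in>J. c s * c t * (a s i * a t i))"
        by (intro sum.cong refl sum.swap)
      also have "\<dots> = (\<Sum>s\<in>J. \<Sum>t\<in>J. c s * c t * \<Gamma> s t)"
        by (intro sum.cong) (auto simp: a sum_distrib_left)
      finally show ?thesis .
    qed
    have "(CLINT \<omega>|\<mu>. iexp (\<Sum>t\<in>J. c t * \<omega> t)) = (CLINT \<xi>|?N. iexp (\<Sum>t\<in>J. c t * h \<xi> t))"
      unfolding \<mu>_def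
      by (intro integral_distr[OF h]) (auto intro!: borel_measurable_sum borel_measurable_times measurable_component_singleton simp del: of_real_sum)
    also have "\<dots> = (CLINT \<xi>|?N. (\<Prod>i\<in>J. iexp (b i * \<xi> i)))"
      unfolding hb by (simp add: exp_sum[OF J] sum_distrib_left)
    also have "\<dots> = (\<Prod>i\<in>J. CLINT x|std_normal_distribution. iexp (b i * x))"
    proof (rule N.product_integral_prod[OF J])
      show "complex_integrable std_normal_distribution (\<lambda>x. iexp (b i * x))" for i
        by (intro finite_measure.integrable_const_bound[OF prob_space.finite_measure[OF sn], where B=1]) auto
    qed
    also have "\<dots> = (\<Prod>i\<in>J. complex_of_real (exp (- ((b i)\<^sup>2) / 2)))"
      using char_std_normal_distribution by (simp add: char_def fun_eq_iff)
    also have "\<dots> = complex_of_real (exp (\<Sum>i\<in>J. - ((b i)\<^sup>2) / 2))"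
      by (simp add: exp_sum[OF J])
    also have "(\<Sum>i\<in>J. - ((b i)\<^sup>2) / 2) = - (\<Sum>s\<in>J. \<Sum>t\<in>J. c s * c t * \<Gamma> s t) / 2"
      by (simp add: b2[symmetric] sum_negf sum_divide_distrib)
    finally show ?thesis .
  qed
  moreover have "prob_space \<mu>"
    unfolding \<mu>_def using h by (intro prob_space.prob_space_distr pN)
  ultimately show ?thesis
    by (intro exI[of _ \<mu>]) (auto simp: \<mu>_def)
qed

text \<open>Scaling all coefficients by \<open>\<theta>\<close> turns the joint characteristic
  function into that of a single combination, which is then recognised as centred normal with the
  quadratic form as variance.\<close>

lemma linear_combination_of_char:
  fixes X :: "'i \<Rightarrow> 'n \<Rightarrow> real"
  assumes N: "prob_space N" and J: "finite J" and X: "\<And>t. t \<in> J \<Longrightarrow> X t \<in> borel_measurable N"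
    and psd: "\<And>c. 0 \<le> (\<Sum>s\<in>J. \<Sum>t\<in>J. c s * c t * \<Gamma> s t)"
    and char: "\<And>c. (CLINT \<omega>|N. iexp (\<Sum>t\<in>J. c t * X t \<omega>)) = exp (- (\<Sum>s\<in>J. \<Sum>t\<in>J. c s * c t * \<Gamma> s t) / 2)"
  shows "normal_rv N (\<lambda>\<omega>. \<Sum>t\<in>J. c t * X t \<omega>)" "integrable N (\<lambda>\<omega>. (\<Sum>t\<in>J. c t * X t \<omega>)\<^sup>2)"
    "(LINT \<omega>|N. (\<Sum>t\<in>J. c t * X t \<omega>)) = 0"
    "(LINT \<omega>|N. (\<Sum>t\<in>J. c t * X t \<omega>)\<^sup>2) = (\<Sum>s\<in>J. \<Sum>t\<in>J. c s * c t * \<Gamma> s t)"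
proof -
  have m: "(\<lambda>\<omega>. \<Sum>t\<in>J. c t * X t \<omega>) \<in> borel_measurable N"
    using X by (intro borel_measurable_sum borel_measurable_times) auto
  have ch: "Characteristic_Functions.char (distr N borel (\<lambda>\<omega>. \<Sum>t\<in>J. c t * X t \<omega>)) \<theta> =
      exp (- (\<theta>\<^sup>2 * (\<Sum>s\<in>J. \<Sum>t\<in>J. c s * c t * \<Gamma> s t)) / 2)" for \<theta>
  proof -
    have "\<theta>\<^sup>2 * (\<Sum>s\<in>J. \<Sum>t\<in>J. c s * c t * \<Gamma> s t) = (\<Sum>s\<in>J. \<Sum>t\<in>J. (\<theta> * c s) * (\<theta> * c t) * \<Gamma> s t)"
      by (simp add: sum_distrib_left power2_eq_square mult_ac)
    moreover have "\<theta> * (\<Sum>t\<in>J. c t * X t \<omega>) = (\<Sum>t\<in>J. (\<theta> * c t) * X t \<omega>)" for \<omega>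
      by (simp add: sum_distrib_left mult_ac)
    moreover have "Characteristic_Functions.char (distr N borel (\<lambda>\<omega>. \<Sum>t\<in>J. c t * X t \<omega>)) \<theta> =
        (CLINT \<omega>|N. iexp (\<theta> * (\<Sum>t\<in>J. c t * X t \<omega>)))"
      unfolding char_def by (rule integral_distr[OF m]) auto
    ultimately show ?thesis
      by (simp only: char)
  qed
  note * = gaussian_rv_of_char[OF N m psd ch]
  show "normal_rv N (\<lambda>\<omega>. \<Sum>t\<in>J. c t * X t \<omega>)" "integrable N (\<lambda>\<omega>. (\<Sum>t\<in>J. c t * X t \<omega>)\<^sup>2)"
    "(LINT \<omega>|N. (\<Sum>t\<in>J. c t * X t \<omega>)) = 0"
    "(LINT \<omega>|N. (\<Sum>t\<in>J. c t * X t \<omega>)\<^sup>2) = (\<Sum>s\<in>J. \<Sum>t\<in>J. c s * c t * \<Gamma> s t)"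
    by (fact *)+
qed

text \<open>Padding coefficients with 0 is how marginals are read off joint characteristic
  functions.\<close>

lemma sum_restrict_coefficients:
  assumes "finite H" "J \<subseteq> H"
  shows "(\<Sum>t\<in>H. (if t \<in> J then c t else 0) * f t) = (\<Sum>t\<in>J. c t * (f t :: real))"
proof -
  have "(\<Sum>t\<in>H. (if t \<in> J then c t else 0) * f t) = (\<Sum>t\<in>J. (if t \<in> J then c t else 0) * f t)"
    using assms by (intro sum.mono_neutral_right) auto
  also have "\<dots> = (\<Sum>t\<in>J. c t * f t)"
    by (intro sum.cong) auto
  finally show ?thesis .
qed

lemma quadratic_form_restrict_coefficients:
  assumes "finite H" "J \<subseteq> H"
  shows "(\<Sum>s\<in>H. \<Sum>t\<in>H. (if s \<in> J then c s else 0) * (if t \<in> J then c t else 0) * \<Gamma> s t) =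
    (\<Sum>s\<in>J. \<Sum>t\<in>J. c s * c t * (\<Gamma> s t :: real))"
  using sum_restrict_coefficients[OF assms, of c]
  by (simp add: mult.assoc sum_distrib_left[symmetric])

text \<open>Consistency follows from uniqueness: restricting the law on \<open>H\<close> to
  \<open>J\<close> gives a law with the characteristic function prescribed on \<open>J\<close>. The
  choice made by \<open>SOME\<close> is therefore harmless.\<close>

lemma gaussian_process_exists:
  fixes \<Gamma> :: "'i \<Rightarrow> 'i \<Rightarrow> real"
  assumes sym: "\<And>s t. s \<in> I \<Longrightarrow> t \<in> I \<Longrightarrow> \<Gamma> s t = \<Gamma> t s"
    and psd: "\<And>J c. finite J \<Longrightarrow> J \<subseteq> I \<Longrightarrow> 0 \<le> (\<Sum>s\<in>J. \<Sum>t\<in>J. c s * c t * \<Gamma> s t)"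
  obtains N :: "('i \<Rightarrow> real) measure" and G where "prob_space N" "\<And>t. t \<in> I \<Longrightarrow> G t \<in> borel_measurable N"
    "\<And>J c. finite J \<Longrightarrow> J \<subseteq> I \<Longrightarrow>
      (CLINT \<omega>|N. iexp (\<Sum>t\<in>J. c t * G t \<omega>)) = exp (- (\<Sum>s\<in>J. \<Sum>t\<in>J. c s * c t * \<Gamma> s t) / 2)"
proof -
  define Q where "Q J = (SOME \<mu>. prob_space \<mu> \<and> sets \<mu> = sets (PiM J (\<lambda>_. borel)) \<and>
    (\<forall>c. (CLINT \<omega>|\<mu>. iexp (\<Sum>t\<in>J. c t * \<omega> t)) = exp (- (\<Sum>s\<in>J. \<Sum>t\<in>J. c s * c t * \<Gamma> s t) / 2)))" for J
  have Q0: "prob_space (Q J) \<and> sets (Q J) = sets (PiM J (\<lambda>_. borel)) \<and>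
    (\<forall>c. (CLINT \<omega>|Q J. iexp (\<Sum>t\<in>J. c t * \<omega> t)) = exp (- (\<Sum>s\<in>J. \<Sum>t\<in>J. c s * c t * \<Gamma> s t) / 2))"
    if J: "finite J" "J \<subseteq> I" for J
  proof -
    have "\<Gamma> s t = \<Gamma> t s" if "s \<in> J" "t \<in> J" for s t using that sym J by auto
    from someI_ex[OF gaussian_measure_exists[of J \<Gamma>, OF J(1) this psd[OF J]]] show ?thesis
      unfolding Q_def .
  qed
  note Q = Q0[THEN conjunct1] Q0[THEN conjunct2, THEN conjunct1] Q0[THEN conjunct2, THEN conjunct2, THEN spec]
  have Q2: "integrable (Q J) (\<lambda>\<omega>. (\<omega> t)\<^sup>2)" if J: "finite J" "J \<subseteq> I" and t: "t \<in> J" for J t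
  proof -
    have "integrable (Q J) (\<lambda>\<omega>. (\<Sum>s\<in>J. (if s = t then 1 else 0) * \<omega> s)\<^sup>2)"
      using coordinate_measurable[OF Q(2)[OF J]]
      by (rule linear_combination_of_char(2)[OF Q(1)[OF J] J(1) _ psd[OF J] Q(3)[OF J]])
    moreover have "(\<Sum>s\<in>J. (if s = t then 1 else 0) * \<omega> s) = \<omega> t" for \<omega> :: "'i \<Rightarrow> real"
      using J t by (simp add: if_distrib[of "\<lambda>y. y * _"] cong: if_cong)
    ultimately show ?thesis by simp
  qed
  have consistent: "Q J = distr (Q H) (PiM J (\<lambda>_. borel)) (\<lambda>f. restrict f J)"
    if JH: "J \<subseteq> H" and H: "finite H" "H \<subseteq> I" for J H
  proof -
    have J: "finite J" "J \<subseteq> I" using JH H finite_subset by auto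
    have r: "(\<lambda>f. restrict f J) \<in> measurable (Q H) (PiM J (\<lambda>_. borel))"
      using JH by (simp add: measurable_cong_sets[OF Q(2)[OF H] refl] measurable_restrict_subset)
    have coordJ: "(\<lambda>\<omega>. \<omega> t) \<in> borel_measurable (PiM J (\<lambda>_. borel :: real measure))" if "t \<in> J" for t
      using that by (rule measurable_component_singleton)
    show ?thesis
    proof (rule measure_eqI_char_PiM[OF J(1)])
      show "prob_space (distr (Q H) (PiM J (\<lambda>_. borel)) (\<lambda>f. restrict f J))"
        using r by (intro prob_space.prob_space_distr Q(1) H)
      show "integrable (distr (Q H) (PiM J (\<lambda>_. borel)) (\<lambda>f. restrict f J)) (\<lambda>\<omega>. (\<omega> t)\<^sup>2)" if "t \<in> J" for t
        using Q2[OF H, of t] that JH coordJ[OF that] by (subst integrable_distr_eq[OF r]) auto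
      show "(CLINT \<omega>|Q J. iexp (\<Sum>t\<in>J. c t * \<omega> t)) =
          (CLINT \<omega>|distr (Q H) (PiM J (\<lambda>_. borel)) (\<lambda>f. restrict f J). iexp (\<Sum>t\<in>J. c t * \<omega> t))" for c
      proof -
        let ?c = "\<lambda>t. if t \<in> J then c t else 0"
        have "(CLINT \<omega>|distr (Q H) (PiM J (\<lambda>_. borel)) (\<lambda>f. restrict f J). iexp (\<Sum>t\<in>J. c t * \<omega> t)) =
            (CLINT \<omega>|Q H. iexp (\<Sum>t\<in>J. c t * restrict \<omega> J t))"
          using coordJ by (intro integral_distr[OF r])
            (auto intro!: borel_measurable_sum borel_measurable_times simp del: of_real_sum)
        also have "\<dots> = (CLINT \<omega>|Q H. iexp (\<Sum>t\<in>H. ?c t * \<omega> t))"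
          unfolding sum_restrict_coefficients[OF H(1) JH] by (simp cong: sum.cong)
        also have "\<dots> = (CLINT \<omega>|Q J. iexp (\<Sum>t\<in>J. c t * \<omega> t))"
          unfolding Q(3)[OF H] Q(3)[OF J] quadratic_form_restrict_coefficients[OF H(1) JH] ..
        finally show ?thesis ..
      qed
    qed (use Q Q2 J in auto)
  qed
  \<comment> \<open>Kolmogorov's extension theorem for Polish coordinate spaces; \<open>lim\<close>
    is the resulting measure on the product over \<open>I\<close>, and its coordinates are the
    process.\<close>
  interpret polish_projective I Q
  proof (intro polish_projective.intro projective_family.intro)
    show "Q J = distr (Q H) (PiM J (\<lambda>_. borel)) (\<lambda>f. restrict f J)"
      if "J \<subseteq> H" "finite H" "H \<subseteq> I" for J H
      using that by (rule consistent)
    show "prob_space (Q J)" if "finite J" "J \<subseteq> I" for J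
      using that by (rule Q(1))
  qed
  have char: "(CLINT \<omega>|lim. iexp (\<Sum>t\<in>J. c t * \<omega> t)) = exp (- (\<Sum>s\<in>J. \<Sum>t\<in>J. c s * c t * \<Gamma> s t) / 2)"
    if J: "finite J" "J \<subseteq> I" for J c
  proof -
    have r: "(\<lambda>f. restrict f J) \<in> measurable lim (PiM J (\<lambda>_. borel))"
      using J by (simp add: measurable_cong_sets[OF sets_lim refl] measurable_restrict_subset)
    have "distr lim (PiM J (\<lambda>_. borel)) (\<lambda>f. restrict f J) = Q J"
    proof (rule measure_eqI)
      fix A assume A: "A \<in> sets (distr lim (PiM J (\<lambda>_. borel)) (\<lambda>f. restrict f J))"
      then have "emeasure (distr lim (PiM J (\<lambda>_. borel)) (\<lambda>f. restrict f J)) A = lim (prod_emb I (\<lambda>_. borel) J A)"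
        using r by (simp add: emeasure_distr prod_emb_def space_PiM)
      then show "emeasure (distr lim (PiM J (\<lambda>_. borel)) (\<lambda>f. restrict f J)) A = emeasure (Q J) A"
        using A J by (simp add: emeasure_lim_emb)
    qed (simp add: Q(2)[OF J])
    then have "(CLINT \<omega>|Q J. iexp (\<Sum>t\<in>J. c t * \<omega> t)) = (CLINT \<omega>|lim. iexp (\<Sum>t\<in>J. c t * restrict \<omega> J t))"
      using integral_distr[OF r, of "\<lambda>\<omega>. iexp (\<Sum>t\<in>J. c t * \<omega> t)"]
      by (simp del: of_real_sum add: borel_measurable_sum borel_measurable_times measurable_component_singleton)
    also have "\<dots> = (CLINT \<omega>|lim. iexp (\<Sum>t\<in>J. c t * \<omega> t))"
      by (simp cong: sum.cong)
    finally show ?thesis using Q(3)[OF J] by simp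
  qed
  show thesis
    using P.prob_space_axioms coordinate_measurable[OF sets_lim] char
    by (rule that[of lim "\<lambda>t \<omega>. \<omega> t"])
qed

section \<open>The central limit theorem for finite dimensional distributions\<close>

text \<open>The copies are numbered from 1, whereas the central limit theorem takes a sequence
  starting at 0.\<close>

lemma (in prob_space) indep_vars_reindex_Suc:
  assumes "indep_vars (\<lambda>_. S) X {1..}"
  shows "indep_vars (\<lambda>_. S) (\<lambda>i. X (Suc i)) UNIV"
proof -
  let ?F = "\<lambda>i. {X i -` A \<inter> space M |A. A \<in> sets S}"
  have X: "\<And>i. i \<in> {1..} \<Longrightarrow> random_variable S (X i)" and ind: "indep_sets ?F {1..}"
    using assms unfolding indep_vars_def2 by auto
  have "indep_sets (\<lambda>i. ?F (Suc i)) UNIV"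
    unfolding indep_sets_def
  proof (intro conjI ballI allI impI)
    show "?F (Suc i) \<subseteq> events" for i
      using X[of "Suc i"] by auto
    fix J :: "nat set" and A assume J: "J \<subseteq> UNIV" "J \<noteq> {}" "finite J" and A: "A \<in> (\<Pi> j\<in>J. ?F (Suc j))"
    define B where "B i = A (i - 1)" for i
    have *: "Suc ` J \<subseteq> {1..}" "Suc ` J \<noteq> {}" "finite (Suc ` J)" using J by auto
    have "B \<in> (\<Pi> j\<in>Suc ` J. ?F j)"
      using A by (auto simp: B_def Pi_iff)
    then have "prob (\<Inter>j\<in>Suc ` J. B j) = (\<Prod>j\<in>Suc ` J. prob (B j))"
      using ind * unfolding indep_sets_def by blast
    then show "prob (\<Inter>j\<in>J. A j) = (\<Prod>j\<in>J. prob (A j))"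
      by (simp add: B_def prod.reindex)
  qed
  then show ?thesis
    using X unfolding indep_vars_def2 by auto
qed

section \<open>Normalised sums of independent copies\<close>

locale iid_sequence = prob_space P for P :: "'b measure" +
  fixes S :: "'s measure" and W :: "nat \<Rightarrow> 'b \<Rightarrow> 's"
  assumes indep: "indep_vars (\<lambda>_. S) W {1..}"
    and ident: "\<And>i. 1 \<le> i \<Longrightarrow> distr P S (W i) = distr P S (W 1)"
begin

lemma W_measurable: "1 \<le> i \<Longrightarrow> W i \<in> measurable P S"
  using indep by (auto simp: indep_vars_def2)

lemma integral_ident:
  fixes g :: "'s \<Rightarrow> real"
  assumes "g \<in> borel_measurable S" "1 \<le> i"
  shows "(LINT \<omega>|P. g (W i \<omega>)) = (LINT \<omega>|P. g (W 1 \<omega>))"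
  using integral_distr[OF W_measurable assms(1), of i] integral_distr[OF W_measurable assms(1), of 1]
    ident[OF assms(2)] assms(2) by simp

lemma integrable_ident:
  fixes g :: "'s \<Rightarrow> real"
  assumes "g \<in> borel_measurable S" "1 \<le> i"
  shows "integrable P (\<lambda>\<omega>. g (W i \<omega>)) \<longleftrightarrow> integrable P (\<lambda>\<omega>. g (W 1 \<omega>))"
  using integrable_distr_eq[OF W_measurable assms(1), of i] integrable_distr_eq[OF W_measurable assms(1), of 1]
    ident[OF assms(2)] assms(2) by simp

context
  fixes g :: "'s \<Rightarrow> real" and v :: real
  assumes g: "g \<in> borel_measurable S"
    and g_sq: "integrable P (\<lambda>\<omega>. (g (W 1 \<omega>))\<^sup>2)"
    and g_mean: "(LINT \<omega>|P. g (W 1 \<omega>)) = 0"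
    and g_var: "(LINT \<omega>|P. (g (W 1 \<omega>))\<^sup>2) = v"
begin

lemma indep_g: "indep_vars (\<lambda>_. borel) (\<lambda>i \<omega>. g (W i \<omega>)) {1..}"
  using indep g by (rule indep_vars_compose2)

lemma g_measurable: "1 \<le> i \<Longrightarrow> (\<lambda>\<omega>. g (W i \<omega>)) \<in> borel_measurable P"
  using W_measurable g by (rule measurable_compose)

lemma g_sq_integrable: "1 \<le> i \<Longrightarrow> integrable P (\<lambda>\<omega>. (g (W i \<omega>))\<^sup>2)"
  using integrable_ident[of "\<lambda>w. (g w)\<^sup>2" i] g g_sq by simp

lemma g_integrable: "1 \<le> i \<Longrightarrow> integrable P (\<lambda>\<omega>. g (W i \<omega>))"
  using square_integrable_imp_integrable[OF g_measurable g_sq_integrable] .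

lemma g_cross:
  assumes "1 \<le> i" "1 \<le> j"
  shows "integrable P (\<lambda>\<omega>. g (W i \<omega>) * g (W j \<omega>)) \<and>
    (LINT \<omega>|P. g (W i \<omega>) * g (W j \<omega>)) = (if i = j then v else 0)"
proof (cases "i = j")
  case True
  then show ?thesis
    using g_sq_integrable[OF assms(2)] integral_ident[of "\<lambda>w. (g w)\<^sup>2" j] g assms g_var
    by (simp add: power2_eq_square)
next
  case False
  have ind: "indep_vars (\<lambda>_. borel) (\<lambda>i \<omega>. g (W i \<omega>)) {i, j}"
    using assms by (intro indep_vars_subset[OF indep_g]) auto
  have int: "integrable P (\<lambda>\<omega>. g (W k \<omega>))" if "k \<in> {i, j}" for k
    using that assms g_integrable by auto
  show ?thesis
    using indep_vars_lebesgue_integral[OF _ ind int] indep_vars_integrable[OF _ ind int] False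
      integral_ident[OF g assms(1)] g_mean by simp
qed

text \<open>The mixed terms have mean 0, so the diagonal gives \<open>v\<close>. An inequality is
  stated because for \<open>n = 0\<close> the expression is 0.\<close>

lemma normalized_sum_sq:
  "integrable P (\<lambda>\<omega>. ((1 / sqrt (real n)) * (\<Sum>i=1..n. g (W i \<omega>)))\<^sup>2)"
  "(LINT \<omega>|P. ((1 / sqrt (real n)) * (\<Sum>i=1..n. g (W i \<omega>)))\<^sup>2) \<le> v"
proof -
  have eq: "((1 / sqrt (real n)) * (\<Sum>i=1..n. g (W i \<omega>)))\<^sup>2 =
      (1 / real n) * (\<Sum>i=1..n. \<Sum>j=1..n. g (W i \<omega>) * g (W j \<omega>))" for \<omega>
    unfolding power_mult_distrib power2_eq_square[of "sum _ _"] sum_product by (simp add: power_divide)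
  have int: "integrable P (\<lambda>\<omega>. g (W i \<omega>) * g (W j \<omega>))" if "i \<in> {1..n}" "j \<in> {1..n}" for i j
    using g_cross that by auto
  show "integrable P (\<lambda>\<omega>. ((1 / sqrt (real n)) * (\<Sum>i=1..n. g (W i \<omega>)))\<^sup>2)"
    unfolding eq using int by (intro integrable_mult_right Bochner_Integration.integrable_sum)
  have "(LINT \<omega>|P. ((1 / sqrt (real n)) * (\<Sum>i=1..n. g (W i \<omega>)))\<^sup>2) =
      (1 / real n) * (\<Sum>i=1..n. \<Sum>j=1..n. LINT \<omega>|P. g (W i \<omega>) * g (W j \<omega>))"
  proof -
    have "(LINT \<omega>|P. (\<Sum>i=1..n. \<Sum>j=1..n. g (W i \<omega>) * g (W j \<omega>))) =
        (\<Sum>i=1..n. LINT \<omega>|P. (\<Sum>j=1..n. g (W i \<omega>) * g (W j \<omega>)))"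
      using int by (intro Bochner_Integration.integral_sum Bochner_Integration.integrable_sum)
    also have "\<dots> = (\<Sum>i=1..n. \<Sum>j=1..n. LINT \<omega>|P. g (W i \<omega>) * g (W j \<omega>))"
      using int by (intro sum.cong refl Bochner_Integration.integral_sum)
    finally show ?thesis
      unfolding eq by simp
  qed
  also have "(\<Sum>i=1..n. \<Sum>j=1..n. LINT \<omega>|P. g (W i \<omega>) * g (W j \<omega>)) = (\<Sum>i=1..n. \<Sum>j=1..n. if i = j then v else 0)"
    using g_cross by (intro sum.cong) auto
  also have "\<dots> = real n * v" by simp
  also have "1 / real n * (real n * v) \<le> v"
    using g_var[symmetric] by (cases "n = 0") auto
  finally show "(LINT \<omega>|P. ((1 / sqrt (real n)) * (\<Sum>i=1..n. g (W i \<omega>)))\<^sup>2) \<le> v" .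
qed

text \<open>Standardising divides by the deviation, so \<open>v = 0\<close> is treated directly:
  almost surely all summands vanish. Otherwise the characteristic function of the standardised sum
  is evaluated at \<open>\<sigma>\<close>, which cancels that division.\<close>

lemma normalized_sum_char_tendsto:
  "(\<lambda>n. CLINT \<omega>|P. iexp ((1 / sqrt (real n)) * (\<Sum>i=1..n. g (W i \<omega>)))) \<longlonglongrightarrow> complex_of_real (exp (- v / 2))"
proof (cases "v = 0")
  case True
  have "AE \<omega> in P. g (W i \<omega>) = 0" if "1 \<le> i" for i
  proof -
    have "(LINT \<omega>|P. (g (W i \<omega>))\<^sup>2) = 0"
      using integral_ident[of "\<lambda>w. (g w)\<^sup>2" i] g that g_var True by simp
    then show ?thesis
      using integral_nonneg_eq_0_iff_AE[OF g_sq_integrable[OF that]] by simp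
  qed
  then have "AE \<omega> in P. \<forall>i\<in>{1..}. g (W i \<omega>) = 0"
    by (subst AE_ball_countable) auto
  then have "AE \<omega> in P. iexp ((1 / sqrt (real n)) * (\<Sum>i=1..n. g (W i \<omega>))) = 1" for n
    by eventually_elim simp
  then have "(CLINT \<omega>|P. iexp ((1 / sqrt (real n)) * (\<Sum>i=1..n. g (W i \<omega>)))) = (CLINT \<omega>|P. 1)" for n
    using g_measurable
    by (intro integral_cong_AE) (auto intro!: borel_measurable_times borel_measurable_sum simp del: of_real_sum of_real_mult)
  then show ?thesis
    by (simp add: True prob_space)
next
  case False
  have "0 \<le> v" unfolding g_var[symmetric] by simp
  define \<sigma> where "\<sigma> = sqrt v"
  have \<sigma>: "0 < \<sigma>" "\<sigma>\<^sup>2 = v" using False \<open>0 \<le> v\<close> by (auto simp: \<sigma>_def)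
  let ?X = "\<lambda>i \<omega>. g (W (Suc i) \<omega>)"
  let ?S = "\<lambda>n \<omega>. (\<Sum>i<n. ?X i \<omega>) / sqrt (real n * \<sigma>\<^sup>2)"
  have X: "?X i \<in> borel_measurable P" for i
    by (rule g_measurable) simp
  then have S: "?S n \<in> borel_measurable P" for n
    by (intro borel_measurable_divide borel_measurable_sum) auto
  have "weak_conv_m (\<lambda>n. distr P borel (?S n)) std_normal_distribution"
  proof (rule central_limit_theorem_zero_mean[where \<mu>="distr P borel (\<lambda>\<omega>. g (W 1 \<omega>))"])
    show "indep_vars (\<lambda>_. borel) ?X UNIV"
      by (rule indep_vars_reindex_Suc[OF indep_g])
    have mean: "expectation (?X n) = 0" for n
      using integral_ident[OF g, of "Suc n"] g_mean by simp
    then show "expectation (?X n) = 0" for n .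
    show "variance (?X n) = \<sigma>\<^sup>2" for n
      using integral_ident[of "\<lambda>w. (g w)\<^sup>2" "Suc n"] g g_var \<sigma> unfolding mean by simp
    show "distr P borel (?X n) = distr P borel (\<lambda>\<omega>. g (W 1 \<omega>))" for n
      using distr_distr[OF g W_measurable, of "Suc n"] distr_distr[OF g W_measurable, of 1] ident[of "Suc n"]
      by (simp add: comp_def)
  qed (use \<sigma> g_sq_integrable in auto)
  then have "(\<lambda>n. char (distr P borel (?S n)) \<sigma>) \<longlonglongrightarrow> char std_normal_distribution \<sigma>"
    using S by (intro levy_continuity1)
      (auto intro: real_distribution_distr real_distribution_normal)
  moreover have "char (distr P borel (?S n)) \<sigma> = (CLINT \<omega>|P. iexp ((1 / sqrt (real n)) * (\<Sum>i=1..n. g (W i \<omega>))))" for n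
  proof -
    have "\<sigma> * ?S n \<omega> = (1 / sqrt (real n)) * (\<Sum>i=1..n. g (W i \<omega>))" for \<omega>
    proof -
      have "sqrt (real n * \<sigma>\<^sup>2) = sqrt (real n) * \<sigma>"
        using \<sigma>(1) by (simp add: real_sqrt_mult)
      then show ?thesis
        using \<sigma>(1) by (simp add: sum.atLeast1_atMost_eq)
    qed
    moreover have "char (distr P borel (?S n)) \<sigma> = (CLINT \<omega>|P. iexp (\<sigma> * ?S n \<omega>))"
      unfolding char_def using S by (intro integral_distr) auto
    ultimately show ?thesis by simp
  qed
  ultimately show ?thesis
    using \<sigma> by (simp add: char_std_normal_distribution)
qed

end

end

text \<open>Covariances come by polarisation from the variances of \<open>G s\<close>,
  \<open>G t\<close> and \<open>G s + G t\<close>.\<close>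

lemma centered_gaussian_process_of_char:
  fixes G :: "real \<Rightarrow> 'n \<Rightarrow> real"
  assumes N: "prob_space N"
    and sym: "\<And>s t. s \<in> I \<Longrightarrow> t \<in> I \<Longrightarrow> \<Gamma> s t = \<Gamma> t s"
    and psd: "\<And>J c. finite J \<Longrightarrow> J \<subseteq> I \<Longrightarrow> 0 \<le> (\<Sum>s\<in>J. \<Sum>t\<in>J. c s * c t * \<Gamma> s t)"
    and G: "\<And>t. t \<in> I \<Longrightarrow> G t \<in> borel_measurable N"
    and char: "\<And>J c. finite J \<Longrightarrow> J \<subseteq> I \<Longrightarrow>
      (CLINT \<omega>|N. iexp (\<Sum>t\<in>J. c t * G t \<omega>)) = exp (- (\<Sum>s\<in>J. \<Sum>t\<in>J. c s * c t * \<Gamma> s t) / 2)"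
  shows "centered_gaussian_process N I G \<Gamma>"
    "\<And>t. t \<in> I \<Longrightarrow> integrable N (\<lambda>\<omega>. (G t \<omega>)\<^sup>2)"
    "\<And>t. t \<in> I \<Longrightarrow> (LINT \<omega>|N. (G t \<omega>)\<^sup>2) = \<Gamma> t t"
proof -
  have lin: "normal_rv N (\<lambda>\<omega>. \<Sum>t\<in>J. c t * G t \<omega>)" "integrable N (\<lambda>\<omega>. (\<Sum>t\<in>J. c t * G t \<omega>)\<^sup>2)"
      "(LINT \<omega>|N. (\<Sum>t\<in>J. c t * G t \<omega>)) = 0"
      "(LINT \<omega>|N. (\<Sum>t\<in>J. c t * G t \<omega>)\<^sup>2) = (\<Sum>s\<in>J. \<Sum>t\<in>J. c s * c t * \<Gamma> s t)"
    if J: "finite J" "J \<subseteq> I" for J c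
  proof -
    have GJ: "G t \<in> borel_measurable N" if "t \<in> J" for t using that J G by auto
    note * = linear_combination_of_char[where X=G and \<Gamma>=\<Gamma> and c=c, OF N J(1) GJ psd[OF J] char[OF J]]
    show "normal_rv N (\<lambda>\<omega>. \<Sum>t\<in>J. c t * G t \<omega>)" by (rule *(1))
    show "integrable N (\<lambda>\<omega>. (\<Sum>t\<in>J. c t * G t \<omega>)\<^sup>2)" by (rule *(2))
    show "(LINT \<omega>|N. (\<Sum>t\<in>J. c t * G t \<omega>)) = 0" by (rule *(3))
    show "(LINT \<omega>|N. (\<Sum>t\<in>J. c t * G t \<omega>)\<^sup>2) = (\<Sum>s\<in>J. \<Sum>t\<in>J. c s * c t * \<Gamma> s t)" by (rule *(4))
  qed
  show sq: "integrable N (\<lambda>\<omega>. (G t \<omega>)\<^sup>2)" "(LINT \<omega>|N. (G t \<omega>)\<^sup>2) = \<Gamma> t t" if "t \<in> I" for t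
    using lin(2,4)[of "{t}" "\<lambda>_. 1"] that by auto
  have mean: "(LINT \<omega>|N. G t \<omega>) = 0" if "t \<in> I" for t
    using lin(3)[of "{t}" "\<lambda>_. 1"] that by auto
  have cov: "covariance N (G s) (G t) = \<Gamma> s t" if st: "s \<in> I" "t \<in> I" for s t
  \<comment> \<open>For \<open>s = t\<close> the set \<open>{s, t}\<close> is a singleton, and the
    sum over it would not be \<open>G s + G t\<close>.\<close>
  proof (cases "s = t")
    case True
    then show ?thesis
      using sq(2)[OF st(2)] by (simp add: covariance_def mean st power2_eq_square)
  next
    case False
    have int: "integrable N (\<lambda>\<omega>. (G s \<omega> + G t \<omega>)\<^sup>2)"
      and E: "(LINT \<omega>|N. (G s \<omega> + G t \<omega>)\<^sup>2) = \<Gamma> s s + 2 * \<Gamma> s t + \<Gamma> t t"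
      using lin(2,4)[of "{s, t}" "\<lambda>_. 1"] st False sym[OF st] by auto
    have "(G s \<omega> - 0) * (G t \<omega> - 0) = ((G s \<omega> + G t \<omega>)\<^sup>2 - (G s \<omega>)\<^sup>2 - (G t \<omega>)\<^sup>2) / 2" for \<omega>
      by (simp add: power2_sum)
    then have "covariance N (G s) (G t) = (LINT \<omega>|N. ((G s \<omega> + G t \<omega>)\<^sup>2 - (G s \<omega>)\<^sup>2 - (G t \<omega>)\<^sup>2) / 2)"
      by (simp only: covariance_def mean[OF st(1)] mean[OF st(2)])
    also have "\<dots> = \<Gamma> s t"
      using int sq st E by simp
    finally show ?thesis .
  qed
  show "centered_gaussian_process N I G \<Gamma>"
    unfolding centered_gaussian_process_def using N lin(1) mean cov by blast
qed

context iid_sequence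
begin

text \<open>The Cramer-Wold device: a linear combination of coordinates is again a normalised sum of
  centred independent copies, with summands \<open>g J c (W i)\<close>. The variances of the same
  \<open>g J c\<close> show that \<open>\<Gamma>\<close> is positive semidefinite, so that a
  Gaussian process exists.\<close>

lemma fdd_central_limit:
  fixes h :: "real \<Rightarrow> 's \<Rightarrow> real"
  assumes h: "\<And>t. t \<in> I \<Longrightarrow> h t \<in> borel_measurable S"
    and h_sq: "\<And>t. t \<in> I \<Longrightarrow> integrable P (\<lambda>\<omega>. (h t (W 1 \<omega>))\<^sup>2)"
  shows "\<exists>(N :: (real \<Rightarrow> real) measure) G.
    centered_gaussian_process N I G (\<lambda>s t. (LINT \<omega>|P. h s (W 1 \<omega>) * h t (W 1 \<omega>)) -
      (LINT \<omega>|P. h s (W 1 \<omega>)) * (LINT \<omega>|P. h t (W 1 \<omega>))) \<and>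
    fdd_converges P (\<lambda>n t \<omega>. (1 / sqrt (real n)) * (\<Sum>i=1..n. h t (W i \<omega>)) -
      (LINT \<omega>|P. (1 / sqrt (real n)) * (\<Sum>i=1..n. h t (W i \<omega>)))) I N G"
proof -
  define m where "m t = (LINT \<omega>|P. h t (W 1 \<omega>))" for t
  define \<Gamma> where "\<Gamma> s t = (LINT \<omega>|P. h s (W 1 \<omega>) * h t (W 1 \<omega>)) - m s * m t" for s t
  define Z where "Z n t \<omega> = (1 / sqrt (real n)) * (\<Sum>i=1..n. h t (W i \<omega>)) -
      (LINT \<omega>|P. (1 / sqrt (real n)) * (\<Sum>i=1..n. h t (W i \<omega>)))" for n t \<omega>
  have hW: "(\<lambda>\<omega>. h t (W i \<omega>)) \<in> borel_measurable P" if "t \<in> I" "1 \<le> i" for t i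
    using W_measurable[OF that(2)] h[OF that(1)] by (rule measurable_compose)
  have int1: "integrable P (\<lambda>\<omega>. h t (W 1 \<omega>))" if "t \<in> I" for t
    by (rule square_integrable_imp_integrable[where f="\<lambda>\<omega>. h t (W 1 \<omega>)"])
       (use that hW[of t 1] h_sq[of t] in auto)
  have int_i: "integrable P (\<lambda>\<omega>. h t (W i \<omega>))" if "t \<in> I" "1 \<le> i" for t i
    using int1[OF that(1)] integrable_ident[OF h[OF that(1)] that(2)] by blast
  have int2: "integrable P (\<lambda>\<omega>. h s (W 1 \<omega>) * h t (W 1 \<omega>))" if "s \<in> I" "t \<in> I" for s t
  proof (rule Bochner_Integration.integrable_bound)
    show "integrable P (\<lambda>\<omega>. (h s (W 1 \<omega>))\<^sup>2 + (h t (W 1 \<omega>))\<^sup>2)"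
      by (intro Bochner_Integration.integrable_add h_sq that)
    show "(\<lambda>\<omega>. h s (W 1 \<omega>) * h t (W 1 \<omega>)) \<in> borel_measurable P"
      by (intro borel_measurable_times hW that) simp_all
    have "\<bar>x * y\<bar> \<le> x\<^sup>2 + y\<^sup>2" for x y :: real
    proof -
      have "2 * \<bar>x * y\<bar> \<le> x\<^sup>2 + y\<^sup>2"
        using sum_squares_bound[of "\<bar>x\<bar>" "\<bar>y\<bar>"] by (simp add: abs_mult mult.assoc)
      then show ?thesis by linarith
    qed
    then show "AE \<omega> in P. norm (h s (W 1 \<omega>) * h t (W 1 \<omega>)) \<le> norm ((h s (W 1 \<omega>))\<^sup>2 + (h t (W 1 \<omega>))\<^sup>2)"
      by simp
  qed
  define g where "g J c w = (\<Sum>t\<in>J. c t * (h t w - m t))" for J :: "real set" and c w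
  have g: "g J c \<in> borel_measurable S" if "J \<subseteq> I" for J c
    unfolding g_def using h that by (intro borel_measurable_sum borel_measurable_times borel_measurable_diff) auto
  have g_mean: "(LINT \<omega>|P. g J c (W 1 \<omega>)) = 0" if "J \<subseteq> I" for J c
  proof -
    have "(LINT \<omega>|P. g J c (W 1 \<omega>)) = (\<Sum>t\<in>J. LINT \<omega>|P. c t * (h t (W 1 \<omega>) - m t))"
      unfolding g_def using int1 that
      by (intro Bochner_Integration.integral_sum integrable_mult_right Bochner_Integration.integrable_diff) auto
    also have "\<dots> = (\<Sum>t\<in>J. 0)"
      using int1 that by (intro sum.cong) (auto simp: m_def prob_space)
    finally show ?thesis by simp
  qed
  have cross: "integrable P (\<lambda>\<omega>. (h s (W 1 \<omega>) - m s) * (h t (W 1 \<omega>) - m t))"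
      "(LINT \<omega>|P. (h s (W 1 \<omega>) - m s) * (h t (W 1 \<omega>) - m t)) = \<Gamma> s t" if st: "s \<in> I" "t \<in> I" for s t
  proof -
    have *: "(h s (W 1 \<omega>) - m s) * (h t (W 1 \<omega>) - m t) =
        h s (W 1 \<omega>) * h t (W 1 \<omega>) - m t * h s (W 1 \<omega>) - m s * h t (W 1 \<omega>) + m s * m t" for \<omega>
      by (simp add: algebra_simps)
    show "integrable P (\<lambda>\<omega>. (h s (W 1 \<omega>) - m s) * (h t (W 1 \<omega>) - m t))"
      "(LINT \<omega>|P. (h s (W 1 \<omega>) - m s) * (h t (W 1 \<omega>) - m t)) = \<Gamma> s t"
      unfolding * using int1 int2 st by (auto simp: \<Gamma>_def m_def[symmetric, unfolded One_nat_def] prob_space)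
  qed
  have g2: "(g J c w)\<^sup>2 = (\<Sum>s\<in>J. \<Sum>t\<in>J. c s * c t * ((h s w - m s) * (h t w - m t)))" for J c w
    unfolding g_def power2_eq_square sum_product by (simp add: mult_ac)
  have g_sq: "integrable P (\<lambda>\<omega>. (g J c (W 1 \<omega>))\<^sup>2)" if "J \<subseteq> I" for J c
    unfolding g2
    by (intro Bochner_Integration.integrable_sum integrable_mult_right cross subsetD[OF that])
  have g_var: "(LINT \<omega>|P. (g J c (W 1 \<omega>))\<^sup>2) = (\<Sum>s\<in>J. \<Sum>t\<in>J. c s * c t * \<Gamma> s t)" if "J \<subseteq> I" for J c
  proof -
    have "(LINT \<omega>|P. (g J c (W 1 \<omega>))\<^sup>2) =
        (\<Sum>s\<in>J. LINT \<omega>|P. (\<Sum>t\<in>J. c s * c t * ((h s (W 1 \<omega>) - m s) * (h t (W 1 \<omega>) - m t))))"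
      unfolding g2
      by (intro Bochner_Integration.integral_sum Bochner_Integration.integrable_sum integrable_mult_right
          cross subsetD[OF that])
    also have "\<dots> = (\<Sum>s\<in>J. \<Sum>t\<in>J. LINT \<omega>|P. c s * c t * ((h s (W 1 \<omega>) - m s) * (h t (W 1 \<omega>) - m t)))"
      by (intro sum.cong refl Bochner_Integration.integral_sum integrable_mult_right cross subsetD[OF that])
    also have "\<dots> = (\<Sum>s\<in>J. \<Sum>t\<in>J. c s * c t * \<Gamma> s t)"
      using subsetD[OF that] by (intro sum.cong refl) (simp add: cross del: One_nat_def)
    finally show ?thesis .
  qed
  have sym: "\<Gamma> s t = \<Gamma> t s" if "s \<in> I" "t \<in> I" for s t
    by (simp add: \<Gamma>_def mult.commute)
  have psd: "0 \<le> (\<Sum>s\<in>J. \<Sum>t\<in>J. c s * c t * \<Gamma> s t)" if "finite J" "J \<subseteq> I" for J c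
    unfolding g_var[OF that(2), symmetric] by simp
  have Z_eq: "Z n t \<omega> = (1 / sqrt (real n)) * (\<Sum>i=1..n. h t (W i \<omega>) - m t)" if "t \<in> I" for n t \<omega>
  proof -
    have "(LINT \<omega>|P. (1 / sqrt (real n)) * (\<Sum>i=1..n. h t (W i \<omega>))) =
        (1 / sqrt (real n)) * (\<Sum>i=1..n. LINT \<omega>|P. h t (W i \<omega>))"
      using int_i that by (simp add: Bochner_Integration.integral_sum)
    also have "(\<Sum>i=1..n. LINT \<omega>|P. h t (W i \<omega>)) = (\<Sum>i=1..n. m t)"
      unfolding m_def by (intro sum.cong refl integral_ident h that) simp
    finally show ?thesis
      unfolding Z_def by (simp add: sum_subtractf right_diff_distrib)
  qed
  have Z_lin: "(\<Sum>t\<in>J. c t * Z n t \<omega>) = (1 / sqrt (real n)) * (\<Sum>i=1..n. g J c (W i \<omega>))" if "J \<subseteq> I" for J c n \<omega>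
  proof -
    have "(\<Sum>t\<in>J. c t * Z n t \<omega>) = (\<Sum>t\<in>J. (1 / sqrt (real n)) * (\<Sum>i=1..n. c t * (h t (W i \<omega>) - m t)))"
      using that Z_eq by (intro sum.cong) (auto simp: sum_distrib_left mult_ac)
    also have "\<dots> = (1 / sqrt (real n)) * (\<Sum>i=1..n. g J c (W i \<omega>))"
      unfolding g_def by (subst sum.swap) (simp add: sum_distrib_left)
    finally show ?thesis .
  qed
  have Z_meas: "Z n t \<in> borel_measurable P" if "t \<in> I" for n t
    unfolding Z_eq[OF that, abs_def] using hW that
    by (intro borel_measurable_times borel_measurable_sum borel_measurable_diff) auto
  obtain N :: "(real \<Rightarrow> real) measure" and G where N: "prob_space N" and G: "\<And>t. t \<in> I \<Longrightarrow> G t \<in> borel_measurable N"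
    and char: "\<And>J c. finite J \<Longrightarrow> J \<subseteq> I \<Longrightarrow>
      (CLINT \<omega>|N. iexp (\<Sum>t\<in>J. c t * G t \<omega>)) = exp (- (\<Sum>s\<in>J. \<Sum>t\<in>J. c s * c t * \<Gamma> s t) / 2)"
    using gaussian_process_exists[OF sym psd] by blast
  have gp: "centered_gaussian_process N I G \<Gamma>"
    by (rule centered_gaussian_process_of_char(1)[OF N sym psd G char])
  have G_sq: "integrable N (\<lambda>\<omega>. (G t \<omega>)\<^sup>2)" if "t \<in> I" for t
    by (rule centered_gaussian_process_of_char(2)[OF N sym psd G char that])
  have G_var: "(LINT \<omega>|N. (G t \<omega>)\<^sup>2) = \<Gamma> t t" if "t \<in> I" for t
    by (rule centered_gaussian_process_of_char(3)[OF N sym psd G char that])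
  have "fdd_converges P Z I N G"
    unfolding fdd_converges_def
  proof (intro allI impI, elim conjE)
    fix J f assume J: "finite J" "J \<subseteq> I"
      and f: "continuous_map (product_topology (\<lambda>_. euclideanreal) J) euclideanreal f" "bounded (f ` (J \<rightarrow>\<^sub>E UNIV))"
    \<comment> \<open>The sum of the variances bounds each of them, as all are nonnegative; the
      normalised sums respect this bound for every \<open>n\<close>.\<close>
    define V where "V = (\<Sum>t\<in>J. \<Gamma> t t)"
    have diag: "0 \<le> \<Gamma> t t" if "t \<in> I" for t
      using psd[of "{t}" "\<lambda>_. 1"] that by simp
    have V: "\<Gamma> t t \<le> V" if "t \<in> J" for t
      unfolding V_def using that J diag by (intro member_le_sum) auto
    show "(\<lambda>n. LINT \<omega>|P. f (\<lambda>t\<in>J. Z n t \<omega>)) \<longlonglongrightarrow> (LINT \<omega>|N. f (\<lambda>t\<in>J. G t \<omega>))"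
    proof (rule fdd_expectation_tendsto[where P="\<lambda>_. P" and V=V, OF J(1) f])
      fix n t assume t: "t \<in> J"
      then have tI: "{t} \<subseteq> I" using J by auto
      have Zt: "Z n t \<omega> = (1 / sqrt (real n)) * (\<Sum>i=1..n. g {t} (\<lambda>_. 1) (W i \<omega>))" for \<omega>
        using Z_lin[OF tI, of "\<lambda>_. 1" n \<omega>] by simp
      show "integrable P (\<lambda>\<omega>. (Z n t \<omega>)\<^sup>2)"
        unfolding Zt by (rule normalized_sum_sq[OF g[OF tI] g_sq[OF tI] g_mean[OF tI] refl])
      have "(LINT \<omega>|P. (Z n t \<omega>)\<^sup>2) \<le> (LINT \<omega>|P. (g {t} (\<lambda>_. 1) (W 1 \<omega>))\<^sup>2)"
        unfolding Zt by (rule normalized_sum_sq[OF g[OF tI] g_sq[OF tI] g_mean[OF tI] refl])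
      also have "\<dots> = \<Gamma> t t"
        unfolding g_var[OF tI] by simp
      finally show "(LINT \<omega>|P. (Z n t \<omega>)\<^sup>2) \<le> V"
        using V[OF t] by simp
    next
      fix t assume t: "t \<in> J"
      then show "integrable N (\<lambda>\<omega>. (G t \<omega>)\<^sup>2)" "(LINT \<omega>|N. (G t \<omega>)\<^sup>2) \<le> V"
        using G_sq G_var subsetD[OF J(2) t] V[OF t] by simp_all
    next
      fix c
      show "(\<lambda>n. CLINT \<omega>|P. iexp (\<Sum>t\<in>J. c t * Z n t \<omega>)) \<longlonglongrightarrow> (CLINT \<omega>|N. iexp (\<Sum>t\<in>J. c t * G t \<omega>))"
        unfolding Z_lin[OF J(2)] char[OF J]
        by (rule normalized_sum_char_tendsto[OF g[OF J(2)] g_sq[OF J(2)] g_mean[OF J(2)] g_var[OF J(2)]])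
    qed (use prob_space_axioms N Z_meas G J in auto)
  qed
  with gp show ?thesis
    unfolding Z_def[abs_def] \<Gamma>_def[abs_def] m_def by blast
qed

end

section \<open>Emission times in a window\<close>

definition emission :: "(nat \<Rightarrow> real) \<Rightarrow> (nat \<Rightarrow> nat) \<Rightarrow> (nat \<Rightarrow> nat \<Rightarrow> real) \<Rightarrow> nat \<Rightarrow> nat \<Rightarrow> real" where
  "emission f l r k m = (\<Sum>i\<in>{1..<k}. f i + on_time l r i) + f k + (\<Sum>j=1..m. r k j)"

lemma emission_times_eq: "emission_times f l r = {emission f l r k m | k m. 1 \<le> k \<and> m \<le> l k}"
  by (simp add: emission_times_def emission_def)

lemma emission_first_cycle: "emission f l r 1 m = f 1 + (\<Sum>j=1..m. r 1 j)"
  by (simp add: emission_def)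

text \<open>\<open>enn2real\<close> sends \<open>top\<close> to 0, as \<open>card\<close> does with
  infinite sets, so no local finiteness is assumed. Back in \<open>ennreal\<close> an inequality
  remains, which is all that upper bounds ask for.\<close>

lemma delta_integral_eq: "delta_integral a b S = enn2real (emeasure (count_space UNIV) (S \<inter> {a<..b}))"
  by (simp add: delta_integral_def emeasure_count_space)

lemma ennreal_delta_integral_le:
  "ennreal (delta_integral a b S) \<le> emeasure (count_space UNIV) (S \<inter> {a<..b})"
  by (simp add: delta_integral_def emeasure_count_space ennreal_of_nat_eq_real_of_nat)

text \<open>A packet of cycle \<open>k+2\<close> is preceded by the whole first cycle, by
  \<open>k\<close> further OFF-durations and by \<open>m\<close> gaps; the other terms are
  nonnegative. These \<open>k + m\<close> variables produce decay in both indices.\<close>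

lemma emission_later_cycle_ge:
  assumes f: "\<And>i. 1 \<le> i \<Longrightarrow> 0 \<le> f i" and r: "\<And>i j. 1 \<le> i \<Longrightarrow> 1 \<le> j \<Longrightarrow> 0 \<le> r i j"
  shows "f 1 + on_time l r 1 + (\<Sum>i\<in>{2..<k+2}. f i) + (\<Sum>j=1..m. r (k+2) j) \<le> emission f l r (k+2) m"
proof -
  have on: "0 \<le> on_time l r i" if "1 \<le> i" for i
    unfolding on_time_def using r that by (intro sum_nonneg) auto
  have "{1..<k+2} = insert 1 {2..<k+2}" by auto
  then have "(\<Sum>i\<in>{1..<k+2}. f i + on_time l r i) = f 1 + on_time l r 1 + (\<Sum>i\<in>{2..<k+2}. f i + on_time l r i)"
    by simp
  moreover have "(\<Sum>i\<in>{2..<k+2}. f i) \<le> (\<Sum>i\<in>{2..<k+2}. f i + on_time l r i)"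
    using on by (intro sum_mono) auto
  ultimately show ?thesis
    unfolding emission_def using f[of "k+2"] by simp
qed

definition in_window :: "(nat \<Rightarrow> real) \<Rightarrow> (nat \<Rightarrow> nat) \<Rightarrow> (nat \<Rightarrow> nat \<Rightarrow> real) \<Rightarrow> real \<Rightarrow> nat \<Rightarrow> real \<Rightarrow> ennreal" where
  "in_window f l r t m u = of_bool (m \<le> l 1 \<and> u < emission f l r 1 m \<and> emission f l r 1 m \<le> u + t)"

text \<open>A bound free of \<open>u\<close> and of the loads: \<open>m\<close> runs over all
  natural numbers, which removes the heavy-tailed variable, and the growth of the gap sums keeps the
  count small.\<close>

definition later_count :: "(nat \<Rightarrow> real) \<Rightarrow> (nat \<Rightarrow> nat \<Rightarrow> real) \<Rightarrow> real \<Rightarrow> ennreal" where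
  "later_count f r t = (\<Sum>k. \<Sum>m. of_bool ((\<Sum>i\<in>{2..<k+2}. f i) + (\<Sum>j=1..m. r (k+2) j) \<le> t))"

text \<open>Since \<open>u\<close> is at most the end of the first cycle, a later packet in the
  window lies at most \<open>t\<close> after that end, and the window must reach past it. Gaps may
  be 0, so different indices can give the same time; coincidences only lower the count, and union
  bounds suffice.\<close>

lemma count_split:
  assumes f: "\<And>i. 1 \<le> i \<Longrightarrow> 0 \<le> f i" and r: "\<And>i j. 1 \<le> i \<Longrightarrow> 1 \<le> j \<Longrightarrow> 0 \<le> r i j"
    and u: "u \<le> f 1 + on_time l r 1"
  shows "emeasure (count_space UNIV) (shift_train u (emission_times f l r) \<inter> {0<..t}) \<le>
    (\<Sum>m. in_window f l r t m u) + of_bool (f 1 + on_time l r 1 - t \<le> u) * later_count f r t"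
proof -
  let ?Y = "f 1 + on_time l r 1"
  let ?\<mu> = "emeasure (count_space (UNIV :: real set))"
  define A where "A m = (if m \<le> l 1 \<and> u < emission f l r 1 m \<and> emission f l r 1 m \<le> u + t
    then {emission f l r 1 m - u} else {})" for m
  define B where "B k m = (if ?Y - t \<le> u \<and> (\<Sum>i\<in>{2..<k+2}. f i) + (\<Sum>j=1..m. r (k+2) j) \<le> t
    then {emission f l r (k+2) m - u} else {})" for k m
  have sub: "shift_train u (emission_times f l r) \<inter> {0<..t} \<subseteq> (\<Union>m. A m) \<union> (\<Union>k. \<Union>m. B k m)"
  proof
    fix x assume "x \<in> shift_train u (emission_times f l r) \<inter> {0<..t}"
    then obtain k m where km: "1 \<le> k" "m \<le> l k" "u + x = emission f l r k m" and x: "0 < x" "x \<le> t"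
      by (auto simp: shift_train_def emission_times_eq)
    show "x \<in> (\<Union>m. A m) \<union> (\<Union>k. \<Union>m. B k m)"
    proof (cases "k = 1")
      case True
      then have "x \<in> A m" using km x by (auto simp: A_def)
      then show ?thesis by blast
    next
      case False
      define k' where "k' = k - 2"
      have k': "k = k' + 2" using False km(1) by (simp add: k'_def)
      have ge: "?Y + (\<Sum>i\<in>{2..<k'+2}. f i) + (\<Sum>j=1..m. r (k'+2) j) \<le> u + x"
        unfolding km(3) k' by (rule emission_later_cycle_ge[OF f r])
      moreover have "0 \<le> (\<Sum>i\<in>{2..<k'+2}. f i)" "0 \<le> (\<Sum>j=1..m. r (k'+2) j)"
        by (rule sum_nonneg, use f in simp) (rule sum_nonneg, use r in simp)
      ultimately have "x \<in> B k' m"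
        using km(3) x u by (auto simp: B_def k')
      then show ?thesis by blast
    qed
  qed
  have "?\<mu> (\<Union>m. A m) \<le> (\<Sum>m. ?\<mu> (A m))"
    by (rule emeasure_subadditive_countably) auto
  also have "(\<Sum>m. ?\<mu> (A m)) = (\<Sum>m. in_window f l r t m u)"
    by (intro suminf_cong) (auto simp: A_def in_window_def)
  finally have 1: "?\<mu> (\<Union>m. A m) \<le> (\<Sum>m. in_window f l r t m u)" .
  have "?\<mu> (\<Union>k. \<Union>m. B k m) \<le> (\<Sum>k. ?\<mu> (\<Union>m. B k m))"
    by (rule emeasure_subadditive_countably) auto
  also have "\<dots> \<le> (\<Sum>k. \<Sum>m. ?\<mu> (B k m))"
    by (intro suminf_le summableI emeasure_subadditive_countably) auto
  also have "\<dots> = (\<Sum>k. \<Sum>m. of_bool (?Y - t \<le> u) * of_bool ((\<Sum>i\<in>{2..<k+2}. f i) + (\<Sum>j=1..m. r (k+2) j) \<le> t))"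
    by (intro suminf_cong) (auto simp: B_def)
  also have "\<dots> = of_bool (?Y - t \<le> u) * later_count f r t"
    by (simp add: later_count_def)
  finally have 2: "?\<mu> (\<Union>k. \<Union>m. B k m) \<le> of_bool (?Y - t \<le> u) * later_count f r t" .
  have "?\<mu> (shift_train u (emission_times f l r) \<inter> {0<..t}) \<le> ?\<mu> ((\<Union>m. A m) \<union> (\<Union>k. \<Union>m. B k m))"
    using sub by (rule emeasure_mono) simp
  also have "\<dots> \<le> ?\<mu> (\<Union>m. A m) + ?\<mu> (\<Union>k. \<Union>m. B k m)"
    by (rule emeasure_subadditive) auto
  also have "\<dots> \<le> (\<Sum>m. in_window f l r t m u) + of_bool (?Y - t \<le> u) * later_count f r t"
    using 1 2 by (rule add_mono)
  finally show ?thesis .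
qed

lemma ennreal_power2_add_le: "(a + b)\<^sup>2 \<le> 2 * a\<^sup>2 + 2 * (b\<^sup>2 :: ennreal)"
proof (cases "a = top \<or> b = top")
  case True
  then show ?thesis by (auto simp: power2_eq_square ennreal_mult_eq_top_iff ennreal_top_mult ennreal_mult_top)
next
  case False
  then obtain x y where xy: "a = ennreal x" "b = ennreal y" "0 \<le> x" "0 \<le> y"
    by (metis ennreal_cases)
  have "(x + y)\<^sup>2 \<le> 2 * x\<^sup>2 + 2 * y\<^sup>2"
    using sum_squares_bound[of x y] by (simp add: power2_sum)
  then have "ennreal ((x + y)\<^sup>2) \<le> ennreal (2 * x\<^sup>2) + ennreal (2 * y\<^sup>2)"
    by (metis ennreal_leI ennreal_plus mult_nonneg_nonneg zero_le_numeral zero_le_power2)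
  moreover have "(a + b)\<^sup>2 = ennreal ((x + y)\<^sup>2)"
    using xy by (simp add: ennreal_power flip: ennreal_plus)
  moreover have "2 * a\<^sup>2 = ennreal (2 * x\<^sup>2)" "2 * b\<^sup>2 = ennreal (2 * y\<^sup>2)"
    using xy by (simp_all add: ennreal_power ennreal_mult)
  ultimately show ?thesis by simp
qed

lemma ennreal_suminf_power2: "(\<Sum>i. x i :: ennreal)\<^sup>2 = (\<Sum>i. \<Sum>j. x i * x j)"
  by (simp add: power2_eq_square)

lemma in_window_measurable [measurable]: "in_window f l r t m \<in> borel_measurable borel"
  unfolding in_window_def[abs_def] of_bool_def by measurable

text \<open>The constant \<open>t * exp t\<close> has two sources: the admissible \<open>u\<close>
  lie in an interval of length \<open>t\<close>, and \<open>D \<le> t\<close> bounds the indicator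
  by \<open>exp (t - D)\<close>, which splits into factors over the gaps between the two
  packets.\<close>

lemma nn_integral_in_window_pair:
  assumes t: "0 \<le> t" and ij: "i \<le> j"
  shows "(\<integral>\<^sup>+u. in_window f l r t i u * in_window f l r t j u \<partial>lborel) \<le>
    ennreal (t * exp t) * (of_bool (j \<le> l 1) * (\<Prod>k\<in>{i<..j}. ennreal (exp (- r 1 k))))"
proof -
  let ?p = "emission f l r 1"
  define D where "D = (\<Sum>k\<in>{i<..j}. r 1 k)"
  have D: "?p j - ?p i = D"
  proof -
    have "{1..j} = {1..i} \<union> {i<..j}" using ij by auto
    then have "(\<Sum>k=1..j. r 1 k) = (\<Sum>k=1..i. r 1 k) + D"
      unfolding D_def by (simp only:) (rule sum.union_disjoint; auto)
    then show ?thesis by (simp only: emission_first_cycle)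
  qed
  have "in_window f l r t i u * in_window f l r t j u \<le>
      of_bool (j \<le> l 1) * ennreal (exp (t - D)) * indicator {?p j - t..?p j} u" for u
  proof (cases "i \<le> l 1 \<and> j \<le> l 1 \<and> u < ?p i \<and> ?p i \<le> u + t \<and> u < ?p j \<and> ?p j \<le> u + t")
    case True
    then have "D \<le> t" using D by linarith
    then have "1 \<le> ennreal (exp (t - D))" by simp
    then show ?thesis using True by (simp add: in_window_def)
  next
    case False
    then show ?thesis by (auto simp: in_window_def)
  qed
  then have "(\<integral>\<^sup>+u. in_window f l r t i u * in_window f l r t j u \<partial>lborel) \<le>
      (\<integral>\<^sup>+u. of_bool (j \<le> l 1) * ennreal (exp (t - D)) * indicator {?p j - t..?p j} u \<partial>lborel)"
    by (intro nn_integral_mono)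
  also have "\<dots> = of_bool (j \<le> l 1) * ennreal (exp (t - D)) * ennreal t"
    using t by (subst nn_integral_cmult_indicator) auto
  also have "ennreal (exp (t - D)) = ennreal (exp t) * (\<Prod>k\<in>{i<..j}. ennreal (exp (- r 1 k)))"
  proof -
    have "exp (t - D) = exp t * (\<Prod>k\<in>{i<..j}. exp (- r 1 k))"
      by (simp add: D_def exp_sum[symmetric] sum_negf mult_exp_exp)
    then show ?thesis
      by (simp add: prod_ennreal ennreal_mult prod_nonneg)
  qed
  finally show ?thesis
    using t by (simp add: ennreal_mult mult_ac)
qed

lemma nn_integral_in_window_sq:
  assumes t: "0 \<le> t"
  shows "(\<integral>\<^sup>+u. (\<Sum>m. in_window f l r t m u)\<^sup>2 \<partial>lborel) \<le>
    (\<Sum>i. \<Sum>j. ennreal (t * exp t) *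
      (of_bool (max i j \<le> l 1) * (\<Prod>k\<in>{min i j<..max i j}. ennreal (exp (- r 1 k)))))"
proof -
  have "(\<integral>\<^sup>+u. (\<Sum>m. in_window f l r t m u)\<^sup>2 \<partial>lborel) =
      (\<Sum>i. \<Sum>j. \<integral>\<^sup>+u. in_window f l r t i u * in_window f l r t j u \<partial>lborel)"
    unfolding ennreal_suminf_power2
    by (subst nn_integral_suminf, measurable, intro suminf_cong, rule nn_integral_suminf, measurable)
  also have "\<dots> \<le> (\<Sum>i. \<Sum>j. ennreal (t * exp t) *
      (of_bool (max i j \<le> l 1) * (\<Prod>k\<in>{min i j<..max i j}. ennreal (exp (- r 1 k)))))"
  proof (intro suminf_le summableI)
    fix i j
    show "(\<integral>\<^sup>+u. in_window f l r t i u * in_window f l r t j u \<partial>lborel) \<le> ennreal (t * exp t) *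
      (of_bool (max i j \<le> l 1) * (\<Prod>k\<in>{min i j<..max i j}. ennreal (exp (- r 1 k))))"
    proof (cases "i \<le> j")
      case True
      then show ?thesis using nn_integral_in_window_pair[OF t True, of f l r] by (simp add: max_def min_def)
    next
      case False
      then have "j \<le> i" by simp
      from nn_integral_in_window_pair[OF t this, of f l r] show ?thesis
        using False by (simp add: max_def min_def mult.commute)
    qed
  qed
  finally show ?thesis .
qed

section \<open>Moments of the packet source\<close>

text \<open>The loads enter through a finite sum of tails and the gaps through not being almost
  surely 0: the forms in which the moment bounds use the tail and small-ball hypotheses.\<close>

locale packet_source = prob_space M for M :: "'a measure" +
  fixes Of :: "nat \<Rightarrow> 'a \<Rightarrow> real" and L :: "nat \<Rightarrow> 'a \<Rightarrow> nat" and R :: "nat \<Rightarrow> nat \<Rightarrow> 'a \<Rightarrow> real"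
  assumes indep: "indep_vars (\<lambda>_. borel) (source_var Of L R) source_indices"
    and Of_ident: "\<And>i. 1 \<le> i \<Longrightarrow> distr M borel (Of i) = distr M borel (Of 1)"
    and Of_pos: "AE \<omega> in M. 0 < Of 1 \<omega>"
    and R_ident: "\<And>i j. 1 \<le> i \<Longrightarrow> 1 \<le> j \<Longrightarrow> distr M borel (R i j) = distr M borel (R 1 1)"
    and R_nonneg: "AE \<omega> in M. 0 \<le> R 1 1 \<omega>"
    and R_nonzero: "\<not> (AE \<omega> in M. R 1 1 \<omega> = 0)"
    and L_mean: "(\<Sum>i. emeasure M {\<omega> \<in> space M. i \<le> L 1 \<omega>}) < top"
begin

lemma source_var_measurable: "n \<in> source_indices \<Longrightarrow> source_var Of L R n \<in> borel_measurable M"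
  using indep by (auto simp: indep_vars_def2)

lemma Of_measurable: "1 \<le> i \<Longrightarrow> Of i \<in> borel_measurable M"
  using source_var_measurable[of "Off i"] by (auto simp: source_indices_def)

lemma R_measurable: "1 \<le> i \<Longrightarrow> 1 \<le> j \<Longrightarrow> R i j \<in> borel_measurable M"
  using source_var_measurable[of "Gap i j"] by (auto simp: source_indices_def)

lemma L_measurable: "1 \<le> i \<Longrightarrow> L i \<in> measurable M (count_space UNIV)"
proof -
  assume "1 \<le> i"
  then have "(\<lambda>\<omega>. real (L i \<omega>)) \<in> borel_measurable M"
    using source_var_measurable[of "Load i"] by (auto simp: source_indices_def)
  \<comment> \<open>\<open>source_var\<close> only gives measurability of the load cast to a real;
    taking the floor undoes the cast.\<close>
  then have "(\<lambda>\<omega>. nat \<lfloor>real (L i \<omega>)\<rfloor>) \<in> measurable M (count_space UNIV)"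
    by measurable
  then show ?thesis by simp
qed

lemma AE_positive:
  "AE \<omega> in M. (\<forall>i\<ge>1. 0 < Of i \<omega>) \<and> (\<forall>i\<ge>1. \<forall>j\<ge>1. 0 \<le> R i j \<omega>)"
proof -
  have "AE \<omega> in M. 0 < Of i \<omega>" if i: "1 \<le> i" for i
  proof -
    have "AE x in distr M borel (Of 1). 0 < x"
      using Of_pos by (subst AE_distr_iff) (auto simp: Of_measurable)
    then have "AE x in distr M borel (Of i). 0 < x"
      by (simp only: Of_ident[OF i])
    then show ?thesis
      by (subst (asm) AE_distr_iff) (auto simp: Of_measurable[OF i])
  qed
  moreover have "AE \<omega> in M. 0 \<le> R i j \<omega>" if ij: "1 \<le> i" "1 \<le> j" for i j
  proof -
    have "AE x in distr M borel (R 1 1). 0 \<le> x"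
      using R_nonneg by (subst AE_distr_iff) (auto simp: R_measurable)
    then have "AE x in distr M borel (R i j). 0 \<le> x"
      by (simp only: R_ident[OF ij])
    then show ?thesis
      by (subst (asm) AE_distr_iff) (auto simp: R_measurable[OF ij])
  qed
  ultimately show ?thesis
    by (auto simp: AE_all_countable)
qed

text \<open>The Laplace transform at 1: the factor by which each further OFF-duration lowers a
  probability bound. \<open>gap_transform\<close> does the same for gaps.\<close>

definition off_transform :: ennreal where
  "off_transform = (\<integral>\<^sup>+\<omega>. ennreal (exp (- Of 1 \<omega>)) \<partial>M)"

definition gap_transform :: ennreal where
  "gap_transform = (\<integral>\<^sup>+\<omega>. ennreal (exp (- R 1 1 \<omega>)) \<partial>M)"

text \<open>\<open>1 - exp (- X)\<close> is almost surely nonnegative; an expectation equal to 0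
  would force \<open>X\<close> to vanish almost surely.\<close>

lemma laplace_transform_less_1:
  assumes X: "X \<in> borel_measurable M" "AE \<omega> in M. 0 \<le> X \<omega>" "\<not> (AE \<omega> in M. X \<omega> = 0)"
  shows "(\<integral>\<^sup>+\<omega>. ennreal (exp (- X \<omega>)) \<partial>M) < 1"
proof -
  have int: "integrable M (\<lambda>\<omega>. exp (- X \<omega>))"
    using X by (intro integrable_const_bound[where B=1]) (auto elim: eventually_mono)
  have nonneg: "AE \<omega> in M. 0 \<le> 1 - exp (- X \<omega>)"
    using X(2) by eventually_elim simp
  have "expectation (\<lambda>\<omega>. 1 - exp (- X \<omega>)) \<noteq> 0"
  proof
    assume "expectation (\<lambda>\<omega>. 1 - exp (- X \<omega>)) = 0"
    then have "AE \<omega> in M. 1 - exp (- X \<omega>) = 0"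
      using int nonneg by (subst (asm) integral_nonneg_eq_0_iff_AE) auto
    then show False using X(3) by simp
  qed
  moreover have "0 \<le> expectation (\<lambda>\<omega>. 1 - exp (- X \<omega>))"
    using nonneg by (rule integral_nonneg_AE)
  moreover have "expectation (\<lambda>\<omega>. 1 - exp (- X \<omega>)) = 1 - expectation (\<lambda>\<omega>. exp (- X \<omega>))"
    using int by (simp add: prob_space)
  ultimately have "expectation (\<lambda>\<omega>. exp (- X \<omega>)) < 1" by linarith
  then show ?thesis
    using int by (subst nn_integral_eq_integral) (auto simp: ennreal_less_one_iff)
qed

lemma off_transform_less_1: "off_transform < 1"
  unfolding off_transform_def
proof (rule laplace_transform_less_1)
  show "\<not> (AE \<omega> in M. Of 1 \<omega> = 0)"
  proof
    assume "AE \<omega> in M. Of 1 \<omega> = 0"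
    with Of_pos have "AE \<omega> in M. False" by eventually_elim simp
    then show False by simp
  qed
qed (use Of_measurable[of 1] Of_pos in \<open>auto elim: eventually_mono\<close>)

lemma gap_transform_less_1: "gap_transform < 1"
  unfolding gap_transform_def
  by (rule laplace_transform_less_1) (use R_measurable[of 1 1] R_nonneg R_nonzero in auto)

lemma nn_integral_Of: "1 \<le> i \<Longrightarrow> (\<integral>\<^sup>+\<omega>. ennreal (exp (- Of i \<omega>)) \<partial>M) = off_transform"
  using nn_integral_distr[of "Of i" M borel "\<lambda>x. ennreal (exp (- x))"]
    nn_integral_distr[of "Of 1" M borel "\<lambda>x. ennreal (exp (- x))"] Of_measurable Of_ident[of i]
  by (simp add: off_transform_def)

lemma nn_integral_R: "1 \<le> i \<Longrightarrow> 1 \<le> j \<Longrightarrow> (\<integral>\<^sup>+\<omega>. ennreal (exp (- R i j \<omega>)) \<partial>M) = gap_transform"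
  using nn_integral_distr[of "R i j" M borel "\<lambda>x. ennreal (exp (- x))"]
    nn_integral_distr[of "R 1 1" M borel "\<lambda>x. ennreal (exp (- x))"] R_measurable R_ident[of i j]
  by (simp add: gap_transform_def)

text \<open>The constructors of \<open>source_index\<close> keep the three groups of variables
  disjoint, so independence is used in one product. The function \<open>h\<close> is later a
  constant or the indicator of a large load.\<close>

lemma nn_integral_product:
  assumes A: "finite A" "A \<subseteq> {1..}" and B: "finite B" "B \<subseteq> {1..}" and k: "1 \<le> k"
    and h: "h \<in> borel_measurable borel"
  shows "(\<integral>\<^sup>+\<omega>. h (real (L 1 \<omega>)) * ((\<Prod>i\<in>A. ennreal (exp (- Of i \<omega>))) * (\<Prod>j\<in>B. ennreal (exp (- R k j \<omega>)))) \<partial>M) =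
    (\<integral>\<^sup>+\<omega>. h (real (L 1 \<omega>)) \<partial>M) * (off_transform ^ card A * gap_transform ^ card B)"
proof -
  let ?F = "insert (Load 1) (Off ` A \<union> Gap k ` B)"
  define g where "g n = (case n of Load _ \<Rightarrow> h | _ \<Rightarrow> (\<lambda>x. ennreal (exp (- x))))" for n
  have g: "g n \<in> borel_measurable borel" for n
    using h by (cases n) (simp_all add: g_def)
  have F: "finite ?F" "?F \<subseteq> source_indices"
    using A B k by (auto simp: source_indices_def)
  have ind: "indep_vars (\<lambda>_. borel) (\<lambda>n \<omega>. g n (source_var Of L R n \<omega>)) ?F"
    by (rule indep_vars_compose2[OF indep_vars_subset[OF indep F(2)] g])
  have prod: "(\<Prod>n\<in>?F. G n) = G (Load 1) * ((\<Prod>i\<in>A. G (Off i)) * (\<Prod>j\<in>B. G (Gap k j)))" for G :: "source_index \<Rightarrow> ennreal"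
  proof -
    have "(\<Prod>n\<in>?F. G n) = G (Load 1) * (\<Prod>n\<in>Off ` A \<union> Gap k ` B. G n)"
      using A B by (intro prod.insert) auto
    also have "(\<Prod>n\<in>Off ` A \<union> Gap k ` B. G n) = (\<Prod>n\<in>Off ` A. G n) * (\<Prod>n\<in>Gap k ` B. G n)"
      using A B by (intro prod.union_disjoint) auto
    finally show ?thesis
      by (simp add: prod.reindex inj_on_def)
  qed
  have "(\<integral>\<^sup>+\<omega>. (\<Prod>n\<in>?F. g n (source_var Of L R n \<omega>)) \<partial>M) =
      (\<Prod>n\<in>?F. \<integral>\<^sup>+\<omega>. g n (source_var Of L R n \<omega>) \<partial>M)"
    by (rule indep_vars_nn_integral[OF F(1) ind]) simp
  then have "(\<integral>\<^sup>+\<omega>. h (real (L 1 \<omega>)) * ((\<Prod>i\<in>A. ennreal (exp (- Of i \<omega>))) * (\<Prod>j\<in>B. ennreal (exp (- R k j \<omega>)))) \<partial>M) =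
    (\<integral>\<^sup>+\<omega>. h (real (L 1 \<omega>)) \<partial>M) * ((\<Prod>i\<in>A. \<integral>\<^sup>+\<omega>. ennreal (exp (- Of i \<omega>)) \<partial>M) *
      (\<Prod>j\<in>B. \<integral>\<^sup>+\<omega>. ennreal (exp (- R k j \<omega>)) \<partial>M))"
    unfolding prod by (simp add: g_def)
  also have "(\<Prod>i\<in>A. \<integral>\<^sup>+\<omega>. ennreal (exp (- Of i \<omega>)) \<partial>M) = off_transform ^ card A"
    using A nn_integral_Of by (simp add: subset_eq)
  also have "(\<Prod>j\<in>B. \<integral>\<^sup>+\<omega>. ennreal (exp (- R k j \<omega>)) \<partial>M) = gap_transform ^ card B"
    using B k nn_integral_R by (simp add: subset_eq)
  finally show ?thesis .
qed

end

section \<open>Geometric and double series of extended nonnegative reals\<close>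

lemma suminf_geometric_ennreal:
  fixes x :: ennreal
  assumes "x < 1"
  shows "(\<Sum>n. x ^ n) < top"
proof -
  obtain y where y: "x = ennreal y" "0 \<le> y"
    using assms by (cases x) auto
  then have "y < 1" using assms by (simp add: ennreal_less_one_iff)
  then have "summable (\<lambda>n. y ^ n)" using y by (intro summable_geometric) auto
  then show ?thesis
    using y by (simp add: ennreal_power suminf_ennreal2 del: suminf_ennreal)
qed

text \<open>The exponent is the distance of \<open>i\<close> and \<open>j\<close>, and each distance
  from \<open>i\<close> occurs at most twice.\<close>

lemma suminf_geometric_distance_le:
  fixes x :: ennreal
  shows "(\<Sum>j. x ^ (max i j - min i j)) \<le> 2 * (\<Sum>n. x ^ n)"
proof -
  have "(\<Sum>j. x ^ (max i j - min i j)) = (\<Sum>j. x ^ (max i (j + i) - min i (j + i))) + (\<Sum>j<i. x ^ (max i j - min i j))"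
    by (rule suminf_offset) simp
  also have "(\<Sum>j. x ^ (max i (j + i) - min i (j + i))) = (\<Sum>n. x ^ n)"
    by (simp add: max_def min_def)
  also have "(\<Sum>j<i. x ^ (max i j - min i j)) = (\<Sum>j<i. x ^ (i - j))"
    by (intro sum.cong) auto
  also have "\<dots> = (\<Sum>j<i. x ^ Suc j)"
    by (subst sum.nat_diff_reindex[symmetric]) (auto intro!: sum.cong simp: Suc_diff_Suc)
  also have "\<dots> = (\<Sum>j\<in>Suc ` {..<i}. x ^ j)"
    by (simp add: sum.reindex)
  also have "\<dots> \<le> (\<Sum>n. x ^ n)"
    by (rule sum_le_suminf) auto
  finally show ?thesis by (simp add: mult_2 add_left_mono)
qed

text \<open>A bound on the mixed integrals that is a product of a factor in \<open>i\<close> and one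
  in \<open>j\<close> makes the double series factorise.\<close>

lemma nn_integral_suminf_mult_le:
  fixes x z :: "nat \<Rightarrow> 'a \<Rightarrow> ennreal"
  assumes "\<And>i. x i \<in> borel_measurable M" "\<And>i. z i \<in> borel_measurable M"
    and "\<And>i j. (\<integral>\<^sup>+\<omega>. x i \<omega> * z j \<omega> \<partial>M) \<le> s i * \<sigma> j"
  shows "(\<integral>\<^sup>+\<omega>. (\<Sum>i. x i \<omega>) * (\<Sum>j. z j \<omega>) \<partial>M) \<le> (\<Sum>i. s i) * (\<Sum>j. \<sigma> j)"
proof -
  note [measurable] = assms(1,2)
  have "(\<integral>\<^sup>+\<omega>. (\<Sum>i. x i \<omega>) * (\<Sum>j. z j \<omega>) \<partial>M) = (\<integral>\<^sup>+\<omega>. (\<Sum>i. \<Sum>j. x i \<omega> * z j \<omega>) \<partial>M)"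
    by simp
  also have "\<dots> = (\<Sum>i. \<Sum>j. \<integral>\<^sup>+\<omega>. x i \<omega> * z j \<omega> \<partial>M)"
    by (subst nn_integral_suminf, measurable, intro suminf_cong, rule nn_integral_suminf, measurable)
  also have "\<dots> \<le> (\<Sum>i. \<Sum>j. s i * \<sigma> j)"
    by (intro suminf_le summableI assms(3))
  also have "\<dots> = (\<Sum>i. s i) * (\<Sum>j. \<sigma> j)" by simp
  finally show ?thesis .
qed

text \<open>Dominates the number of packets in a first cycle shorter than 1 without mentioning the
  load; meant for short cycles, where the density of the uniform start is large.\<close>

definition early_count :: "(nat \<Rightarrow> nat \<Rightarrow> real) \<Rightarrow> ennreal" where
  "early_count r = (\<Sum>m. of_bool ((\<Sum>j=1..m. r 1 j) \<le> 1))"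

lemma ennreal_sqrt_less_1:
  fixes x :: ennreal
  assumes "x < 1"
  obtains y where "y < 1" "y * y = x"
proof -
  obtain z where z: "x = ennreal z" "0 \<le> z"
    using assms by (cases x) auto
  then have "z < 1" using assms by (simp add: ennreal_less_one_iff)
  then show thesis
    using z that[of "ennreal (sqrt z)"] by (simp add: ennreal_less_one_iff flip: ennreal_mult)
qed

text \<open>The smaller of two numbers is at most their geometric mean. This turns two separate
  bounds into one of product form, ready for summation over pairs.\<close>

lemma le_mult_of_le_squares:
  fixes z s s' :: ennreal
  assumes "z \<le> s * s" "z \<le> s' * s'"
  shows "z \<le> s * s'"
proof (cases "s \<le> s'")
  case True
  then show ?thesis using assms(1) mult_left_mono[OF True, of s] by (auto intro: order_trans)
next
  case False
  then have "s' \<le> s" by simp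
  then show ?thesis using assms(2) mult_right_mono[of s' s s'] by (auto intro: order_trans)
qed

context packet_source
begin

lemma partial_sum_measurable:
  assumes "k \<ge> 1"
  shows "(\<lambda>\<omega>. \<Sum>j=1..m. R k j \<omega>) \<in> borel_measurable M"
  using assms by (intro borel_measurable_sum R_measurable) auto

lemma off_sum_measurable: "(\<lambda>\<omega>. \<Sum>i\<in>{2..<k}. Of i \<omega>) \<in> borel_measurable M"
  by (intro borel_measurable_sum Of_measurable) auto

text \<open>One form for the events in both counts: the early ones take \<open>n = 2\<close>, an
  empty range of OFF-durations, the later ones take \<open>n\<close> equal to the cycle number
  \<open>k\<close>.\<close>

definition close :: "real \<Rightarrow> nat \<Rightarrow> nat \<Rightarrow> nat \<Rightarrow> 'a \<Rightarrow> ennreal" where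
  "close t n k m \<omega> = of_bool ((\<Sum>i\<in>{2..<n}. Of i \<omega>) + (\<Sum>j=1..m. R k j \<omega>) \<le> t)"

lemma close_measurable: "k \<ge> 1 \<Longrightarrow> close t n k m \<in> borel_measurable M"
  using partial_sum_measurable[of k m] off_sum_measurable[of n]
  unfolding close_def[abs_def] of_bool_def by measurable

lemma nn_integral_close_le:
  assumes k: "1 \<le> k"
  shows "(\<integral>\<^sup>+\<omega>. close t n k m \<omega> \<partial>M) \<le> ennreal (exp t) * (off_transform ^ (n - 2) * gap_transform ^ m)"
proof -
  have "close t n k m \<omega> \<le> ennreal (exp t) *
      ((\<Prod>i\<in>{2..<n}. ennreal (exp (- Of i \<omega>))) * (\<Prod>j\<in>{1..m}. ennreal (exp (- R k j \<omega>))))" for \<omega>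
  proof -
    let ?S = "(\<Sum>i\<in>{2..<n}. Of i \<omega>) + (\<Sum>j=1..m. R k j \<omega>)"
    have "of_bool (?S \<le> t) \<le> exp (t - ?S)" by simp
    also have "exp (t - ?S) = exp t * ((\<Prod>i\<in>{2..<n}. exp (- Of i \<omega>)) * (\<Prod>j\<in>{1..m}. exp (- R k j \<omega>)))"
      by (simp add: exp_sum[symmetric] sum_negf mult_exp_exp)
    finally have "ennreal (of_bool (?S \<le> t)) \<le>
        ennreal (exp t * ((\<Prod>i\<in>{2..<n}. exp (- Of i \<omega>)) * (\<Prod>j\<in>{1..m}. exp (- R k j \<omega>))))"
      by (rule ennreal_leI)
    then show ?thesis
      unfolding close_def by (simp add: prod_ennreal ennreal_mult prod_nonneg of_bool_def split: if_splits)
  qed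
  then have "(\<integral>\<^sup>+\<omega>. close t n k m \<omega> \<partial>M) \<le> (\<integral>\<^sup>+\<omega>. ennreal (exp t) *
      ((\<Prod>i\<in>{2..<n}. ennreal (exp (- Of i \<omega>))) * (\<Prod>j\<in>{1..m}. ennreal (exp (- R k j \<omega>)))) \<partial>M)"
    by (rule nn_integral_mono)
  also have "\<dots> = ennreal (exp t) * (off_transform ^ (n - 2) * gap_transform ^ m)"
    using nn_integral_product[of "{2..<n}" "{1..m}" k "\<lambda>_. ennreal (exp t)"] k
    by (simp add: emeasure_space_1 subset_eq)
  finally show ?thesis .
qed

text \<open>The two events may share variables, so their probabilities are not multiplied. The
  intersection lies in each event, and the geometric mean of the two bounds has the square roots
  \<open>a\<close> and \<open>b\<close> of the transforms as ratios; these are below 1 where the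
  bound is applied.\<close>

lemma nn_integral_close_mult_le:
  assumes k: "1 \<le> k" "1 \<le> k'" and ab: "a * a = off_transform" "b * b = gap_transform"
  shows "(\<integral>\<^sup>+\<omega>. close t n k m \<omega> * close t n' k' m' \<omega> \<partial>M) \<le>
    (ennreal (exp (t/2)) * (a ^ (n - 2) * b ^ m)) * (ennreal (exp (t/2)) * (a ^ (n' - 2) * b ^ m'))"
proof -
  have sq: "ennreal (exp t) * (off_transform ^ n * gap_transform ^ m) =
      (ennreal (exp (t/2)) * (a ^ n * b ^ m)) * (ennreal (exp (t/2)) * (a ^ n * b ^ m))" for n m
  proof -
    have "ennreal (exp t) = ennreal (exp (t/2)) * ennreal (exp (t/2))"
      by (simp add: mult_exp_exp flip: ennreal_mult)
    then show ?thesis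
      unfolding ab[symmetric] by (simp add: power_mult_distrib mult_ac)
  qed
  show ?thesis
  proof (rule le_mult_of_le_squares)
    have "(\<integral>\<^sup>+\<omega>. close t n k m \<omega> * close t n' k' m' \<omega> \<partial>M) \<le> (\<integral>\<^sup>+\<omega>. close t n k m \<omega> \<partial>M)"
      by (intro nn_integral_mono) (simp add: close_def)
    then show "(\<integral>\<^sup>+\<omega>. close t n k m \<omega> * close t n' k' m' \<omega> \<partial>M) \<le>
        (ennreal (exp (t/2)) * (a ^ (n - 2) * b ^ m)) * (ennreal (exp (t/2)) * (a ^ (n - 2) * b ^ m))"
      using nn_integral_close_le[OF k(1), of t n m] unfolding sq by (rule order_trans)
    have "(\<integral>\<^sup>+\<omega>. close t n k m \<omega> * close t n' k' m' \<omega> \<partial>M) \<le> (\<integral>\<^sup>+\<omega>. close t n' k' m' \<omega> \<partial>M)"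
      by (intro nn_integral_mono) (simp add: close_def)
    then show "(\<integral>\<^sup>+\<omega>. close t n k m \<omega> * close t n' k' m' \<omega> \<partial>M) \<le>
        (ennreal (exp (t/2)) * (a ^ (n' - 2) * b ^ m')) * (ennreal (exp (t/2)) * (a ^ (n' - 2) * b ^ m'))"
      using nn_integral_close_le[OF k(2), of t n' m'] unfolding sq by (rule order_trans)
  qed
qed

lemma early_count_eq: "early_count (\<lambda>i j. R i j \<omega>) = (\<Sum>m. close 1 2 1 m \<omega>)"
  by (simp add: early_count_def close_def)

lemma later_count_eq:
  "later_count (\<lambda>i. Of i \<omega>) (\<lambda>i j. R i j \<omega>) t = (\<Sum>k. \<Sum>m. close t (k + 2) (k + 2) m \<omega>)"
  by (simp add: later_count_def close_def)

lemma early_count_measurable: "(\<lambda>\<omega>. early_count (\<lambda>i j. R i j \<omega>)) \<in> borel_measurable M"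
  unfolding early_count_eq by (intro borel_measurable_suminf_order close_measurable) simp

lemma later_count_measurable:
  "(\<lambda>\<omega>. later_count (\<lambda>i. Of i \<omega>) (\<lambda>i j. R i j \<omega>) t) \<in> borel_measurable M"
  unfolding later_count_eq by (intro borel_measurable_suminf_order close_measurable) auto

lemma early_count_square_integrable: "(\<integral>\<^sup>+\<omega>. (early_count (\<lambda>i j. R i j \<omega>))\<^sup>2 \<partial>M) < top"
proof -
  obtain a where a: "a < 1" "a * a = off_transform" using ennreal_sqrt_less_1[OF off_transform_less_1] .
  obtain b where b: "b < 1" "b * b = gap_transform" using ennreal_sqrt_less_1[OF gap_transform_less_1] .
  \<comment> \<open>The exponent \<open>2 - 2\<close> is the number of OFF-durations, here none; the
    decay comes from the gaps.\<close>
  let ?s = "\<lambda>m. ennreal (exp (1/2)) * (a ^ (2 - 2) * b ^ m)"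
  have "(\<integral>\<^sup>+\<omega>. (\<Sum>m. close 1 2 1 m \<omega>) * (\<Sum>m. close 1 2 1 m \<omega>) \<partial>M) \<le> (\<Sum>m. ?s m) * (\<Sum>m. ?s m)"
    by (rule nn_integral_suminf_mult_le)
       (use close_measurable[of 1] nn_integral_close_mult_le[of 1 1 a b 1 2 _ 2] a b in auto)
  also have "\<dots> < top"
    using suminf_geometric_ennreal[OF b(1)] by (simp add: ennreal_mult_less_top)
  finally show ?thesis
    by (simp add: early_count_eq power2_eq_square)
qed

lemma later_count_square_integrable:
  "(\<integral>\<^sup>+\<omega>. (later_count (\<lambda>i. Of i \<omega>) (\<lambda>i j. R i j \<omega>) t)\<^sup>2 \<partial>M) < top"
proof -
  obtain a where a: "a < 1" "a * a = off_transform" using ennreal_sqrt_less_1[OF off_transform_less_1] .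
  obtain b where b: "b < 1" "b * b = gap_transform" using ennreal_sqrt_less_1[OF gap_transform_less_1] .
  define s where "s k m = ennreal (exp (t/2)) * (a ^ k * b ^ m)" for k m :: nat
  let ?x = "\<lambda>k \<omega>. \<Sum>m. close t (k + 2) (k + 2) m \<omega>"
  have "(\<integral>\<^sup>+\<omega>. (\<Sum>k. ?x k \<omega>) * (\<Sum>k. ?x k \<omega>) \<partial>M) \<le> (\<Sum>k. \<Sum>m. s k m) * (\<Sum>k. \<Sum>m. s k m)"
  proof (rule nn_integral_suminf_mult_le)
    show "?x k \<in> borel_measurable M" for k
      by (intro borel_measurable_suminf_order close_measurable) simp
    then show "?x k \<in> borel_measurable M" for k .
    show "(\<integral>\<^sup>+\<omega>. ?x k \<omega> * ?x k' \<omega> \<partial>M) \<le> (\<Sum>m. s k m) * (\<Sum>m. s k' m)" for k k'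
    proof (rule nn_integral_suminf_mult_le)
      show "(\<integral>\<^sup>+\<omega>. close t (k + 2) (k + 2) m \<omega> * close t (k' + 2) (k' + 2) m' \<omega> \<partial>M) \<le> s k m * s k' m'" for m m'
        using nn_integral_close_mult_le[of "k + 2" "k' + 2" a b t "k + 2" m "k' + 2" m'] a b by (simp add: s_def)
    qed (auto intro!: close_measurable)
  qed
  also have "\<dots> < top"
  proof -
    have "(\<Sum>k. \<Sum>m. s k m) = ennreal (exp (t/2)) * ((\<Sum>k. a ^ k) * (\<Sum>m. b ^ m))"
      by (simp add: s_def)
    also have "\<dots> < top"
      using suminf_geometric_ennreal[OF a(1)] suminf_geometric_ennreal[OF b(1)] by (simp add: ennreal_mult_less_top)
    finally show ?thesis by (simp add: ennreal_mult_less_top)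
  qed
  finally show ?thesis
    by (simp only: later_count_eq power2_eq_square)
qed

text \<open>What is left of the squared first-cycle count after integration over \<open>u\<close>;
  \<open>min\<close> and \<open>max\<close> treat both orders of a pair of packets at once.\<close>

definition window_bound :: "real \<Rightarrow> 'a \<Rightarrow> ennreal" where
  "window_bound t \<omega> = (\<Sum>i. \<Sum>j. ennreal (t * exp t) *
    (of_bool (max i j \<le> L 1 \<omega>) * (\<Prod>k\<in>{min i j<..max i j}. ennreal (exp (- R 1 k \<omega>)))))"

lemma window_bound_integrable:
  "window_bound t \<in> borel_measurable M" "(\<integral>\<^sup>+\<omega>. window_bound t \<omega> \<partial>M) < top"
proof -
  define tail where "tail i = emeasure M {\<omega> \<in> space M. i \<le> L 1 \<omega>}" for i
  have [measurable]: "L 1 \<in> measurable M (count_space UNIV)" by (rule L_measurable) simp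
  have load: "(\<lambda>\<omega>. of_bool (i \<le> L 1 \<omega>) :: ennreal) \<in> borel_measurable M" for i
    unfolding of_bool_def by measurable
  have gaps: "(\<lambda>\<omega>. ennreal (exp (- R 1 k \<omega>))) \<in> borel_measurable M" if "1 \<le> k" for k
    using R_measurable[of 1 k] that by simp
  have tail: "(\<integral>\<^sup>+\<omega>. of_bool (i \<le> L 1 \<omega>) \<partial>M) = tail i" for i
  proof -
    have "(\<integral>\<^sup>+\<omega>. of_bool (i \<le> L 1 \<omega>) \<partial>M) = (\<integral>\<^sup>+\<omega>. indicator {\<omega> \<in> space M. i \<le> L 1 \<omega>} \<omega> \<partial>M)"
      by (intro nn_integral_cong) (simp add: indicator_def)
    also have "\<dots> = emeasure M {\<omega> \<in> space M. i \<le> L 1 \<omega>}"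
      by (rule nn_integral_indicator) measurable
    finally show ?thesis by (simp add: tail_def)
  qed
  let ?p = "\<lambda>i j \<omega>. ennreal (t * exp t) *
      (of_bool (max i j \<le> L 1 \<omega>) * (\<Prod>k\<in>{min i j<..max i j}. ennreal (exp (- R 1 k \<omega>))))"
  have p_meas: "?p i j \<in> borel_measurable M" for i j
    by (intro borel_measurable_times_ennreal borel_measurable_prod_ennreal load gaps) auto
  have p: "(\<integral>\<^sup>+\<omega>. ?p i j \<omega> \<partial>M) = ennreal (t * exp t) * (tail (max i j) * gap_transform ^ (max i j - min i j))" for i j
  proof -
    have "(\<integral>\<^sup>+\<omega>. of_bool (max i j \<le> L 1 \<omega>) * (\<Prod>k\<in>{min i j<..max i j}. ennreal (exp (- R 1 k \<omega>))) \<partial>M) =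
        tail (max i j) * gap_transform ^ (max i j - min i j)"
      using nn_integral_product[of "{}" "{min i j<..max i j}" 1 "\<lambda>x. of_bool (real (max i j) \<le> x)"]
      by (simp add: tail[symmetric] of_bool_def subset_eq)
    moreover have "(\<lambda>\<omega>. of_bool (max i j \<le> L 1 \<omega>) * (\<Prod>k\<in>{min i j<..max i j}. ennreal (exp (- R 1 k \<omega>))))
        \<in> borel_measurable M"
      by (intro borel_measurable_times_ennreal borel_measurable_prod_ennreal load gaps) auto
    ultimately show ?thesis
      by (simp add: nn_integral_cmult)
  qed
  show "window_bound t \<in> borel_measurable M"
    unfolding window_bound_def[abs_def] by (intro borel_measurable_suminf_order p_meas)
  have "(\<integral>\<^sup>+\<omega>. window_bound t \<omega> \<partial>M) = (\<integral>\<^sup>+\<omega>. (\<Sum>i. \<Sum>j. ?p i j \<omega>) \<partial>M)"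
    by (simp only: window_bound_def)
  also have "\<dots> = (\<Sum>i. \<Sum>j. \<integral>\<^sup>+\<omega>. ?p i j \<omega> \<partial>M)"
    by (subst nn_integral_suminf, intro borel_measurable_suminf_order p_meas,
        intro suminf_cong, rule nn_integral_suminf, rule p_meas)
  \<comment> \<open>With \<open>tail i\<close> in place of \<open>tail (max i j)\<close>, the sum
    over \<open>j\<close> no longer involves the load and is geometric in the distance to
    \<open>i\<close>. The sum over \<open>i\<close> is then the finite one of
    \<open>L_mean\<close>.\<close>
  also have "\<dots> \<le> (\<Sum>i. \<Sum>j. ennreal (t * exp t) * (tail i * gap_transform ^ (max i j - min i j)))"
  proof (intro suminf_le summableI)
    fix i j
    have "tail (max i j) \<le> tail i"
      unfolding tail_def by (intro emeasure_mono; (measurable)?) auto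
    then show "(\<integral>\<^sup>+\<omega>. ?p i j \<omega> \<partial>M) \<le> ennreal (t * exp t) * (tail i * gap_transform ^ (max i j - min i j))"
      unfolding p by (intro mult_left_mono mult_right_mono) auto
  qed
  also have "\<dots> \<le> (\<Sum>i. ennreal (t * exp t) * (tail i * (2 * (\<Sum>n. gap_transform ^ n))))"
    using suminf_geometric_distance_le[of gap_transform]
    by (intro suminf_le summableI) (auto intro!: mult_left_mono)
  also have "\<dots> = ennreal (t * exp t) * ((\<Sum>i. tail i) * (2 * (\<Sum>n. gap_transform ^ n)))"
    by simp
  also have "\<dots> < top"
    using L_mean suminf_geometric_ennreal[OF gap_transform_less_1]
    by (simp add: ennreal_mult_less_top tail_def)
  finally show "(\<integral>\<^sup>+\<omega>. window_bound t \<omega> \<partial>M) < top" .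
qed

end

section \<open>Measurability of the packet train\<close>

text \<open>
  A value attained several times is counted at its least index, which makes the cardinality of
  the range a series of measurable terms.
\<close>

lemma emeasure_count_space_range:
  fixes p :: "nat \<Rightarrow> 'b"
  shows "emeasure (count_space UNIV) {p n | n. V n} =
    (\<Sum>n. of_bool (V n \<and> (\<forall>n'<n. V n' \<longrightarrow> p n' \<noteq> p n)))"
proof -
  define A where "A n = (if V n \<and> (\<forall>n'<n. V n' \<longrightarrow> p n' \<noteq> p n) then {p n} else {})" for n
  have less: "A i \<inter> A j = {}" if "i < j" for i j
    using that by (auto simp: A_def)
  have "disjoint_family A"
    unfolding disjoint_family_on_def
  proof (intro ballI impI)
    fix i j :: nat assume "i \<noteq> j"
    then have "i < j \<or> j < i" by linarith
    then show "A i \<inter> A j = {}"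
      using less[of i j] less[of j i] by (metis Int_commute)
  qed
  then have "emeasure (count_space UNIV) (\<Union>n. A n) = (\<Sum>n. emeasure (count_space UNIV) (A n))"
    by (intro suminf_emeasure[symmetric]) auto
  moreover have "(\<Union>n. A n) = {p n | n. V n}"
  proof (intro equalityI subsetI)
    fix x assume "x \<in> (\<Union>n. A n)"
    then obtain n where "x \<in> A n" by blast
    then have "x = p n" "V n" by (auto simp: A_def split: if_splits)
    then show "x \<in> {p n | n. V n}" by blast
  next
    fix x assume "x \<in> {p n | n. V n}"
    then obtain n where n: "x = p n" "V n" by blast
    then obtain m where m: "V m \<and> p m = p n" and least: "\<forall>k<m. \<not> (V k \<and> p k = p n)"
      using exists_least_iff[of "\<lambda>m. V m \<and> p m = p n"] by blast
    then have "V m \<and> (\<forall>k<m. V k \<longrightarrow> p k \<noteq> p m)" by simp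
    then have "A m = {p m}" unfolding A_def by (rule if_P)
    then have "x \<in> A m" using n m by simp
    then show "x \<in> (\<Union>n. A n)" by (rule UN_I[OF UNIV_I])
  qed
  moreover have "emeasure (count_space UNIV) (A n) = of_bool (V n \<and> (\<forall>n'<n. V n' \<longrightarrow> p n' \<noteq> p n))" for n
  proof (cases "V n \<and> (\<forall>n'<n. V n' \<longrightarrow> p n' \<noteq> p n)")
    case True
    then have "A n = {p n}" unfolding A_def by (rule if_P)
    then show ?thesis using True by (simp only: of_bool_eq) simp
  next
    case False
    then have "A n = {}" unfolding A_def by (rule if_not_P)
    then show ?thesis using False by (simp only: of_bool_eq) simp
  qed
  ultimately show ?thesis by (simp only:)
qed

lemma delta_integral_measurable:
  assumes "0 \<le> a" "a \<le> b"
  shows "delta_integral a b \<in> borel_measurable delta_trains"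
proof (rule measurableI)
  fix B :: "real set" assume "B \<in> sets borel"
  then show "delta_integral a b -` B \<inter> space delta_trains \<in> sets delta_trains"
    using assms unfolding delta_trains_def by (auto intro!: in_measure_of)
qed simp

context packet_source
begin

abbreviation (input) train :: "'a \<Rightarrow> real set" where
  "train \<omega> \<equiv> emission_times (\<lambda>i. Of i \<omega>) (\<lambda>i. L i \<omega>) (\<lambda>i j. R i j \<omega>)"

lemma on_time_measurable:
  assumes "1 \<le> i"
  shows "(\<lambda>\<omega>. on_time (\<lambda>i. L i \<omega>) (\<lambda>i j. R i j \<omega>) i) \<in> borel_measurable M"
  unfolding on_time_def
  by (rule measurable_compose_countable[OF partial_sum_measurable[OF assms] L_measurable[OF assms]])

lemma first_cycle_measurable: "first_cycle Of L R \<in> borel_measurable M"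
  using Of_measurable[of 1] on_time_measurable[of 1] unfolding first_cycle_def[abs_def] by simp

lemma emission_measurable:
  assumes k: "1 \<le> k"
  shows "(\<lambda>\<omega>. emission (\<lambda>i. Of i \<omega>) (\<lambda>i. L i \<omega>) (\<lambda>i j. R i j \<omega>) k m) \<in> borel_measurable M"
  unfolding emission_def using k
  by (intro borel_measurable_add borel_measurable_sum Of_measurable on_time_measurable partial_sum_measurable) auto

lemma train_measurable: "(\<lambda>(\<omega>, u). shift_train u (train \<omega>)) \<in> measurable (M \<Otimes>\<^sub>M lborel) delta_trains"
proof -
  have "(\<lambda>z. delta_integral a b (shift_train (snd z) (train (fst z)))) \<in> borel_measurable (M \<Otimes>\<^sub>M lborel)" for a b
  proof -
    \<comment> \<open>\<open>prod_decode\<close> lists all pairs of a cycle and a packet number;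
      \<open>Suc\<close> appears because cycles are numbered from 1, packets from 0.\<close>
    define p where "p n z = emission (\<lambda>i. Of i (fst z)) (\<lambda>i. L i (fst z)) (\<lambda>i j. R i j (fst z))
        (Suc (fst (prod_decode n))) (snd (prod_decode n)) - snd z" for n and z :: "'a \<times> real"
    define V where "V n z \<longleftrightarrow> snd (prod_decode n) \<le> L (Suc (fst (prod_decode n))) (fst z) \<and> a < p n z \<and> p n z \<le> b"
      for n and z :: "'a \<times> real"
    have [measurable]: "p n \<in> borel_measurable (M \<Otimes>\<^sub>M lborel)" for n
      using measurable_compose[OF measurable_fst emission_measurable[of "Suc (fst (prod_decode n))" "snd (prod_decode n)"]]
      unfolding p_def[abs_def] by measurable
    have [measurable]: "(\<lambda>z. L (Suc k) (fst z)) \<in> measurable (M \<Otimes>\<^sub>M lborel) (count_space UNIV)" for k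
      using measurable_compose[OF measurable_fst L_measurable[of "Suc k"]] by simp
    have [measurable]: "Measurable.pred (M \<Otimes>\<^sub>M lborel) (V n)" for n
      unfolding V_def[abs_def] by measurable
    have "shift_train (snd z) (train (fst z)) \<inter> {a<..b} = {p n z | n. V n z}" for z
    proof (intro set_eqI iffI)
      fix x assume "x \<in> shift_train (snd z) (train (fst z)) \<inter> {a<..b}"
      then obtain k m where km: "1 \<le> k" "m \<le> L k (fst z)" and x: "a < x" "x \<le> b"
          "snd z + x = emission (\<lambda>i. Of i (fst z)) (\<lambda>i. L i (fst z)) (\<lambda>i j. R i j (fst z)) k m"
        by (auto simp: shift_train_def emission_times_eq)
      let ?n = "prod_encode (k - 1, m)"
      have "p ?n z = x" using km(1) x(3) by (simp add: p_def)
      moreover from this have "V ?n z" using km x by (simp add: V_def)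
      ultimately show "x \<in> {p n z | n. V n z}" by blast
    next
      fix x assume "x \<in> {p n z | n. V n z}"
      then obtain n where n: "x = p n z" "V n z" by blast
      have "snd z + x \<in> train (fst z)"
        using n unfolding emission_times_eq V_def p_def
        by (intro CollectI exI[of _ "Suc (fst (prod_decode n))"] exI[of _ "snd (prod_decode n)"]) auto
      then show "x \<in> shift_train (snd z) (train (fst z)) \<inter> {a<..b}"
        using n by (simp add: shift_train_def V_def)
    qed
    then have eq: "delta_integral a b (shift_train (snd z) (train (fst z))) =
        enn2real (\<Sum>n. of_bool (V n z \<and> (\<forall>n'<n. V n' z \<longrightarrow> p n' z \<noteq> p n z)))" for z
      by (simp add: delta_integral_eq emeasure_count_space_range)
    have m: "Measurable.pred (M \<Otimes>\<^sub>M lborel) (\<lambda>z. V n z \<and> (\<forall>n'<n. V n' z \<longrightarrow> p n' z \<noteq> p n z))" for n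
      by measurable
    have "(\<lambda>z. enn2real (\<Sum>n. of_bool (V n z \<and> (\<forall>n'<n. V n' z \<longrightarrow> p n' z \<noteq> p n z))))
        \<in> borel_measurable (M \<Otimes>\<^sub>M lborel)"
      unfolding of_bool_def
      by (intro borel_measurable_enn2real borel_measurable_suminf_order measurable_If borel_measurable_const predE m)
    then show ?thesis
      unfolding eq .
  qed
  note count = this
  show ?thesis
    unfolding delta_trains_def
  proof (rule measurable_measure_of)
    show "{delta_integral a b -` B |a b B. 0 \<le> a \<and> a \<le> b \<and> B \<in> sets borel} \<subseteq> Pow UNIV"
      unfolding Pow_UNIV by (rule subset_UNIV)
    show "(\<lambda>(\<omega>, u). shift_train u (train \<omega>)) \<in> space (M \<Otimes>\<^sub>M lborel) \<rightarrow> UNIV"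
      by (rule Pi_I) (rule UNIV_I)
    fix A assume "A \<in> {delta_integral a b -` B |a b B. 0 \<le> a \<and> a \<le> b \<and> B \<in> sets borel}"
    then show "(\<lambda>(\<omega>, u). shift_train u (train \<omega>)) -` A \<inter> space (M \<Otimes>\<^sub>M lborel) \<in> sets (M \<Otimes>\<^sub>M lborel)"
    proof safe
      fix a b :: real and B :: "real set" assume B: "B \<in> sets borel"
      have "(\<lambda>(\<omega>, u). shift_train u (train \<omega>)) -` (delta_integral a b -` B) \<inter> space (M \<Otimes>\<^sub>M lborel) =
          (\<lambda>z. delta_integral a b (shift_train (snd z) (train (fst z)))) -` B \<inter> space (M \<Otimes>\<^sub>M lborel)"
        by (auto simp: case_prod_beta)
      then show "(\<lambda>(\<omega>, u). shift_train u (train \<omega>)) -` (delta_integral a b -` B) \<inter> space (M \<Otimes>\<^sub>M lborel)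
          \<in> sets (M \<Otimes>\<^sub>M lborel)"
        using measurable_sets[OF count B] by (simp only:)
    qed
  qed
qed

lemma shifted_count_measurable:
  assumes "0 \<le> t"
  shows "(\<lambda>(\<omega>, u). ennreal ((delta_integral 0 t (shift_train u (train \<omega>)))\<^sup>2)) \<in> borel_measurable (M \<Otimes>\<^sub>M lborel)"
proof -
  have "(\<lambda>z. delta_integral 0 t (case z of (\<omega>, u) \<Rightarrow> shift_train u (train \<omega>))) \<in> borel_measurable (M \<Otimes>\<^sub>M lborel)"
    by (rule measurable_compose[OF train_measurable delta_integral_measurable[OF order_refl assms]])
  then have "(\<lambda>z. ennreal ((delta_integral 0 t (case z of (\<omega>, u) \<Rightarrow> shift_train u (train \<omega>)))\<^sup>2))
      \<in> borel_measurable (M \<Otimes>\<^sub>M lborel)"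
    by (intro measurable_compose[OF _ measurable_ennreal] borel_measurable_power)
  then show ?thesis
    by (simp only: case_prod_beta')
qed

end

section \<open>The second moment under the starting laws\<close>

text \<open>In a cycle of length below 1, every gap sum up to the load is below 1 as well.\<close>

lemma suminf_in_window_le_early_count:
  assumes f: "0 \<le> f 1" and r: "\<And>j. 1 \<le> j \<Longrightarrow> 0 \<le> r 1 j" and Y: "f 1 + on_time l r 1 < 1"
  shows "(\<Sum>m. in_window f l r t m u) \<le> early_count r"
  unfolding early_count_def
proof (intro suminf_le summableI)
  fix m
  show "in_window f l r t m u \<le> of_bool ((\<Sum>j=1..m. r 1 j) \<le> 1)"
  proof (cases "m \<le> l 1")
    case True
    then have "(\<Sum>j=1..m. r 1 j) \<le> on_time l r 1"
      unfolding on_time_def using r by (intro sum_mono2) auto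
    then show ?thesis using f Y by (simp add: in_window_def)
  qed (simp add: in_window_def)
qed

lemma ennreal_count_sq_le:
  assumes f: "\<And>i. 1 \<le> i \<Longrightarrow> 0 \<le> f i" and r: "\<And>i j. 1 \<le> i \<Longrightarrow> 1 \<le> j \<Longrightarrow> 0 \<le> r i j"
    and u: "u \<le> f 1 + on_time l r 1"
  shows "ennreal ((delta_integral 0 t (shift_train u (emission_times f l r)))\<^sup>2) \<le>
    2 * (\<Sum>m. in_window f l r t m u)\<^sup>2 + 2 * (of_bool (f 1 + on_time l r 1 - t \<le> u) * (later_count f r t)\<^sup>2)"
proof -
  let ?D = "delta_integral 0 t (shift_train u (emission_times f l r))"
  have le: "ennreal ?D \<le> (\<Sum>m. in_window f l r t m u) + of_bool (f 1 + on_time l r 1 - t \<le> u) * later_count f r t"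
    by (rule order_trans[OF ennreal_delta_integral_le]) (rule count_split; use f r u in simp)
  have "ennreal (?D\<^sup>2) = (ennreal ?D)\<^sup>2"
    by (simp add: ennreal_power delta_integral_def)
  also have "\<dots> \<le> ((\<Sum>m. in_window f l r t m u) + of_bool (f 1 + on_time l r 1 - t \<le> u) * later_count f r t)\<^sup>2"
    unfolding power2_eq_square
    by (intro mult_mono le) auto
  also have "\<dots> \<le> 2 * (\<Sum>m. in_window f l r t m u)\<^sup>2 +
      2 * (of_bool (f 1 + on_time l r 1 - t \<le> u) * later_count f r t)\<^sup>2"
    by (rule ennreal_power2_add_le)
  finally show ?thesis
    by (cases "f 1 + on_time l r 1 - t \<le> u") simp_all
qed

text \<open>Later packets are visible only from the last stretch, of length \<open>t\<close>, of the
  first cycle. Hence the factor \<open>t\<close> where a crude bound would have the cycle length,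
  whose product with the square of \<open>later_count\<close> would need a separate
  estimate.\<close>

lemma nn_integral_length_biased_le:
  assumes f: "\<And>i. 1 \<le> i \<Longrightarrow> 0 \<le> f i" and r: "\<And>i j. 1 \<le> i \<Longrightarrow> 1 \<le> j \<Longrightarrow> 0 \<le> r i j" and t: "0 \<le> t"
  shows "(\<integral>\<^sup>+u. indicator {0..f 1 + on_time l r 1} u *
      ennreal ((delta_integral 0 t (shift_train u (emission_times f l r)))\<^sup>2) \<partial>lborel) \<le>
    2 * (\<integral>\<^sup>+u. (\<Sum>m. in_window f l r t m u)\<^sup>2 \<partial>lborel) + 2 * (ennreal t * (later_count f r t)\<^sup>2)"
proof -
  let ?Y = "f 1 + on_time l r 1" and ?N = "(later_count f r t)\<^sup>2"
  have [measurable]: "(\<lambda>u. (\<Sum>m. in_window f l r t m u)\<^sup>2) \<in> borel_measurable lborel" by measurable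
  have "indicator {0..?Y} u * ennreal ((delta_integral 0 t (shift_train u (emission_times f l r)))\<^sup>2) \<le>
      2 * (\<Sum>m. in_window f l r t m u)\<^sup>2 + 2 * (?N * indicator {?Y - t..?Y} u)" for u
  proof (cases "u \<in> {0..?Y}")
    case True
    then have "of_bool (?Y - t \<le> u) * ?N \<le> ?N * indicator {?Y - t..?Y} u"
      by (simp add: indicator_def)
    then have "2 * (of_bool (?Y - t \<le> u) * ?N) \<le> 2 * (?N * indicator {?Y - t..?Y} u)"
      by (rule mult_left_mono) simp
    moreover have "ennreal ((delta_integral 0 t (shift_train u (emission_times f l r)))\<^sup>2) \<le>
        2 * (\<Sum>m. in_window f l r t m u)\<^sup>2 + 2 * (of_bool (?Y - t \<le> u) * ?N)"
      by (rule ennreal_count_sq_le) (use f r True in auto)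
    ultimately have "ennreal ((delta_integral 0 t (shift_train u (emission_times f l r)))\<^sup>2) \<le>
        2 * (\<Sum>m. in_window f l r t m u)\<^sup>2 + 2 * (?N * indicator {?Y - t..?Y} u)"
      by (meson add_left_mono order_trans)
    then show ?thesis
      using True by simp
  qed simp
  then have "(\<integral>\<^sup>+u. indicator {0..?Y} u *
      ennreal ((delta_integral 0 t (shift_train u (emission_times f l r)))\<^sup>2) \<partial>lborel) \<le>
      (\<integral>\<^sup>+u. 2 * (\<Sum>m. in_window f l r t m u)\<^sup>2 + 2 * (?N * indicator {?Y - t..?Y} u) \<partial>lborel)"
    by (rule nn_integral_mono)
  also have "\<dots> = 2 * (\<integral>\<^sup>+u. (\<Sum>m. in_window f l r t m u)\<^sup>2 \<partial>lborel) + 2 * (?N * ennreal t)"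
    using t by (simp add: nn_integral_add nn_integral_cmult)
  finally show ?thesis by (simp add: mult_ac)
qed

text \<open>For a cycle of length at least 1 the weight is at most 1 on the first-cycle term, and
  averaging over \<open>u\<close> leaves the later term bounded by its value. For a shorter cycle
  the first-cycle count is bounded uniformly in \<open>u\<close> by \<open>early_count\<close>, so
  the average again stays bounded although the weight is large.\<close>

lemma nn_integral_uniform_le:
  assumes f: "\<And>i. 1 \<le> i \<Longrightarrow> 0 \<le> f i" and r: "\<And>i j. 1 \<le> i \<Longrightarrow> 1 \<le> j \<Longrightarrow> 0 \<le> r i j"
    and Y: "0 < f 1 + on_time l r 1"
  shows "(\<integral>\<^sup>+u. indicator {0..f 1 + on_time l r 1} u / ennreal (f 1 + on_time l r 1) *
      ennreal ((delta_integral 0 t (shift_train u (emission_times f l r)))\<^sup>2) \<partial>lborel) \<le>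
    2 * (\<integral>\<^sup>+u. (\<Sum>m. in_window f l r t m u)\<^sup>2 \<partial>lborel) + (2 * (early_count r)\<^sup>2 + 2 * (later_count f r t)\<^sup>2)"
proof -
  let ?Y = "f 1 + on_time l r 1" and ?K = "2 * (early_count r)\<^sup>2 + 2 * (later_count f r t)\<^sup>2"
  let ?A = "\<lambda>u. (\<Sum>m. in_window f l r t m u)\<^sup>2"
  have [measurable]: "?A \<in> borel_measurable lborel" by measurable
  have "indicator {0..?Y} u / ennreal ?Y * ennreal ((delta_integral 0 t (shift_train u (emission_times f l r)))\<^sup>2) \<le>
      2 * ?A u + ?K * (1 / ennreal ?Y) * indicator {0..?Y} u" for u
  proof (cases "u \<in> {0..?Y}")
    case True
    let ?D = "ennreal ((delta_integral 0 t (shift_train u (emission_times f l r)))\<^sup>2)"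
    have "of_bool (?Y - t \<le> u) * (later_count f r t)\<^sup>2 \<le> (later_count f r t)\<^sup>2" by simp
    then have "2 * (of_bool (?Y - t \<le> u) * (later_count f r t)\<^sup>2) \<le> 2 * (later_count f r t)\<^sup>2"
      by (rule mult_left_mono) simp
    moreover have "?D \<le> 2 * ?A u + 2 * (of_bool (?Y - t \<le> u) * (later_count f r t)\<^sup>2)"
      by (rule ennreal_count_sq_le) (use f r True in auto)
    ultimately have D: "?D \<le> 2 * ?A u + 2 * (later_count f r t)\<^sup>2"
      by (meson add_left_mono order_trans)
    have "1 / ennreal ?Y * ?D \<le> 2 * ?A u + ?K * (1 / ennreal ?Y)"
    proof (cases "?Y < 1")
      case True
      have "(\<Sum>m. in_window f l r t m u) \<le> early_count r"
        using f[of 1] r[of 1] True by (intro suminf_in_window_le_early_count) auto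
      then have "?A u \<le> (early_count r)\<^sup>2"
        unfolding power2_eq_square by (intro mult_mono) auto
      then have "?D \<le> ?K"
        using D by (meson add_right_mono mult_left_mono order_trans zero_le)
      then have "?D * (1 / ennreal ?Y) \<le> ?K * (1 / ennreal ?Y)"
        by (rule mult_right_mono) simp
      then show ?thesis
        by (simp add: mult.commute add_increasing)
    next
      case False
      then have "1 / ennreal ?Y \<le> 1"
        by (simp add: divide_ennreal ennreal_1[symmetric] del: ennreal_1)
      then have "1 / ennreal ?Y * (2 * ?A u) \<le> 1 * (2 * ?A u)"
        by (rule mult_right_mono) simp
      moreover have "2 * (later_count f r t)\<^sup>2 \<le> ?K"
        by (simp add: add_increasing)
      then have "1 / ennreal ?Y * (2 * (later_count f r t)\<^sup>2) \<le> 1 / ennreal ?Y * ?K"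
        by (rule mult_left_mono) simp
      ultimately have "1 / ennreal ?Y * (2 * ?A u + 2 * (later_count f r t)\<^sup>2) \<le> 2 * ?A u + ?K * (1 / ennreal ?Y)"
        by (simp only: distrib_left[of "1 / ennreal ?Y" "2 * ?A u"] mult_1 mult.commute[of ?K] add_mono)
      with mult_left_mono[OF D, of "1 / ennreal ?Y"] show ?thesis
        by (meson order_trans zero_le)
    qed
    then show ?thesis
      using True by simp
  qed simp
  then have "(\<integral>\<^sup>+u. indicator {0..?Y} u / ennreal ?Y *
      ennreal ((delta_integral 0 t (shift_train u (emission_times f l r)))\<^sup>2) \<partial>lborel) \<le>
      (\<integral>\<^sup>+u. 2 * ?A u + ?K * (1 / ennreal ?Y) * indicator {0..?Y} u \<partial>lborel)"
    by (rule nn_integral_mono)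
  also have "\<dots> = 2 * (\<integral>\<^sup>+u. ?A u \<partial>lborel) + ?K * (1 / ennreal ?Y) * ennreal ?Y"
    using Y by (subst nn_integral_add; (measurable)?) (simp add: nn_integral_cmult nn_integral_cmult_indicator)
  also have "?K * (1 / ennreal ?Y) * ennreal ?Y = ?K"
  proof -
    have "1 / ennreal ?Y = ennreal (1 / ?Y)"
      using Y by (metis divide_ennreal ennreal_1 zero_le_one)
    then have "1 / ennreal ?Y * ennreal ?Y = 1"
      using Y by (simp flip: ennreal_mult)
    then show ?thesis by (simp only: mult.assoc mult_1_right)
  qed
  finally show ?thesis .
qed

section \<open>Averaging the pathwise bounds over the sample point\<close>

context packet_source
begin

lemma first_cycle_eq:
  "first_cycle Of L R \<omega> = Of 1 \<omega> + on_time (\<lambda>i. L i \<omega>) (\<lambda>i j. R i j \<omega>) 1"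
  by (simp add: first_cycle_def)

lemma uniform_start_second_moment:
  assumes t: "0 \<le> t"
  shows "(\<integral>\<^sup>+z. (case z of (\<omega>, u) \<Rightarrow> ennreal ((delta_integral 0 t (shift_train u (train \<omega>)))\<^sup>2))
    \<partial>uniform_start M (first_cycle Of L R)) < top"
proof -
  let ?Y = "first_cycle Of L R"
  let ?D = "\<lambda>\<omega> u. ennreal ((delta_integral 0 t (shift_train u (train \<omega>)))\<^sup>2)"
  let ?B = "\<lambda>\<omega>. 2 * window_bound t \<omega> + (2 * (early_count (\<lambda>i j. R i j \<omega>))\<^sup>2 +
    2 * (later_count (\<lambda>i. Of i \<omega>) (\<lambda>i j. R i j \<omega>) t)\<^sup>2)"
  note [measurable] = first_cycle_measurable window_bound_integrable(1) early_count_measurable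
    later_count_measurable shifted_count_measurable[OF t]
  have dens: "(\<lambda>(\<omega>, u). indicator {0..?Y \<omega>} u / ennreal (?Y \<omega>)) \<in> borel_measurable (M \<Otimes>\<^sub>M lborel)"
    unfolding indicator_def atLeastAtMost_iff by measurable
  have "(\<integral>\<^sup>+z. (case z of (\<omega>, u) \<Rightarrow> ?D \<omega> u) \<partial>uniform_start M ?Y) =
      (\<integral>\<^sup>+z. (case z of (\<omega>, u) \<Rightarrow> indicator {0..?Y \<omega>} u / ennreal (?Y \<omega>)) * (case z of (\<omega>, u) \<Rightarrow> ?D \<omega> u) \<partial>(M \<Otimes>\<^sub>M lborel))"
    unfolding uniform_start_def by (rule nn_integral_density[OF dens shifted_count_measurable[OF t]])
  also have "\<dots> = (\<integral>\<^sup>+\<omega>. (\<integral>\<^sup>+u. indicator {0..?Y \<omega>} u / ennreal (?Y \<omega>) * ?D \<omega> u \<partial>lborel) \<partial>M)"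
    using lborel.nn_integral_fst[OF borel_measurable_times_ennreal[OF dens shifted_count_measurable[OF t]]]
    by (simp only: prod.case)
  also have "\<dots> \<le> (\<integral>\<^sup>+\<omega>. ?B \<omega> \<partial>M)"
  proof (rule nn_integral_mono_AE)
    show "AE \<omega> in M. (\<integral>\<^sup>+u. indicator {0..?Y \<omega>} u / ennreal (?Y \<omega>) * ?D \<omega> u \<partial>lborel) \<le> ?B \<omega>"
      using AE_positive
    proof eventually_elim
      case (elim \<omega>)
      then have f: "0 \<le> Of i \<omega>" if "1 \<le> i" for i using that by (simp add: less_imp_le)
      have r: "0 \<le> R i j \<omega>" if "1 \<le> i" "1 \<le> j" for i j using that elim by simp
      have "0 \<le> on_time (\<lambda>i. L i \<omega>) (\<lambda>i j. R i j \<omega>) 1"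
        unfolding on_time_def using r by (intro sum_nonneg) auto
      then have Y: "0 < Of 1 \<omega> + on_time (\<lambda>i. L i \<omega>) (\<lambda>i j. R i j \<omega>) 1"
        using elim by (simp add: add_pos_nonneg)
      show ?case
        unfolding first_cycle_eq window_bound_def
        by (rule order_trans[OF nn_integral_uniform_le[where f="\<lambda>i. Of i \<omega>" and r="\<lambda>i j. R i j \<omega>", OF f r Y]
          add_right_mono[OF mult_left_mono[OF nn_integral_in_window_sq[OF t] zero_le]]])
    qed
  qed
  also have "\<dots> = 2 * (\<integral>\<^sup>+\<omega>. window_bound t \<omega> \<partial>M) + (2 * (\<integral>\<^sup>+\<omega>. (early_count (\<lambda>i j. R i j \<omega>))\<^sup>2 \<partial>M) +
      2 * (\<integral>\<^sup>+\<omega>. (later_count (\<lambda>i. Of i \<omega>) (\<lambda>i j. R i j \<omega>) t)\<^sup>2 \<partial>M))"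
    by (simp add: nn_integral_add nn_integral_cmult)
  also have "\<dots> < top"
    using window_bound_integrable(2) early_count_square_integrable later_count_square_integrable
    by (simp add: ennreal_mult_less_top)
  finally show ?thesis .
qed

lemma length_biased_start_second_moment:
  assumes t: "0 \<le> t" and Y: "ennreal (integral\<^sup>L M (first_cycle Of L R)) \<noteq> 0"
  shows "(\<integral>\<^sup>+z. (case z of (\<omega>, u) \<Rightarrow> ennreal ((delta_integral 0 t (shift_train u (train \<omega>)))\<^sup>2))
    \<partial>length_biased_start M (first_cycle Of L R)) < top"
proof -
  let ?Y = "first_cycle Of L R"
  let ?c = "1 / ennreal (integral\<^sup>L M ?Y)"
  let ?D = "\<lambda>\<omega> u. ennreal ((delta_integral 0 t (shift_train u (train \<omega>)))\<^sup>2)"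
  let ?B = "\<lambda>\<omega>. 2 * window_bound t \<omega> +
    2 * (ennreal t * (later_count (\<lambda>i. Of i \<omega>) (\<lambda>i j. R i j \<omega>) t)\<^sup>2)"
  note [measurable] = first_cycle_measurable window_bound_integrable(1)
    later_count_measurable shifted_count_measurable[OF t]
  have ind [measurable]: "(\<lambda>(\<omega>, u). indicator {0..?Y \<omega>} u :: ennreal) \<in> borel_measurable (M \<Otimes>\<^sub>M lborel)"
    unfolding indicator_def atLeastAtMost_iff by measurable
  have dens: "(\<lambda>(\<omega>, u). indicator {0..?Y \<omega>} u / ennreal (integral\<^sup>L M ?Y)) = (\<lambda>z. ?c * (case z of (\<omega>, u) \<Rightarrow> indicator {0..?Y \<omega>} u))"
    by (auto simp: fun_eq_iff indicator_def)
  have "(\<integral>\<^sup>+z. (case z of (\<omega>, u) \<Rightarrow> ?D \<omega> u) \<partial>length_biased_start M ?Y) =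
      (\<integral>\<^sup>+z. (?c * (case z of (\<omega>, u) \<Rightarrow> indicator {0..?Y \<omega>} u)) * (case z of (\<omega>, u) \<Rightarrow> ?D \<omega> u) \<partial>(M \<Otimes>\<^sub>M lborel))"
    unfolding length_biased_start_def dens
    by (rule nn_integral_density[OF borel_measurable_times_ennreal[OF borel_measurable_const ind] shifted_count_measurable[OF t]])
  also have "\<dots> = ?c * (\<integral>\<^sup>+z. (case z of (\<omega>, u) \<Rightarrow> indicator {0..?Y \<omega>} u) * (case z of (\<omega>, u) \<Rightarrow> ?D \<omega> u) \<partial>(M \<Otimes>\<^sub>M lborel))"
    unfolding mult.assoc
    by (rule nn_integral_cmult[OF borel_measurable_times_ennreal[OF ind shifted_count_measurable[OF t]]])
  also have "(\<integral>\<^sup>+z. (case z of (\<omega>, u) \<Rightarrow> indicator {0..?Y \<omega>} u) * (case z of (\<omega>, u) \<Rightarrow> ?D \<omega> u) \<partial>(M \<Otimes>\<^sub>M lborel)) =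
      (\<integral>\<^sup>+\<omega>. (\<integral>\<^sup>+u. indicator {0..?Y \<omega>} u * ?D \<omega> u \<partial>lborel) \<partial>M)"
    using lborel.nn_integral_fst[OF borel_measurable_times_ennreal[OF ind shifted_count_measurable[OF t]]]
    by (simp only: prod.case)
  also have "?c * \<dots> \<le> ?c * (\<integral>\<^sup>+\<omega>. ?B \<omega> \<partial>M)"
  proof (intro mult_left_mono nn_integral_mono_AE)
    show "AE \<omega> in M. (\<integral>\<^sup>+u. indicator {0..?Y \<omega>} u * ?D \<omega> u \<partial>lborel) \<le> ?B \<omega>"
      using AE_positive
    proof eventually_elim
      case (elim \<omega>)
      then have f: "0 \<le> Of i \<omega>" if "1 \<le> i" for i using that by (simp add: less_imp_le)
      have r: "0 \<le> R i j \<omega>" if "1 \<le> i" "1 \<le> j" for i j using that elim by simp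
      show ?case
        unfolding first_cycle_eq window_bound_def
        by (rule order_trans[OF nn_integral_length_biased_le[where f="\<lambda>i. Of i \<omega>" and r="\<lambda>i j. R i j \<omega>", OF f r t]
          add_right_mono[OF mult_left_mono[OF nn_integral_in_window_sq[OF t] zero_le]]])
    qed
  qed simp
  also have "(\<integral>\<^sup>+\<omega>. ?B \<omega> \<partial>M) = 2 * (\<integral>\<^sup>+\<omega>. window_bound t \<omega> \<partial>M) +
      2 * (ennreal t * (\<integral>\<^sup>+\<omega>. (later_count (\<lambda>i. Of i \<omega>) (\<lambda>i j. R i j \<omega>) t)\<^sup>2 \<partial>M))"
    by (simp add: nn_integral_add nn_integral_cmult)
  also have "?c * \<dots> < top"
  proof -
    have "?c < top"
      using Y by (simp add: less_top[symmetric] ennreal_divide_eq_top_iff)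
    then show ?thesis
      using window_bound_integrable(2) later_count_square_integrable by (simp add: ennreal_mult_less_top)
  qed
  finally show ?thesis .
qed

text \<open>
  If the mean cycle length were 0 or infinite (so that its Bochner integral is 0), the density of the
  length-biased law would only take the values 0 and \<open>top\<close>. Thus no bound on the mean cycle length
  is needed once the law is known to have mass 1.
\<close>

lemma length_biased_start_normalizer:
  assumes "emeasure (length_biased_start M (first_cycle Of L R)) (space (M \<Otimes>\<^sub>M lborel)) = 1"
  shows "ennreal (integral\<^sup>L M (first_cycle Of L R)) \<noteq> 0"
proof
  let ?Y = "first_cycle Of L R"
  assume Y: "ennreal (integral\<^sup>L M ?Y) = 0"
  note [measurable] = first_cycle_measurable
  have ind: "(\<lambda>(\<omega>, u). indicator {0..?Y \<omega>} u :: ennreal) \<in> borel_measurable (M \<Otimes>\<^sub>M lborel)"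
    unfolding indicator_def atLeastAtMost_iff by measurable
  have dens: "(\<lambda>(\<omega>, u). indicator {0..?Y \<omega>} u / ennreal (integral\<^sup>L M ?Y)) = (\<lambda>z. top * (case z of (\<omega>, u) \<Rightarrow> indicator {0..?Y \<omega>} u))"
    unfolding Y by (auto simp: fun_eq_iff indicator_def)
  have "1 = (\<integral>\<^sup>+z. top * (case z of (\<omega>, u) \<Rightarrow> indicator {0..?Y \<omega>} u) *
      indicator (space (M \<Otimes>\<^sub>M lborel)) z \<partial>(M \<Otimes>\<^sub>M lborel))"
    unfolding assms[symmetric] length_biased_start_def dens
    by (rule emeasure_density[OF borel_measurable_times_ennreal[OF borel_measurable_const ind] sets.top])
  also have "\<dots> = (\<integral>\<^sup>+z. top * (case z of (\<omega>, u) \<Rightarrow> indicator {0..?Y \<omega>} u) \<partial>(M \<Otimes>\<^sub>M lborel))"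
    by (rule nn_integral_cong) simp
  also have "\<dots> = top * (\<integral>\<^sup>+z. (case z of (\<omega>, u) \<Rightarrow> indicator {0..?Y \<omega>} u) \<partial>(M \<Otimes>\<^sub>M lborel))"
    by (rule nn_integral_cmult[OF ind])
  finally show False
    by (simp add: ennreal_top_mult split: if_splits)
qed

end

text \<open>Convergence bounds the scaled tail by \<open>C + 1\<close> eventually, so the tails are
  dominated by a multiple of \<open>i powr (- p)\<close>, summable for \<open>1 < p\<close>. The
  strict inequality in the hypothesis accounts for the shift by \<open>Suc\<close>.\<close>

lemma suminf_tail_finite:
  assumes M: "prob_space M" and X: "X \<in> measurable M (count_space UNIV)" and p: "1 < p"
    and tail: "((\<lambda>t. t powr p * measure M {\<omega> \<in> space M. t < real (X \<omega>)}) \<longlongrightarrow> C) at_top"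
  shows "(\<Sum>i. emeasure M {\<omega> \<in> space M. i \<le> (X \<omega> :: nat)}) < top"
proof -
  interpret prob_space M by fact
  let ?g = "\<lambda>i. measure M {\<omega> \<in> space M. i \<le> X \<omega>}"
  have Suc: "{\<omega> \<in> space M. real i < real (X \<omega>)} = {\<omega> \<in> space M. Suc i \<le> X \<omega>}" for i
    by auto
  have "\<forall>\<^sub>F t in at_top. t powr p * measure M {\<omega> \<in> space M. t < real (X \<omega>)} < C + 1"
    using tail by (rule order_tendstoD) simp
  then have "\<forall>\<^sub>F i in sequentially. real i powr p * ?g (Suc i) < C + 1"
    unfolding Suc[symmetric] by (rule eventually_compose_filterlim[OF _ filterlim_real_sequentially])
  then have "\<forall>\<^sub>F i in sequentially. norm (?g (Suc i)) \<le> (C + 1) * real i powr (- p)"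
    using eventually_gt_at_top[of 0]
  proof eventually_elim
    case (elim i)
    then have "?g (Suc i) * real i powr p \<le> C + 1" by (simp add: mult.commute)
    moreover have "0 < real i powr p" using elim by simp
    ultimately have "?g (Suc i) \<le> (C + 1) / real i powr p" by (simp add: pos_le_divide_eq)
    then show ?case by (simp add: powr_minus divide_inverse)
  qed
  moreover have "summable (\<lambda>i. (C + 1) * real i powr (- p))"
    using p by (intro summable_mult) (simp add: summable_real_powr_iff)
  ultimately have "summable (\<lambda>i. ?g (Suc i))"
    by (rule summable_comparison_test_ev)
  then have "summable ?g" by (rule iffD1[OF summable_Suc_iff])
  then have "(\<Sum>i. ennreal (?g i)) \<noteq> top"
    by (rule ennreal_suminf_neq_top) simp
  then show ?thesis
    by (simp add: emeasure_eq_measure less_top)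
qed

text \<open>For a variable that is almost surely 0 the probability is 1 at every positive
  \<open>\<delta>\<close>. Multiplying the quotient by \<open>\<delta>\<close> then gives a function
  with both limits 1 and 0.\<close>

lemma not_AE_zero_of_small_probability:
  assumes M: "prob_space M" and X: "X \<in> borel_measurable M"
    and small: "((\<lambda>\<delta>. measure M {\<omega> \<in> space M. X \<omega> < \<delta>} / \<delta>) \<longlongrightarrow> (q :: real)) (at_right 0)"
  shows "\<not> (AE \<omega> in M. X \<omega> = 0)"
proof
  interpret prob_space M by fact
  assume zero: "AE \<omega> in M. X \<omega> = 0"
  have one: "measure M {\<omega> \<in> space M. X \<omega> < \<delta>} = 1" if "0 < \<delta>" for \<delta>
    using zero that X by (subst prob_Collect_eq_1) (auto elim: eventually_mono)
  have "((\<lambda>\<delta>. measure M {\<omega> \<in> space M. X \<omega> < \<delta>} / \<delta> * \<delta>) \<longlongrightarrow> q * 0) (at_right 0)"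
    by (intro tendsto_mult small tendsto_ident_at)
  moreover have "\<forall>\<^sub>F \<delta> in at_right (0 :: real). measure M {\<omega> \<in> space M. X \<omega> < \<delta>} / \<delta> * \<delta> = 1"
    using eventually_at_right_less[of 0] by eventually_elim (simp add: one)
  ultimately have "((\<lambda>_ :: real. 1 :: real) \<longlongrightarrow> q * 0) (at_right 0)"
    by (rule Lim_transform_eventually)
  then have "(1 :: real) = q * 0"
    by (rule tendsto_unique[OF trivial_limit_at_right_real tendsto_const])
  then show False by simp
qed

theorem theorem2:
  fixes M :: "'a measure"
    and Of :: "nat \<Rightarrow> 'a \<Rightarrow> real"
    and L :: "nat \<Rightarrow> 'a \<Rightarrow> nat"
    and R :: "nat \<Rightarrow> nat \<Rightarrow> 'a \<Rightarrow> real"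
    and p C q K T :: real
    and Q :: "('a \<times> real) measure"
    and P :: "'b measure"
    and W :: "nat \<Rightarrow> 'b \<Rightarrow> real set"
  assumes M: "prob_space M"
    and independent:
      "prob_space.indep_vars M (\<lambda>_. borel) (source_var Of L R) source_indices"
    and Of_ident: "\<And>i. 1 \<le> i \<Longrightarrow> distr M borel (Of i) = distr M borel (Of 1)"
    and Of_pos: "AE \<omega> in M. 0 < Of 1 \<omega>"
    and Of_sq: "integrable M (\<lambda>\<omega>. (Of 1 \<omega>)\<^sup>2)"
    and L_ident:
      "\<And>i. 1 \<le> i \<Longrightarrow> distr M (count_space UNIV) (L i) = distr M (count_space UNIV) (L 1)"
    and L_pos: "AE \<omega> in M. 1 \<le> L 1 \<omega>"
    and p: "1 < p" "p < 2" and C: "0 < C"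
    and L_tail:
      "((\<lambda>t. t powr p * measure M {\<omega> \<in> space M. t < real (L 1 \<omega>)}) \<longlongrightarrow> C) at_top"
    and R_ident: "\<And>i j. 1 \<le> i \<Longrightarrow> 1 \<le> j \<Longrightarrow> distr M borel (R i j) = distr M borel (R 1 1)"
    and R_nonneg: "AE \<omega> in M. 0 \<le> R 1 1 \<omega>"
    and R_sq: "integrable M (\<lambda>\<omega>. (R 1 1 \<omega>)\<^sup>2)"
    and R_small:
      "((\<lambda>\<delta>. measure M {\<omega> \<in> space M. R 1 1 \<omega> < \<delta>} / \<delta>) \<longlongrightarrow> q) (at_right 0)"
      "q \<le> K"
    and start: "Q = uniform_start M (first_cycle Of L R) \<or>
                Q = length_biased_start M (first_cycle Of L R)"
    and P: "prob_space P"
    and W_indep: "prob_space.indep_vars P (\<lambda>_. delta_trains) W {1..}"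
    and W_law: "\<And>i. 1 \<le> i \<Longrightarrow> distr P delta_trains (W i) = packet_law Q Of L R"
    and T: "0 < T"
  shows "(\<forall>t\<in>{0..T}. integrable P (\<lambda>\<omega>. (delta_integral 0 t (W 1 \<omega>))\<^sup>2)) \<and>
    (\<exists>(N :: (real \<Rightarrow> real) measure) G.
       centered_gaussian_process N {0..T} G
         (\<lambda>s t. integral\<^sup>L P (\<lambda>\<omega>. delta_integral 0 s (W 1 \<omega>) * delta_integral 0 t (W 1 \<omega>))
              - integral\<^sup>L P (\<lambda>\<omega>. delta_integral 0 s (W 1 \<omega>))
                * integral\<^sup>L P (\<lambda>\<omega>. delta_integral 0 t (W 1 \<omega>))) \<and>
       fdd_converges P (centered_aggregate P W) {0..T} N G)"
proof -
  interpret M: prob_space M by fact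
  have Load1: "Load 1 \<in> source_indices" and Gap1: "Gap 1 1 \<in> source_indices"
    by (auto simp: source_indices_def)
  have rv: "source_var Of L R n \<in> borel_measurable M" if "n \<in> source_indices" for n
    using independent that unfolding M.indep_vars_def2 by blast
  have "(\<lambda>\<omega>. real (L 1 \<omega>)) \<in> borel_measurable M"
    using rv[OF Load1] by simp
  then have "(\<lambda>\<omega>. nat \<lfloor>real (L 1 \<omega>)\<rfloor>) \<in> measurable M (count_space UNIV)"
    by measurable
  then have L1: "L 1 \<in> measurable M (count_space UNIV)"
    by simp
  have R1: "R 1 1 \<in> borel_measurable M"
    using rv[OF Gap1] by simp
  interpret packet_source M Of L R
    by (intro packet_source.intro packet_source_axioms.intro M independent Of_ident Of_pos R_ident R_nonneg
      not_AE_zero_of_small_probability[OF M R1 R_small(1)] suminf_tail_finite[OF M L1 p(1) L_tail])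
  interpret iid_sequence P delta_trains W
  proof (intro iid_sequence.intro iid_sequence_axioms.intro P W_indep)
    show "distr P delta_trains (W i) = distr P delta_trains (W 1)" if "1 \<le> i" for i
      using W_law[OF that] W_law[of 1] by simp
  qed
  define X where "X = (\<lambda>(\<omega>, u). shift_train u (train \<omega>))"
  have sets_Q: "sets Q = sets (M \<Otimes>\<^sub>M lborel)"
    using start by (auto simp: uniform_start_def length_biased_start_def)
  have X: "X \<in> measurable Q delta_trains"
    unfolding X_def using train_measurable by (simp only: measurable_cong_sets[OF sets_Q refl])
  have W1: "W 1 \<in> measurable P delta_trains"
    by (rule W_measurable) simp
  have law: "distr P delta_trains (W 1) = distr Q delta_trains X"
    using W_law[of 1] by (simp add: packet_law_def X_def)
  \<comment> \<open>The mass of \<open>Q\<close> is obtained backwards, from the law of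
    \<open>W 1\<close> being a probability measure. In the length-biased case this makes the
    normaliser nonzero, so that its reciprocal is finite.\<close>
  have "emeasure Q (space (M \<Otimes>\<^sub>M lborel)) = 1"
  proof -
    have "emeasure (distr P delta_trains (W 1)) (space delta_trains) = 1"
      using prob_space.emeasure_space_1[OF prob_space.prob_space_distr[OF P W1]] by simp
    then have "emeasure (distr Q delta_trains X) (space delta_trains) = 1"
      by (simp only: law)
    moreover have "X -` space delta_trains \<inter> space Q = space (M \<Otimes>\<^sub>M lborel)"
      using measurable_space[OF X] sets_eq_imp_space_eq[OF sets_Q] by auto
    ultimately show ?thesis
      using emeasure_distr[OF X sets.top] by (simp only:)
  qed
  then have Q2: "(\<integral>\<^sup>+z. ennreal ((delta_integral 0 t (X z))\<^sup>2) \<partial>Q) < top" if "0 \<le> t" for t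
    using start uniform_start_second_moment[OF that]
      length_biased_start_second_moment[OF that length_biased_start_normalizer]
    by (auto simp: X_def case_prod_beta)
  have sq: "integrable P (\<lambda>\<omega>. (delta_integral 0 t (W 1 \<omega>))\<^sup>2)" if t: "t \<in> {0..T}" for t
  proof (rule integrableI_bounded)
    have D: "delta_integral 0 t \<in> borel_measurable delta_trains"
      using t by (intro delta_integral_measurable) auto
    then have E: "(\<lambda>S. ennreal ((delta_integral 0 t S)\<^sup>2)) \<in> borel_measurable delta_trains"
      by measurable
    show "(\<lambda>\<omega>. (delta_integral 0 t (W 1 \<omega>))\<^sup>2) \<in> borel_measurable P"
      by (intro borel_measurable_power measurable_compose[OF W1 D])
    \<comment> \<open>The law on \<open>delta_trains\<close> is the only link between
      \<open>P\<close> and \<open>Q\<close>; window counts are measurable there, so the moment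
      carries over.\<close>
    have "(\<integral>\<^sup>+\<omega>. ennreal ((delta_integral 0 t (W 1 \<omega>))\<^sup>2) \<partial>P) =
        (\<integral>\<^sup>+S. ennreal ((delta_integral 0 t S)\<^sup>2) \<partial>distr P delta_trains (W 1))"
      by (rule nn_integral_distr[OF W1, symmetric]) (simp add: E)
    also have "\<dots> = (\<integral>\<^sup>+z. ennreal ((delta_integral 0 t (X z))\<^sup>2) \<partial>Q)"
      unfolding law by (rule nn_integral_distr[OF X]) (simp add: E)
    finally show "(\<integral>\<^sup>+\<omega>. ennreal (norm ((delta_integral 0 t (W 1 \<omega>))\<^sup>2)) \<partial>P) < \<infinity>"
      using Q2[of t] t by simp
  qed
  show ?thesis
    using fdd_central_limit[of "{0..T}" "\<lambda>t. delta_integral 0 t"] sq delta_integral_measurable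
    unfolding centered_aggregate_def[abs_def] aggregate_def[abs_def] by simp
qed

end
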